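(* Let $K$ be an algebraically closed field of characteristic $3$, $D=D(S_3)$ the Drinfel'd double over $K$ of the symmetric group on three letters, and $\mathcal Z^m(\Sigma_1)=\mathrm{Ext}^m_D(K,L)$ with $L=D^*$, for $m\ge0$. Then $\mathcal Z^0(\Sigma_1)\cong K\oplus K[\mathbb P^1_2]\oplus K[\mathbb P^1_3]$, and for $m>0$, $$\mathcal Z^m(\Sigma_1)\cong\begin{cases}K\oplus K[\mathbb P^1_3]&: m\equiv0\pmod 4\ \text{ or }\ m\equiv3\pmod4\\ K_{\chi_2}[\mathbb P^1_3]&: m\equiv1\pmod4\ \text{ or }\ m\equiv2\pmod4\end{cases}$$ as $\mathrm{SL}(2,\mathbb Z)$-modules.
   Context: For a finite group $G$ with unit $e$, $D(G)$ has basis $\delta_a\otimes b$ ($a,b\in G$), product $(\delta_a\otimes b)(\delta_c\otimes d)=\delta_{a,bcb^{-1}}\,\delta_a\otimes bd$, unit $\varepsilon\otimes e$ with $\varepsilon=\sum_a\delta_a$, and counit $\delta_a\otimes b\mapsto\delta_{a,e}$, which makes $K$ a (trivial) $D$-module. $L=D^*$ has the dual basis $u(a,b)$ ($a,b\in G$) and carries the left coadjoint action $(\varepsilon\otimes h).u(a,b)=u(hah^{-1},hbh^{-1})$, $(\delta_h\otimes e).u(a,b)=\delta_{h,\,b^{-1}aba^{-1}}\,u(a,b)$. The mapping class group $\Gamma_1$ of the torus $\Sigma_1$ is identified with $\mathrm{SL}(2,\mathbb Z)$ via its action on first homology. It acts on the derived block space $\mathcal Z^m(\Sigma_1)=\mathrm{Ext}^m_D(K,L)$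 as follows: the maps $\tilde{\mathfrak T}(u(c,d))=u(c,cd)$ and $\tilde{\mathfrak S}(u(c,d))=u(d,d^{-1}c^{-1}d)$ are $D$-linear automorphisms of $L$, and there is an action of $\mathrm{SL}(2,\mathbb Z)$ on $\mathrm{Ext}^m_D(K,L)$ in which $\begin{pmatrix}1&1\\0&1\end{pmatrix}$ acts by $\mathrm{Ext}^m_D(K,\tilde{\mathfrak T})$ and $\begin{pmatrix}0&-1\\1&0\end{pmatrix}$ acts by $\mathrm{Ext}^m_D(K,\tilde{\mathfrak S})$. $K$ denotes the trivial $\mathrm{SL}(2,\mathbb Z)$-module. For a prime $n$, $\mathbb P^1_n$ is the set of one-dimensional subspaces of $\mathbb Z_n^2$, $\mathbb{Z}_n=\mathbb{Z}/n\mathbb{Z}$, and $K[\mathbb P^1_n]$ is the permutation module with basis $\mathbb P^1_n$, on which $\mathrm{SL}(2,\mathbb Z)$ acts through its natural action on $\mathbb Z_n^2$ modulo $n$. Let $\Omega^{1,3}=\mathbb Z_3^2\setminus\{0\}$; $\mathrm{SL}(2,\mathbb Z)$ and $\mathbb Z_3^\times=\{\bar1,-\bar1\}$ act on $K[\Omega^{1,3}]$ (the vector space with basis $\Omega^{1,3}$) by permuting the basis vectors. $\chi_2\colon\mathbb Z_3^\times\to K^\times$ is the character with $\chi_2(-\bar1)=-1$, and $K_{\chi_2}[\mathbb P^1_3]=\{v\in K[\Omega^{1,3}]\mid\bar k v=\chi_2(\bar k)v\text{ for all }\bar k\in\mathbb Z_3^\times\}$, a four-dimensional $\mathrm{SL}(2,\mathbb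 Z)$-submodule of $K[\Omega^{1,3}]$. *)

theory Defs
  imports "HOL-Algebra.Algebra" "HOL-Algebra.Algebraic_Closure_Type" "HOL-Analysis.Analysis"
begin

section \<open>Modules over a not necessarily commutative ring\<close>

text \<open>The library locale \<^locale>\<open>module\<close> assumes a commutative base ring, hence the
  following variant; it uses the same record type. The fields \<^const>\<open>monoid.mult\<close> and
  \<^const>\<open>monoid.one\<close> of a module record carry no meaning and are left undefined below, except
  in the record of an algebra.\<close>

definition left_module :: "('r, 'b) ring_scheme \<Rightarrow> ('r, 'm, 'c) module_scheme \<Rightarrow> bool" where
  "left_module R M \<longleftrightarrow> ring R \<and> abelian_group M \<and>
     (\<forall>a\<in>carrier R. \<forall>x\<in>carrier M. a \<odot>\<^bsub>M\<^esub> x \<in> carrier M) \<and>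
     (\<forall>a\<in>carrier R. \<forall>b\<in>carrier R. \<forall>x\<in>carrier M.
        (a \<oplus>\<^bsub>R\<^esub> b) \<odot>\<^bsub>M\<^esub> x = a \<odot>\<^bsub>M\<^esub> x \<oplus>\<^bsub>M\<^esub> b \<odot>\<^bsub>M\<^esub> x) \<and>
     (\<forall>a\<in>carrier R. \<forall>x\<in>carrier M. \<forall>y\<in>carrier M.
        a \<odot>\<^bsub>M\<^esub> (x \<oplus>\<^bsub>M\<^esub> y) = a \<odot>\<^bsub>M\<^esub> x \<oplus>\<^bsub>M\<^esub> a \<odot>\<^bsub>M\<^esub> y) \<and>
     (\<forall>a\<in>carrier R. \<forall>b\<in>carrier R. \<forall>x\<in>carrier M.
        (a \<otimes>\<^bsub>R\<^esub> b) \<odot>\<^bsub>M\<^esub> x = a \<odot>\<^bsub>M\<^esub> (b \<odot>\<^bsub>M\<^esub> x)) \<and>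
     (\<forall>x\<in>carrier M. \<one>\<^bsub>R\<^esub> \<odot>\<^bsub>M\<^esub> x = x)"

definition module_hom ::
  "('r, 'b) ring_scheme \<Rightarrow> ('r, 'm, 'c) module_scheme \<Rightarrow> ('r, 'n, 'd) module_scheme
     \<Rightarrow> ('m \<Rightarrow> 'n) \<Rightarrow> bool" where
  "module_hom R M N f \<longleftrightarrow> f \<in> carrier M \<rightarrow> carrier N \<and>
     (\<forall>x\<in>carrier M. \<forall>y\<in>carrier M. f (x \<oplus>\<^bsub>M\<^esub> y) = f x \<oplus>\<^bsub>N\<^esub> f y) \<and>
     (\<forall>a\<in>carrier R. \<forall>x\<in>carrier M. f (a \<odot>\<^bsub>M\<^esub> x) = a \<odot>\<^bsub>N\<^esub> f x)"

definition free_module :: "('r, 'b) ring_scheme \<Rightarrow> 'x set \<Rightarrow> ('r, 'x \<Rightarrow> 'r) module" where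
  "free_module R I = \<lparr>
     carrier = {f. (\<forall>x\<in>I. f x \<in> carrier R) \<and> (\<forall>x. x \<notin> I \<longrightarrow> f x = \<zero>\<^bsub>R\<^esub>) \<and>
                   finite {x. f x \<noteq> \<zero>\<^bsub>R\<^esub>}},
     monoid.mult = undefined, one = undefined,
     ring.zero = (\<lambda>_. \<zero>\<^bsub>R\<^esub>), add = (\<lambda>f g x. f x \<oplus>\<^bsub>R\<^esub> g x),
     module.smult = (\<lambda>a f x. a \<otimes>\<^bsub>R\<^esub> f x) \<rparr>"

text \<open>A module is projective if it is a direct summand of a free module. Basis sets inside the
  element type of \<open>M\<close> suffice: if \<open>M\<close> is a direct summand of any free module, then the canonical
  map from the free module on \<^term>\<open>carrier M\<close> onto \<open>M\<close> splits.\<close>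

definition projective_module :: "('r, 'b) ring_scheme \<Rightarrow> ('r, 'm) module \<Rightarrow> bool" where
  "projective_module R M \<longleftrightarrow> left_module R M \<and>
     (\<exists>(I :: 'm set) i p. module_hom R M (free_module R I) i \<and>
        module_hom R (free_module R I) M p \<and> (\<forall>x\<in>carrier M. p (i x) = x))"

text \<open>The resolution is \<open>\<dots> \<rightarrow> P 2 \<rightarrow> P 1 \<rightarrow> P 0 \<rightarrow> N \<rightarrow> 0\<close>, with \<open>d n\<close> mapping \<open>P (n + 1)\<close> to \<open>P n\<close>
  and augmentation \<open>e\<close>.\<close>

definition projective_resolution ::
  "('r, 'b) ring_scheme \<Rightarrow> (nat \<Rightarrow> ('r, 'p) module) \<Rightarrow> (nat \<Rightarrow> 'p \<Rightarrow> 'p) \<Rightarrow> ('p \<Rightarrow> 'n)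
     \<Rightarrow> ('r, 'n) module \<Rightarrow> bool" where
  "projective_resolution R P d e N \<longleftrightarrow>
     (\<forall>n. projective_module R (P n)) \<and> left_module R N \<and>
     (\<forall>n. module_hom R (P (Suc n)) (P n) (d n)) \<and> module_hom R (P 0) N e \<and>
     e ` carrier (P 0) = carrier N \<and>
     d 0 ` carrier (P 1) = {x \<in> carrier (P 0). e x = \<zero>\<^bsub>N\<^esub>} \<and>
     (\<forall>n. d (Suc n) ` carrier (P (Suc (Suc n))) =
            {x \<in> carrier (P (Suc n)). d n x = \<zero>\<^bsub>P n\<^esub>})"


section \<open>Ext over an algebra\<close>

text \<open>An algebra \<open>A\<close> over \<open>K\<close> is given by a module record with meaningful ring part and
  \<^const>\<open>module.smult\<close> the scalar multiplication by \<open>K\<close>. A scalar \<open>k\<close> acts on an \<open>A\<close>-module as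
  \<open>k \<odot> \<one>\<close>.\<close>

definition hom_space ::
  "('k, 'a) module \<Rightarrow> ('a, 'p) module \<Rightarrow> ('a, 'm) module \<Rightarrow> ('k, 'p \<Rightarrow> 'm) module" where
  "hom_space A P M = \<lparr>
     carrier = {f \<in> extensional (carrier P). module_hom A P M f},
     monoid.mult = undefined, one = undefined,
     ring.zero = (\<lambda>x\<in>carrier P. \<zero>\<^bsub>M\<^esub>),
     add = (\<lambda>f g. \<lambda>x\<in>carrier P. f x \<oplus>\<^bsub>M\<^esub> g x),
     module.smult = (\<lambda>k f. \<lambda>x\<in>carrier P. (k \<odot>\<^bsub>A\<^esub> \<one>\<^bsub>A\<^esub>) \<odot>\<^bsub>M\<^esub> f x) \<rparr>"

definition quotient_module :: "('k, 'v) module \<Rightarrow> 'v set \<Rightarrow> ('k, 'v set) module" where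
  "quotient_module V B = \<lparr>
     carrier = a_rcosets\<^bsub>V\<^esub> B,
     monoid.mult = undefined, one = undefined,
     ring.zero = B, add = set_add V,
     module.smult = (\<lambda>k C. \<Union>f\<in>C. B +>\<^bsub>V\<^esub> (k \<odot>\<^bsub>V\<^esub> f)) \<rparr>"

definition cocycles ::
  "('k, 'a) module \<Rightarrow> (nat \<Rightarrow> ('a, 'p) module) \<Rightarrow> (nat \<Rightarrow> 'p \<Rightarrow> 'p) \<Rightarrow> nat \<Rightarrow> ('a, 'm) module
     \<Rightarrow> ('p \<Rightarrow> 'm) set" where
  "cocycles A P d n M =
     {f \<in> carrier (hom_space A (P n) M). \<forall>x\<in>carrier (P (Suc n)). f (d n x) = \<zero>\<^bsub>M\<^esub>}"

fun coboundaries ::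
  "('k, 'a) module \<Rightarrow> (nat \<Rightarrow> ('a, 'p) module) \<Rightarrow> (nat \<Rightarrow> 'p \<Rightarrow> 'p) \<Rightarrow> nat \<Rightarrow> ('a, 'm) module
     \<Rightarrow> ('p \<Rightarrow> 'm) set" where
  "coboundaries A P d 0 M = {\<zero>\<^bsub>hom_space A (P 0) M\<^esub>}"
| "coboundaries A P d (Suc n) M =
     (\<lambda>f. compose (carrier (P (Suc n))) f (d n)) ` carrier (hom_space A (P n) M)"

text \<open>\<open>Ext_space A P d n M\<close> is \<open>Ext\<^sup>n\<^sub>A(N, M)\<close>, computed from a projective resolution \<open>(P, d)\<close>
  of \<open>N\<close>; \<open>Ext_map A P d n M M' g\<close> is the map induced by \<open>g : M \<rightarrow> M'\<close>.\<close>

definition Ext_space ::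
  "('k, 'a) module \<Rightarrow> (nat \<Rightarrow> ('a, 'p) module) \<Rightarrow> (nat \<Rightarrow> 'p \<Rightarrow> 'p) \<Rightarrow> nat \<Rightarrow> ('a, 'm) module
     \<Rightarrow> ('k, ('p \<Rightarrow> 'm) set) module" where
  "Ext_space A P d n M =
     quotient_module (hom_space A (P n) M \<lparr>carrier := cocycles A P d n M\<rparr>) (coboundaries A P d n M)"

definition Ext_map ::
  "('k, 'a) module \<Rightarrow> (nat \<Rightarrow> ('a, 'p) module) \<Rightarrow> (nat \<Rightarrow> 'p \<Rightarrow> 'p) \<Rightarrow> nat \<Rightarrow> ('a, 'm) module
     \<Rightarrow> ('a, 'm') module \<Rightarrow> ('m \<Rightarrow> 'm') \<Rightarrow> ('p \<Rightarrow> 'm) set \<Rightarrow> ('p \<Rightarrow> 'm') set" where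
  "Ext_map A P d n M M' g C =
     (\<Union>f\<in>C. coboundaries A P d n M' +>\<^bsub>hom_space A (P n) M'\<^esub> compose (carrier (P n)) g f)"


section \<open>Vector spaces with a given basis\<close>

text \<open>The vector space with basis \<open>I\<close> consists of the finitely supported functions on \<open>I\<close>,
  extended by zero.\<close>

definition span_on :: "'x set \<Rightarrow> ('k::field, 'x \<Rightarrow> 'k) module" where
  "span_on I = \<lparr>
     carrier = {f. (\<forall>x. x \<notin> I \<longrightarrow> f x = 0) \<and> finite {x. f x \<noteq> 0}},
     monoid.mult = undefined, one = undefined,
     ring.zero = (\<lambda>_. 0), add = (\<lambda>f g x. f x + g x), module.smult = (\<lambda>k f x. k * f x) \<rparr>"

definition basis_vec :: "'x \<Rightarrow> 'x \<Rightarrow> 'k::field" where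
  "basis_vec x = (\<lambda>y. if y = x then 1 else 0)"

text \<open>The linear extension of an assignment \<open>x \<mapsto> w x\<close> on basis vectors.\<close>

definition lin_ext :: "('x \<Rightarrow> 'y \<Rightarrow> 'k) \<Rightarrow> ('x \<Rightarrow> 'k::field) \<Rightarrow> 'y \<Rightarrow> 'k" where
  "lin_ext w f = (\<lambda>y. \<Sum>x | f x \<noteq> 0. f x * w x y)"


section \<open>The Drinfel'd double of a finite group\<close>

text \<open>The function \<open>f\<close> stands for the sum of all \<open>f (a, b) (\<delta>\<^sub>a \<otimes> b)\<close>.\<close>

definition drinfeld_double :: "'g monoid \<Rightarrow> ('k::field, 'g \<times> 'g \<Rightarrow> 'k) module" where
  "drinfeld_double G = (span_on (carrier G \<times> carrier G)) \<lparr>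
     monoid.mult := (\<lambda>f g. lin_ext (\<lambda>(a, b). lin_ext (\<lambda>(c, d).
        if a = b \<otimes>\<^bsub>G\<^esub> c \<otimes>\<^bsub>G\<^esub> inv\<^bsub>G\<^esub> b then basis_vec (a, b \<otimes>\<^bsub>G\<^esub> d) else (\<lambda>_. 0)) g) f),
     one := (\<lambda>(a, b). if a \<in> carrier G \<and> b = \<one>\<^bsub>G\<^esub> then 1 else 0) \<rparr>"

definition double_counit :: "'g monoid \<Rightarrow> ('g \<times> 'g \<Rightarrow> 'k) \<Rightarrow> 'k::field" where
  "double_counit G f = (\<Sum>b\<in>carrier G. f (\<one>\<^bsub>G\<^esub>, b))"

definition trivial_double_module :: "'g monoid \<Rightarrow> ('g \<times> 'g \<Rightarrow> 'k::field, 'k) module" where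
  "trivial_double_module G = \<lparr>
     carrier = UNIV, monoid.mult = undefined, one = undefined,
     ring.zero = 0, add = (+), module.smult = (\<lambda>f x. double_counit G f * x) \<rparr>"

text \<open>The dual space, with left coadjoint action; here \<open>\<phi>\<close> stands for the sum of all
  \<open>\<phi> (a, b) u(a, b)\<close>, that is, \<open>\<phi> (a, b)\<close> is the value of the linear form on \<open>\<delta>\<^sub>a \<otimes> b\<close>.
  The action of \<open>\<delta>\<^sub>h \<otimes> k = (\<delta>\<^sub>h \<otimes> e)(\<epsilon> \<otimes> k)\<close> is composed of the actions of the two factors.\<close>

definition coadjoint_group :: "'g monoid \<Rightarrow> 'g \<Rightarrow> ('g \<times> 'g \<Rightarrow> 'k) \<Rightarrow> 'g \<times> 'g \<Rightarrow> 'k::field" where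
  "coadjoint_group G h = lin_ext (\<lambda>(a, b).
     basis_vec (h \<otimes>\<^bsub>G\<^esub> a \<otimes>\<^bsub>G\<^esub> inv\<^bsub>G\<^esub> h, h \<otimes>\<^bsub>G\<^esub> b \<otimes>\<^bsub>G\<^esub> inv\<^bsub>G\<^esub> h))"

definition coadjoint_delta :: "'g monoid \<Rightarrow> 'g \<Rightarrow> ('g \<times> 'g \<Rightarrow> 'k) \<Rightarrow> 'g \<times> 'g \<Rightarrow> 'k::field" where
  "coadjoint_delta G h = lin_ext (\<lambda>(a, b).
     if h = inv\<^bsub>G\<^esub> b \<otimes>\<^bsub>G\<^esub> a \<otimes>\<^bsub>G\<^esub> b \<otimes>\<^bsub>G\<^esub> inv\<^bsub>G\<^esub> a then basis_vec (a, b) else (\<lambda>_. 0))"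

definition dual_double :: "'g monoid \<Rightarrow> ('g \<times> 'g \<Rightarrow> 'k::field, 'g \<times> 'g \<Rightarrow> 'k) module" where
  "dual_double G = \<lparr>
     carrier = carrier (span_on (carrier G \<times> carrier G)),
     monoid.mult = undefined, one = undefined,
     ring.zero = (\<lambda>_. 0), add = (\<lambda>\<phi> \<psi> x. \<phi> x + \<psi> x),
     module.smult = (\<lambda>f \<phi>. lin_ext (\<lambda>(h, k). coadjoint_delta G h (coadjoint_group G k \<phi>)) f) \<rparr>"

definition T_map :: "'g monoid \<Rightarrow> ('g \<times> 'g \<Rightarrow> 'k) \<Rightarrow> 'g \<times> 'g \<Rightarrow> 'k::field" where
  "T_map G = lin_ext (\<lambda>(c, d). basis_vec (c, c \<otimes>\<^bsub>G\<^esub> d))"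

definition S_map :: "'g monoid \<Rightarrow> ('g \<times> 'g \<Rightarrow> 'k) \<Rightarrow> 'g \<times> 'g \<Rightarrow> 'k::field" where
  "S_map G = lin_ext (\<lambda>(c, d). basis_vec (d, inv\<^bsub>G\<^esub> d \<otimes>\<^bsub>G\<^esub> inv\<^bsub>G\<^esub> c \<otimes>\<^bsub>G\<^esub> d))"


section \<open>Modules over SL(2,Z)\<close>

definition SL2Z :: "(int ^ 2 ^ 2) monoid" where
  "SL2Z = \<lparr> carrier = {A. det A = 1}, monoid.mult = (**), one = mat 1 \<rparr>"

definition T_mat :: "int ^ 2 ^ 2" where
  "T_mat = vector [vector [1, 1], vector [0, 1]]"

definition S_mat :: "int ^ 2 ^ 2" where
  "S_mat = vector [vector [0, -1], vector [1, 0]]"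

text \<open>A representation is a pair of a vector space and an action on it.\<close>

type_synonym ('g, 'k, 'v) rep = "('k, 'v) module \<times> ('g \<Rightarrow> 'v \<Rightarrow> 'v)"

definition linear_rep :: "'g monoid \<Rightarrow> ('g, 'k::field, 'v) rep \<Rightarrow> bool" where
  "linear_rep G = (\<lambda>(V, \<rho>). module ring_of_type_algebra V \<and>
     (\<forall>g\<in>carrier G. module_hom ring_of_type_algebra V V (\<rho> g)) \<and>
     (\<forall>x\<in>carrier V. \<rho> \<one>\<^bsub>G\<^esub> x = x) \<and>
     (\<forall>g\<in>carrier G. \<forall>h\<in>carrier G. \<forall>x\<in>carrier V. \<rho> (g \<otimes>\<^bsub>G\<^esub> h) x = \<rho> g (\<rho> h x)))"

definition rep_iso ::
  "'g monoid \<Rightarrow> ('g, 'k::field, 'v) rep \<Rightarrow> ('g, 'k, 'w) rep \<Rightarrow> bool" where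
  "rep_iso G = (\<lambda>(V, \<rho>) (W, \<sigma>). linear_rep G (V, \<rho>) \<and> linear_rep G (W, \<sigma>) \<and>
     (\<exists>\<Phi>. module_hom ring_of_type_algebra V W \<Phi> \<and> bij_betw \<Phi> (carrier V) (carrier W) \<and>
        (\<forall>g\<in>carrier G. \<forall>x\<in>carrier V. \<Phi> (\<rho> g x) = \<sigma> g (\<Phi> x))))"

definition rep_sum ::
  "('g, 'k, 'v) rep \<Rightarrow> ('g, 'k, 'w) rep \<Rightarrow> ('g, 'k, 'v \<times> 'w) rep" (infixr "\<oplus>\<^sub>r" 65) where
  "rep_sum = (\<lambda>(V, \<rho>) (W, \<sigma>). (
     \<lparr> carrier = carrier V \<times> carrier W, monoid.mult = undefined, one = undefined,
       ring.zero = (\<zero>\<^bsub>V\<^esub>, \<zero>\<^bsub>W\<^esub>),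
       add = (\<lambda>(x, y) (x', y'). (x \<oplus>\<^bsub>V\<^esub> x', y \<oplus>\<^bsub>W\<^esub> y')),
       module.smult = (\<lambda>k (x, y). (k \<odot>\<^bsub>V\<^esub> x, k \<odot>\<^bsub>W\<^esub> y)) \<rparr>,
     \<lambda>g (x, y). (\<rho> g x, \<sigma> g y)))"

definition trivial_rep :: "('g, 'k::field, 'k) rep" where
  "trivial_rep = (
     \<lparr> carrier = UNIV, monoid.mult = undefined, one = undefined,
       ring.zero = 0, add = (+), module.smult = (*) \<rparr>,
     \<lambda>_ x. x)"

text \<open>Here \<open>act\<close> is an action of the group on the finite set \<open>I\<close>.\<close>

definition perm_rep :: "('g \<Rightarrow> 'x \<Rightarrow> 'x) \<Rightarrow> 'x set \<Rightarrow> ('g, 'k::field, 'x \<Rightarrow> 'k) rep" where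
  "perm_rep act I = (span_on I, \<lambda>g. lin_ext (\<lambda>x. basis_vec (act g x)))"

text \<open>The action of SL(2,Z) on column vectors modulo \<open>n\<close>, where the type \<open>'n\<close> is to be a numeral
  type such as \<^typ>\<open>2\<close> or \<^typ>\<open>3\<close>, whose ring structure is that of the integers
  modulo \<open>n\<close>.\<close>

definition mat_act :: "int ^ 2 ^ 2 \<Rightarrow> 'n::comm_ring_1 ^ 2 \<Rightarrow> 'n ^ 2" where
  "mat_act A v = (\<chi> i j. of_int (A $ i $ j)) *v v"

definition proj_line :: "('n::comm_ring_1 ^ 2) set set" where
  "proj_line = {range (\<lambda>c. c *s v) | v. v \<noteq> 0}"

definition proj_line_rep ::
  "'n::comm_ring_1 itself \<Rightarrow> (int ^ 2 ^ 2, 'k::field, ('n ^ 2) set \<Rightarrow> 'k) rep" where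
  "proj_line_rep TYPE('n) = perm_rep (\<lambda>A l. mat_act A ` l) proj_line"

definition chi2 :: "3 \<Rightarrow> 'k::field" where
  "chi2 c = (if c = - 1 then - 1 else 1)"

definition twisted_proj_line_rep :: "(int ^ 2 ^ 2, 'k::field, 3 ^ 2 \<Rightarrow> 'k) rep" where
  "twisted_proj_line_rep = (let \<Omega> = UNIV - {0} in
     (span_on \<Omega> \<lparr> carrier := {v \<in> carrier (span_on \<Omega>).
        \<forall>c\<in>{1, - 1}. lin_ext (\<lambda>x. basis_vec (c *s x)) v = (\<lambda>x. chi2 c * v x)} \<rparr>,
      snd (perm_rep mat_act \<Omega>)))"


section \<open>The mapping class group action on the derived block space of the torus\<close>

text \<open>For \<open>(P, d)\<close> a projective resolution of the trivial module. The two matrices generate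
  SL(2,Z), so that there is at most one such action.\<close>

definition torus_action ::
  "'g monoid \<Rightarrow> (nat \<Rightarrow> ('g \<times> 'g \<Rightarrow> 'k::field, 'p) module) \<Rightarrow> (nat \<Rightarrow> 'p \<Rightarrow> 'p) \<Rightarrow> nat
     \<Rightarrow> (int ^ 2 ^ 2 \<Rightarrow> ('p \<Rightarrow> 'g \<times> 'g \<Rightarrow> 'k) set \<Rightarrow> ('p \<Rightarrow> 'g \<times> 'g \<Rightarrow> 'k) set) \<Rightarrow> bool" where
  "torus_action G P d m \<rho> \<longleftrightarrow>
     (let D = drinfeld_double G; L = dual_double G; Z = Ext_space D P d m L in
      linear_rep SL2Z (Z, \<rho>) \<and>
      (\<forall>x\<in>carrier Z. \<rho> T_mat x = Ext_map D P d m L L (T_map G) x) \<and>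
      (\<forall>x\<in>carrier Z. \<rho> S_mat x = Ext_map D P d m L L (S_map G) x))"

end

theory Submission
  imports Defs
begin

text \<open>Why the theorem holds. The trivial module of \<open>D = D(G)\<close> sits at the unit \<open>e\<close> of \<open>G\<close>: \<open>\<delta>\<^sub>e\<close> acts on it
  as the identity. Therefore \<open>Ext\<^sub>D(K, L)\<close> only sees the part \<open>\<delta>\<^sub>e L\<close>, which is the permutation module
  on the pairs of commuting elements of \<open>G\<close> with simultaneous conjugation, and it is the cohomology of
  \<open>G\<close> with these coefficients. For \<open>G = S\<^sub>3\<close>, with a rotation \<open>s\<close> of order 3 and a reflection \<open>t\<close>, there
  are two kinds of commuting pairs. The pairs of rotations are a copy of \<open>Z\<^sub>3\<^sup>2\<close>, on which \<open>s\<close> acts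
  trivially and \<open>t\<close> as \<open>-1\<close>. The other pairs are, for each of the three reflections, the nonzero
  vectors of a copy of \<open>Z\<^sub>2\<^sup>2\<close>; conjugation by \<open>s\<close> permutes the three copies freely.

  In characteristic 3 the trivial module of \<open>K S\<^sub>3\<close> has a projective resolution of period 4. Its modules
  are the left ideals generated by the idempotents \<open>(1 \<plusminus> t)/2\<close> in the order \<open>+ - - +\<close>, and its
  differentials are right multiplications by \<open>s - s\<^sup>2\<close> and \<open>1 + s + s\<^sup>2\<close> in turn
  (\<open>double_cyclic_resolution\<close>). A cochain is then a vector \<open>v\<close> of \<open>L\<close> fixed by the idempotent, and the
  cohomology consists of the vectors killed by one differential modulo the image of the preceding
  one. On functions on \<open>Z\<^sub>3\<^sup>2\<close> both differentials vanish, so all even, respectively odd, functions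
  survive. On the free part the complex is exact except in degree 0, where the functions that do not
  depend on the reflection remain (\<open>eps_cocycles_iff\<close>, \<open>eps_coboundaries_iff\<close>). Even functions on
  \<open>Z\<^sub>3\<^sup>2\<close> are a value at 0 and a function on \<open>P\<^sup>1\<^sub>3\<close>; odd functions are the twisted module; functions on
  \<open>Z\<^sub>2\<^sup>2 - {0}\<close> are functions on \<open>P\<^sup>1\<^sub>2\<close>. The maps \<open>T\<close> and \<open>S\<close> permute commuting pairs exactly as the two
  matrices permute the vectors of exponents.

  The resolution \<open>P\<close> of the theorem is arbitrary. The comparison theorem of homological algebra,
  carried out by hand for the periodic resolution, shows that a cocycle on \<open>P\<^sub>m\<close> is determined up to
  coboundaries by its value at a single element \<open>p\<^sub>m\<close> (\<open>cocycle_evaluation\<close>). Composing this value with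
  the passage to functions on lines gives a linear bijection \<open>\<Psi>\<close> from Ext onto the asserted module that
  intertwines \<open>T\<close> and \<open>S\<close> with their matrices (\<open>Ext_iso\<close>). Since the two matrices generate
  \<open>SL(2,Z)\<close>, the action exists by transport along \<open>\<Psi>\<close>, and \<open>\<Psi>\<close> is an isomorphism for every action with
  the prescribed generators (\<open>rep_via_generators\<close>).\<close>

section \<open>Left modules and lifting along projective modules\<close>

lemma (in abelian_group) add_diff_distrib:
  assumes "a \<in> carrier G" "b \<in> carrier G" "c \<in> carrier G" "d \<in> carrier G"
  shows "(a \<oplus> b) \<ominus> (c \<oplus> d) = (a \<ominus> c) \<oplus> (b \<ominus> d)"
proof -
  have "(a \<oplus> b) \<ominus> (c \<oplus> d) = (a \<oplus> b) \<oplus> (\<ominus> c \<oplus> \<ominus> d)"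
    using assms by (simp add: a_minus_def minus_add)
  also have "\<dots> = (a \<oplus> \<ominus> c) \<oplus> (b \<oplus> \<ominus> d)"
    using assms by (simp add: a_ac)
  finally show ?thesis by (simp add: a_minus_def)
qed

text \<open>The predicate \<open>left_module\<close> as a locale, so that the facts on rings and abelian groups are available
  for both structures by interpretation.\<close>

locale left_mod = R?: ring R + M?: abelian_group M
  for R :: "('r, 'b) ring_scheme" (structure) and M :: "('r, 'm, 'c) module_scheme" (structure) +
  assumes smult_closed [simp, intro]:
      "a \<in> carrier R \<Longrightarrow> x \<in> carrier M \<Longrightarrow> a \<odot>\<^bsub>M\<^esub> x \<in> carrier M"
    and smult_l_distr: "a \<in> carrier R \<Longrightarrow> b \<in> carrier R \<Longrightarrow> x \<in> carrier M \<Longrightarrow>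
      (a \<oplus> b) \<odot>\<^bsub>M\<^esub> x = a \<odot>\<^bsub>M\<^esub> x \<oplus>\<^bsub>M\<^esub> b \<odot>\<^bsub>M\<^esub> x"
    and smult_r_distr: "a \<in> carrier R \<Longrightarrow> x \<in> carrier M \<Longrightarrow> y \<in> carrier M \<Longrightarrow>
      a \<odot>\<^bsub>M\<^esub> (x \<oplus>\<^bsub>M\<^esub> y) = a \<odot>\<^bsub>M\<^esub> x \<oplus>\<^bsub>M\<^esub> a \<odot>\<^bsub>M\<^esub> y"
    and smult_assoc: "a \<in> carrier R \<Longrightarrow> b \<in> carrier R \<Longrightarrow> x \<in> carrier M \<Longrightarrow>
      (a \<otimes> b) \<odot>\<^bsub>M\<^esub> x = a \<odot>\<^bsub>M\<^esub> (b \<odot>\<^bsub>M\<^esub> x)"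
    and smult_one [simp]: "x \<in> carrier M \<Longrightarrow> \<one> \<odot>\<^bsub>M\<^esub> x = x"

lemma left_mod_iff: "left_mod R M \<longleftrightarrow> left_module R M"
proof
  assume "left_mod R M"
  then interpret left_mod R M .
  show "left_module R M"
    unfolding left_module_def
    by (simp add: R.ring_axioms M.abelian_group_axioms smult_l_distr smult_r_distr smult_assoc)
next
  assume "left_module R M"
  then show "left_mod R M"
    unfolding left_module_def by (intro left_mod.intro left_mod_axioms.intro) simp_all
qed

context left_mod
begin

lemma smult_r_null [simp]: 
  assumes "a \<in> carrier R" shows "a \<odot>\<^bsub>M\<^esub> \<zero>\<^bsub>M\<^esub> = \<zero>\<^bsub>M\<^esub>"
proof -
  have "a \<odot>\<^bsub>M\<^esub> \<zero>\<^bsub>M\<^esub> = a \<odot>\<^bsub>M\<^esub> \<zero>\<^bsub>M\<^esub> \<oplus>\<^bsub>M\<^esub> a \<odot>\<^bsub>M\<^esub> \<zero>\<^bsub>M\<^esub>"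
    using smult_r_distr[OF assms M.zero_closed M.zero_closed] by simp
  then show ?thesis using assms M.add.l_cancel_one' by blast
qed

lemma smult_l_null [simp]:
  assumes "x \<in> carrier M" shows "\<zero> \<odot>\<^bsub>M\<^esub> x = \<zero>\<^bsub>M\<^esub>"
proof -
  have "\<zero> \<odot>\<^bsub>M\<^esub> x = \<zero> \<odot>\<^bsub>M\<^esub> x \<oplus>\<^bsub>M\<^esub> \<zero> \<odot>\<^bsub>M\<^esub> x"
    using smult_l_distr[OF R.zero_closed R.zero_closed assms] by simp
  then show ?thesis using assms M.add.l_cancel_one' by blast
qed

lemma smult_r_minus: 
  assumes "a \<in> carrier R" "x \<in> carrier M" shows "a \<odot>\<^bsub>M\<^esub> (\<ominus>\<^bsub>M\<^esub> x) = \<ominus>\<^bsub>M\<^esub> (a \<odot>\<^bsub>M\<^esub> x)"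
proof -
  have "a \<odot>\<^bsub>M\<^esub> (\<ominus>\<^bsub>M\<^esub> x) \<oplus>\<^bsub>M\<^esub> a \<odot>\<^bsub>M\<^esub> x = \<zero>\<^bsub>M\<^esub>"
    using smult_r_distr[OF assms(1) M.a_inv_closed[OF assms(2)] assms(2)] assms by (simp add: M.l_neg)
  then show ?thesis using M.minus_equality assms by simp
qed

lemma smult_r_diff: "a \<in> carrier R \<Longrightarrow> x \<in> carrier M \<Longrightarrow> y \<in> carrier M \<Longrightarrow>
    a \<odot>\<^bsub>M\<^esub> (x \<ominus>\<^bsub>M\<^esub> y) = a \<odot>\<^bsub>M\<^esub> x \<ominus>\<^bsub>M\<^esub> a \<odot>\<^bsub>M\<^esub> y"
  by (simp add: a_minus_def smult_r_distr smult_r_minus)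

lemma smult_l_minus:
  assumes "a \<in> carrier R" "x \<in> carrier M" shows "(\<ominus> a) \<odot>\<^bsub>M\<^esub> x = \<ominus>\<^bsub>M\<^esub> (a \<odot>\<^bsub>M\<^esub> x)"
proof -
  have "(\<ominus> a) \<odot>\<^bsub>M\<^esub> x \<oplus>\<^bsub>M\<^esub> a \<odot>\<^bsub>M\<^esub> x = \<zero>\<^bsub>M\<^esub>"
    using smult_l_distr[OF R.a_inv_closed[OF assms(1)] assms] assms by (simp add: R.l_neg)
  then show ?thesis using M.minus_equality assms by simp
qed

lemma smult_l_diff: "a \<in> carrier R \<Longrightarrow> b \<in> carrier R \<Longrightarrow> x \<in> carrier M \<Longrightarrow>
    (a \<ominus> b) \<odot>\<^bsub>M\<^esub> x = a \<odot>\<^bsub>M\<^esub> x \<ominus>\<^bsub>M\<^esub> b \<odot>\<^bsub>M\<^esub> x"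
  by (simp add: a_minus_def smult_l_distr smult_l_minus)

end

definition regular_module :: "('r, 'b) ring_scheme \<Rightarrow> ('r, 'r) module" where
  "regular_module R = \<lparr> carrier = carrier R, monoid.mult = undefined, one = undefined,
     ring.zero = \<zero>\<^bsub>R\<^esub>, add = add R, module.smult = monoid.mult R \<rparr>"

lemma regular_module_simps [simp]:
  "carrier (regular_module R) = carrier R" "\<zero>\<^bsub>regular_module R\<^esub> = \<zero>\<^bsub>R\<^esub>"
  "x \<oplus>\<^bsub>regular_module R\<^esub> y = x \<oplus>\<^bsub>R\<^esub> y" "x \<odot>\<^bsub>regular_module R\<^esub> y = x \<otimes>\<^bsub>R\<^esub> y"
  by (simp_all add: regular_module_def)

lemma left_module_regular: 
  assumes "ring R" shows "left_module R (regular_module R)"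
proof -
  interpret ring R by fact
  have "abelian_group (regular_module R)"
    by (rule abelian_groupI) (auto simp: a_ac intro: a_inv_closed l_neg)
  then show ?thesis
    using ring_axioms by (simp add: left_module_def l_distr r_distr m_assoc)
qed

lemma module_hom_closed: "module_hom R M N f \<Longrightarrow> x \<in> carrier M \<Longrightarrow> f x \<in> carrier N"
  by (auto simp: module_hom_def)

lemma module_hom_add: "module_hom R M N f \<Longrightarrow> x \<in> carrier M \<Longrightarrow> y \<in> carrier M \<Longrightarrow>
    f (x \<oplus>\<^bsub>M\<^esub> y) = f x \<oplus>\<^bsub>N\<^esub> f y"
  by (auto simp: module_hom_def)

lemma module_hom_smult: "module_hom R M N f \<Longrightarrow> a \<in> carrier R \<Longrightarrow> x \<in> carrier M \<Longrightarrow>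
    f (a \<odot>\<^bsub>M\<^esub> x) = a \<odot>\<^bsub>N\<^esub> f x"
  by (auto simp: module_hom_def)

lemma module_hom_zero:
  assumes "module_hom R M N f" "left_module R M" "left_module R N"
  shows "f \<zero>\<^bsub>M\<^esub> = \<zero>\<^bsub>N\<^esub>"
proof -
  interpret M: left_mod R M using assms by (simp add: left_mod_iff)
  interpret N: left_mod R N using assms by (simp add: left_mod_iff)
  have "f \<zero>\<^bsub>M\<^esub> = f (\<zero>\<^bsub>R\<^esub> \<odot>\<^bsub>M\<^esub> \<zero>\<^bsub>M\<^esub>)" by simp
  also have "\<dots> = \<zero>\<^bsub>N\<^esub>" 
    by (subst module_hom_smult[OF assms(1)]) (simp_all add: module_hom_closed[OF assms(1)])
  finally show ?thesis .
qed

lemma module_hom_minus: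
  assumes "module_hom R M N f" "left_module R M" "left_module R N" "x \<in> carrier M"
  shows "f (\<ominus>\<^bsub>M\<^esub> x) = \<ominus>\<^bsub>N\<^esub> f x"
proof -
  interpret M: left_mod R M using assms by (simp add: left_mod_iff)
  interpret N: left_mod R N using assms by (simp add: left_mod_iff)
  have "f (\<ominus>\<^bsub>M\<^esub> x) \<oplus>\<^bsub>N\<^esub> f x = \<zero>\<^bsub>N\<^esub>"
    using module_hom_add[OF assms(1), of "\<ominus>\<^bsub>M\<^esub> x" x] assms(4) module_hom_zero[OF assms(1-3)]
    by (simp add: M.M.l_neg)
  then show ?thesis using assms module_hom_closed[OF assms(1)]
    by (simp add: N.M.minus_equality)
qed

lemma module_hom_diff:
  assumes "module_hom R M N f" "left_module R M" "left_module R N" "x \<in> carrier M" "y \<in> carrier M"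
  shows "f (x \<ominus>\<^bsub>M\<^esub> y) = f x \<ominus>\<^bsub>N\<^esub> f y"
proof -
  interpret M: left_mod R M using assms by (simp add: left_mod_iff)
  show ?thesis
    using module_hom_add[OF assms(1,4), of "\<ominus>\<^bsub>M\<^esub> y"] assms(5) module_hom_minus[OF assms(1-3,5)]
    by (simp add: a_minus_def)
qed

lemma module_hom_comp:
  "module_hom R M N f \<Longrightarrow> module_hom R N Q g \<Longrightarrow> module_hom R M Q (\<lambda>x. g (f x))"
  by (auto simp: module_hom_def Pi_iff)

lemma module_hom_diff_fun:
  assumes "module_hom R M N f" "module_hom R M N g" "left_module R M" "left_module R N"
  shows "module_hom R M N (\<lambda>x. f x \<ominus>\<^bsub>N\<^esub> g x)"
proof -
  interpret M: left_mod R M using assms by (simp add: left_mod_iff)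
  interpret N: left_mod R N using assms by (simp add: left_mod_iff)
  note [simp] = module_hom_closed[OF assms(1)] module_hom_closed[OF assms(2)]
    module_hom_add[OF assms(1)] module_hom_add[OF assms(2)]
    module_hom_smult[OF assms(1)] module_hom_smult[OF assms(2)]
  show ?thesis
    unfolding module_hom_def
  proof (intro conjI ballI)
    fix x y assume xy: "x \<in> carrier M" "y \<in> carrier M"
    show "f (x \<oplus>\<^bsub>M\<^esub> y) \<ominus>\<^bsub>N\<^esub> g (x \<oplus>\<^bsub>M\<^esub> y) = f x \<ominus>\<^bsub>N\<^esub> g x \<oplus>\<^bsub>N\<^esub> (f y \<ominus>\<^bsub>N\<^esub> g y)"
      using xy by (simp add: N.M.add_diff_distrib)
  qed (simp_all add: N.smult_r_diff)
qed

lemma module_hom_add_fun: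
  assumes "module_hom R M N f" "module_hom R M N g" "left_module R M" "left_module R N"
  shows "module_hom R M N (\<lambda>x. f x \<oplus>\<^bsub>N\<^esub> g x)"
proof -
  interpret M: left_mod R M using assms by (simp add: left_mod_iff)
  interpret N: left_mod R N using assms by (simp add: left_mod_iff)
  note [simp] = module_hom_closed[OF assms(1)] module_hom_closed[OF assms(2)]
    module_hom_add[OF assms(1)] module_hom_add[OF assms(2)]
    module_hom_smult[OF assms(1)] module_hom_smult[OF assms(2)]
  show ?thesis
    unfolding module_hom_def
  proof (intro conjI ballI)
    fix x y assume xy: "x \<in> carrier M" "y \<in> carrier M"
    show "f (x \<oplus>\<^bsub>M\<^esub> y) \<oplus>\<^bsub>N\<^esub> g (x \<oplus>\<^bsub>M\<^esub> y) = f x \<oplus>\<^bsub>N\<^esub> g x \<oplus>\<^bsub>N\<^esub> (f y \<oplus>\<^bsub>N\<^esub> g y)"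
      using xy by (simp add: N.M.a_ac)
  qed (simp_all add: N.smult_r_distr)
qed

lemma module_hom_right_mult:
  assumes "left_module R M" "v \<in> carrier M"
  shows "module_hom R (regular_module R) M (\<lambda>a. a \<odot>\<^bsub>M\<^esub> v)"
proof -
  interpret M: left_mod R M using assms by (simp add: left_mod_iff)
  show ?thesis using assms(2) by (auto simp: module_hom_def M.smult_l_distr M.smult_assoc)
qed

definition free_basis :: "('r, 'b) ring_scheme \<Rightarrow> 'x \<Rightarrow> 'x \<Rightarrow> 'r" where
  "free_basis R b = (\<lambda>x. if x = b then \<one>\<^bsub>R\<^esub> else \<zero>\<^bsub>R\<^esub>)"

lemma free_module_mem_iff: "c \<in> carrier (free_module R I) \<longleftrightarrow>
   (\<forall>x\<in>I. c x \<in> carrier R) \<and> (\<forall>x. x \<notin> I \<longrightarrow> c x = \<zero>\<^bsub>R\<^esub>) \<and> finite {x. c x \<noteq> \<zero>\<^bsub>R\<^esub>}"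
  by (simp add: free_module_def)

lemma free_module_ops [simp]:
  "c \<oplus>\<^bsub>free_module R I\<^esub> c' = (\<lambda>x. c x \<oplus>\<^bsub>R\<^esub> c' x)"
  "a \<odot>\<^bsub>free_module R I\<^esub> c = (\<lambda>x. a \<otimes>\<^bsub>R\<^esub> c x)"
  "\<zero>\<^bsub>free_module R I\<^esub> = (\<lambda>_. \<zero>\<^bsub>R\<^esub>)"
  by (simp_all add: free_module_def)

lemma free_basis_closed: "ring R \<Longrightarrow> b \<in> I \<Longrightarrow> free_basis R b \<in> carrier (free_module R I)"
  by (auto simp: free_module_mem_iff free_basis_def ring.ring_simprules)

text \<open>By induction on the support. Only additivity is assumed of the two maps, and agreement on scalar
  multiples of basis vectors, so that maps into any additive structure are covered.\<close>

lemma free_module_hom_ext: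
  assumes R: "ring R"
    and f: "\<And>c c'. c \<in> carrier (free_module R I) \<Longrightarrow> c' \<in> carrier (free_module R I) \<Longrightarrow>
              f (c \<oplus>\<^bsub>free_module R I\<^esub> c') = f c \<oplus>\<^bsub>N\<^esub> f c'"
      "f (\<lambda>_. \<zero>\<^bsub>R\<^esub>) = g (\<lambda>_. \<zero>\<^bsub>R\<^esub>)"
    and g: "\<And>c c'. c \<in> carrier (free_module R I) \<Longrightarrow> c' \<in> carrier (free_module R I) \<Longrightarrow>
              g (c \<oplus>\<^bsub>free_module R I\<^esub> c') = g c \<oplus>\<^bsub>N\<^esub> g c'"
    and eq: "\<And>a b. a \<in> carrier R \<Longrightarrow> b \<in> I \<Longrightarrow>
       f (a \<odot>\<^bsub>free_module R I\<^esub> free_basis R b) = g (a \<odot>\<^bsub>free_module R I\<^esub> free_basis R b)"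
    and c: "c \<in> carrier (free_module R I)"
  shows "f c = g c"
proof -
  interpret ring R by fact
  have "finite {x. c x \<noteq> \<zero>\<^bsub>R\<^esub>}" using c by (simp add: free_module_mem_iff)
  then show ?thesis using c
  proof (induction "{x. c x \<noteq> \<zero>\<^bsub>R\<^esub>}" arbitrary: c rule: finite_induct)
    case empty
    then have "c = (\<lambda>_. \<zero>\<^bsub>R\<^esub>)" by auto
    then show ?case using f(2) by simp
  next
    case (insert b F)
    define c' where "c' = c(b := \<zero>\<^bsub>R\<^esub>)"
    have bI: "b \<in> I" "c b \<in> carrier R" using insert.hyps insert.prems
      by (auto simp: free_module_mem_iff)
    have F: "F = {x. c' x \<noteq> \<zero>\<^bsub>R\<^esub>}" using insert.hyps by (auto simp: c'_def)
    have c': "c' \<in> carrier (free_module R I)"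
      using insert.prems insert.hyps F by (auto simp: free_module_mem_iff c'_def)
    have cb: "c b \<odot>\<^bsub>free_module R I\<^esub> free_basis R b \<in> carrier (free_module R I)"
      using bI by (auto simp: free_module_mem_iff free_basis_def)
    have cx: "c x \<in> carrier R" for x using insert.prems 
      by (cases "x \<in> I") (auto simp: free_module_mem_iff)
    have "c = c b \<odot>\<^bsub>free_module R I\<^esub> free_basis R b \<oplus>\<^bsub>free_module R I\<^esub> c'"
      using bI cx by (auto simp: fun_eq_iff c'_def free_basis_def)
    then show ?case 
      using insert.hyps(3)[OF F c'] f(1)[OF cb c'] g[OF cb c'] eq[OF bI(2,1)] by metis
  qed
qed

lemma free_module_lift:
  assumes M: "left_module R M" and m: "\<And>b. b \<in> I \<Longrightarrow> m b \<in> carrier M"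
  obtains H where "module_hom R (free_module R I) M H" "\<And>b. b \<in> I \<Longrightarrow> H (free_basis R b) = m b"
proof -
  interpret M: left_mod R M using M by (simp add: left_mod_iff)
  define H where "H = (\<lambda>c. finsum M (\<lambda>b. c b \<odot>\<^bsub>M\<^esub> m b) {b. c b \<noteq> \<zero>\<^bsub>R\<^esub>})"
  have supp: "b \<in> I" if "c \<in> carrier (free_module R I)" "c b \<noteq> \<zero>\<^bsub>R\<^esub>" for c b
    using that by (auto simp: free_module_mem_iff)
  have cl: "c b \<odot>\<^bsub>M\<^esub> m b \<in> carrier M" if "c \<in> carrier (free_module R I)" "b \<in> I" for c b
    using that m by (auto simp: free_module_mem_iff)
  have H_eq: "H c = finsum M (\<lambda>b. c b \<odot>\<^bsub>M\<^esub> m b) B"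
    if "c \<in> carrier (free_module R I)" "{b. c b \<noteq> \<zero>\<^bsub>R\<^esub>} \<subseteq> B" "finite B" "B \<subseteq> I" for c B
    unfolding H_def
    by (rule M.add.finprod_mono_neutral_cong_left)
      (use that cl m in \<open>auto simp: subset_eq\<close>)
  have "module_hom R (free_module R I) M H"
    unfolding module_hom_def
  proof (intro conjI ballI)
    show "H \<in> carrier (free_module R I) \<rightarrow> carrier M"
      unfolding H_def by (auto intro!: M.M.finsum_closed cl dest: supp)
  next
    fix c c' assume c: "c \<in> carrier (free_module R I)" "c' \<in> carrier (free_module R I)"
    let ?B = "{b. c b \<noteq> \<zero>\<^bsub>R\<^esub>} \<union> {b. c' b \<noteq> \<zero>\<^bsub>R\<^esub>}"
    have B: "finite ?B" "?B \<subseteq> I" using c by (auto simp: free_module_mem_iff)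
    have "finite {x. c x \<oplus>\<^bsub>R\<^esub> c' x \<noteq> \<zero>\<^bsub>R\<^esub>}"
      by (rule finite_subset[OF _ B(1)]) auto
    then have s: "c \<oplus>\<^bsub>free_module R I\<^esub> c' \<in> carrier (free_module R I)"
      using c by (auto simp: free_module_mem_iff)
    have "H (c \<oplus>\<^bsub>free_module R I\<^esub> c') = finsum M (\<lambda>b. (c b \<oplus>\<^bsub>R\<^esub> c' b) \<odot>\<^bsub>M\<^esub> m b) ?B"
      by (subst H_eq[OF s _ B]) auto
    also have "\<dots> = finsum M (\<lambda>b. c b \<odot>\<^bsub>M\<^esub> m b \<oplus>\<^bsub>M\<^esub> c' b \<odot>\<^bsub>M\<^esub> m b) ?B"
    proof (rule M.M.finsum_cong'[OF refl])
      fix b assume "b \<in> ?B"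
      then have "b \<in> I" using B by blast
      then show "(c b \<oplus>\<^bsub>R\<^esub> c' b) \<odot>\<^bsub>M\<^esub> m b = c b \<odot>\<^bsub>M\<^esub> m b \<oplus>\<^bsub>M\<^esub> c' b \<odot>\<^bsub>M\<^esub> m b"
        using c m by (simp add: M.smult_l_distr free_module_mem_iff)
    next
      show "(\<lambda>b. c b \<odot>\<^bsub>M\<^esub> m b \<oplus>\<^bsub>M\<^esub> c' b \<odot>\<^bsub>M\<^esub> m b) \<in> ?B \<rightarrow> carrier M"
        using B(2) cl[OF c(1)] cl[OF c(2)] by blast
    qed
    also have "\<dots> = finsum M (\<lambda>b. c b \<odot>\<^bsub>M\<^esub> m b) ?B \<oplus>\<^bsub>M\<^esub> finsum M (\<lambda>b. c' b \<odot>\<^bsub>M\<^esub> m b) ?B"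
      by (rule M.M.finsum_addf) (use B(2) cl[OF c(1)] cl[OF c(2)] in blast)+
    also have "\<dots> = H c \<oplus>\<^bsub>M\<^esub> H c'" by (simp add: H_eq[OF c(1) Un_upper1 B] H_eq[OF c(2) Un_upper2 B])
    finally show "H (c \<oplus>\<^bsub>free_module R I\<^esub> c') = H c \<oplus>\<^bsub>M\<^esub> H c'" .
  next
    fix a c assume c: "a \<in> carrier R" "c \<in> carrier (free_module R I)"
    let ?B = "{b. c b \<noteq> \<zero>\<^bsub>R\<^esub>}"
    have B: "finite ?B" "?B \<subseteq> I" using c by (auto simp: free_module_mem_iff)
    have "finite {x. a \<otimes>\<^bsub>R\<^esub> c x \<noteq> \<zero>\<^bsub>R\<^esub>}"
      by (rule finite_subset[OF _ B(1)]) (use c in auto)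
    then have s: "a \<odot>\<^bsub>free_module R I\<^esub> c \<in> carrier (free_module R I)"
      using c by (auto simp: free_module_mem_iff)
    have "H (a \<odot>\<^bsub>free_module R I\<^esub> c) = finsum M (\<lambda>b. (a \<otimes>\<^bsub>R\<^esub> c b) \<odot>\<^bsub>M\<^esub> m b) ?B"
      by (subst H_eq[OF s _ B]) (use c in auto)
    also have "\<dots> = finsum M (\<lambda>b. a \<odot>\<^bsub>M\<^esub> (c b \<odot>\<^bsub>M\<^esub> m b)) ?B"
    proof (rule M.M.finsum_cong'[OF refl])
      fix b assume "b \<in> ?B"
      then have "b \<in> I" using B by blast
      then show "(a \<otimes>\<^bsub>R\<^esub> c b) \<odot>\<^bsub>M\<^esub> m b = a \<odot>\<^bsub>M\<^esub> (c b \<odot>\<^bsub>M\<^esub> m b)"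
        using c m by (simp add: M.smult_assoc free_module_mem_iff)
    next
      show "(\<lambda>b. a \<odot>\<^bsub>M\<^esub> (c b \<odot>\<^bsub>M\<^esub> m b)) \<in> ?B \<rightarrow> carrier M"
        using B(2) cl[OF c(2)] c(1) M.smult_closed by blast
    qed
    also have "\<dots> = a \<odot>\<^bsub>M\<^esub> H c"
    proof -
      have "finsum M (\<lambda>b. a \<odot>\<^bsub>M\<^esub> (c b \<odot>\<^bsub>M\<^esub> m b)) B = a \<odot>\<^bsub>M\<^esub> finsum M (\<lambda>b. c b \<odot>\<^bsub>M\<^esub> m b) B"
        if "finite B" "B \<subseteq> I" for B
        using that
      proof (induction B rule: finite_induct)
        case empty
        then show ?case using c(1) by simp
      next
        case (insert b F)
        have cb: "c b \<odot>\<^bsub>M\<^esub> m b \<in> carrier M" using cl[OF c(2)] insert.prems by blast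
        have cF: "(\<lambda>b. c b \<odot>\<^bsub>M\<^esub> m b) \<in> F \<rightarrow> carrier M" using cl[OF c(2)] insert.prems by blast
        have acF: "(\<lambda>b. a \<odot>\<^bsub>M\<^esub> (c b \<odot>\<^bsub>M\<^esub> m b)) \<in> F \<rightarrow> carrier M"
          using cF c(1) M.smult_closed by blast
        show ?case
          using insert.hyps insert.IH insert.prems c(1) cb
          by (simp add: M.M.finsum_insert[OF _ _ cF cb] M.M.finsum_insert[OF _ _ acF]
              M.smult_r_distr M.M.finsum_closed[OF cF])
      qed
      then show ?thesis unfolding H_def using B by blast
    qed
    finally show "H (a \<odot>\<^bsub>free_module R I\<^esub> c) = a \<odot>\<^bsub>M\<^esub> H c" .
  qed
  moreover have "H (free_basis R b) = m b" if "b \<in> I" for b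
  proof -
    have "{x. free_basis R b x \<noteq> \<zero>\<^bsub>R\<^esub>} \<subseteq> {b}" by (auto simp: free_basis_def)
    then show ?thesis
      using H_eq[OF free_basis_closed[OF M.R.ring_axioms that], of "{b}"] that m[OF that]
      by (simp add: free_basis_def)
  qed
  ultimately show ?thesis using that by blast
qed

text \<open>The lifting property of projective modules. The lift is constructed on the free module of which
  \<open>P\<close> is a summand, by choosing preimages of the images of the basis vectors, and is then restricted
  to \<open>P\<close>.\<close>

lemma projective_lift:
  assumes P: "projective_module R P" and M: "left_module R M" and N: "left_module R N"
    and g: "module_hom R M N g" and f: "module_hom R P N f"
    and sub: "\<And>x. x \<in> carrier P \<Longrightarrow> f x \<in> g ` carrier M"
  obtains h where "module_hom R P M h" "\<And>x. x \<in> carrier P \<Longrightarrow> g (h x) = f x"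
proof -
  obtain I :: "'c set" and i p where i: "module_hom R P (free_module R I) i"
    and p: "module_hom R (free_module R I) P p" and pi: "\<And>x. x \<in> carrier P \<Longrightarrow> p (i x) = x"
    and PM: "left_module R P"
    using P unfolding projective_module_def by blast
  interpret M: left_mod R M using M by (simp add: left_mod_iff)
  interpret N: left_mod R N using N by (simp add: left_mod_iff)
  have "\<exists>y\<in>carrier M. g y = f (p (free_basis R b))" if "b \<in> I" for b
    using sub[of "p (free_basis R b)"] module_hom_closed[OF p free_basis_closed[OF M.R.ring_axioms that]]
    by auto
  then obtain m where m: "\<And>b. b \<in> I \<Longrightarrow> m b \<in> carrier M"
     "\<And>b. b \<in> I \<Longrightarrow> g (m b) = f (p (free_basis R b))" by metis
  obtain H where H: "module_hom R (free_module R I) M H" "\<And>b. b \<in> I \<Longrightarrow> H (free_basis R b) = m b"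
    using free_module_lift[OF M, of I m] m(1) by metis
  have gH: "module_hom R (free_module R I) N (\<lambda>c. g (H c))" by (rule module_hom_comp[OF H(1) g])
  have fp: "module_hom R (free_module R I) N (\<lambda>c. f (p c))" by (rule module_hom_comp[OF p f])
  have Z: "h (\<lambda>_. \<zero>\<^bsub>R\<^esub>) = \<zero>\<^bsub>N\<^esub>" if "module_hom R (free_module R I) N h" for h
  proof -
    have z: "(\<lambda>_. \<zero>\<^bsub>R\<^esub>) \<in> carrier (free_module R I)" by (simp add: free_module_mem_iff)
    show ?thesis
      using module_hom_smult[OF that M.R.zero_closed z] module_hom_closed[OF that z] by simp
  qed
  have eq: "g (H c) = f (p c)" if c: "c \<in> carrier (free_module R I)" for c
  proof (rule free_module_hom_ext[OF M.R.ring_axioms _ _ _ _ c, where N = N])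
    fix a b assume ab: "a \<in> carrier R" "b \<in> I"
    show "g (H (a \<odot>\<^bsub>free_module R I\<^esub> free_basis R b)) = f (p (a \<odot>\<^bsub>free_module R I\<^esub> free_basis R b))"
      using module_hom_smult[OF gH ab(1) free_basis_closed[OF M.R.ring_axioms ab(2)]]
        module_hom_smult[OF fp ab(1) free_basis_closed[OF M.R.ring_axioms ab(2)]]
        H(2)[OF ab(2)] m(2)[OF ab(2)] by simp
  qed (use module_hom_add[OF gH] module_hom_add[OF fp] Z[OF gH] Z[OF fp] in auto)
  show ?thesis
    by (rule that[OF module_hom_comp[OF i H(1)]]) (simp add: eq module_hom_closed[OF i] pi)
qed

lemma left_mod_of_left_module: "left_module R M \<Longrightarrow> left_mod R M"
  by (simp add: left_mod_iff)

section \<open>Comparison with a resolution by cyclic modules\<close>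

text \<open>Besides the given projective resolution \<open>P\<close> of \<open>N\<close>, there is a second one whose \<open>n\<close>-th module is the
  left ideal \<open>A \<cdot> eps n\<close> of an idempotent, with differential \<open>x \<mapsto> x \<cdot> del n\<close> and augmentation \<open>x \<mapsto> x u\<close>. Its
  modules are generated by one element, and homomorphisms from \<open>A \<cdot> eps n\<close> to \<open>M\<close> correspond to vectors
  of \<open>M\<close> fixed by \<open>eps n\<close>. Requiring \<open>eps (n + 1) \<cdot> del n = del n \<cdot> eps n\<close> instead of absorbing the
  idempotents into \<open>del\<close> leaves the differentials in their simplest form.\<close>

locale cyclic_resolution = M: left_mod A M + N: left_mod A N
  for A :: "('k::field, 'a) module" and M :: "('a, 'm) module" and N :: "('a, 'n) module" +
  fixes P :: "nat \<Rightarrow> ('a, 'p) module" and d :: "nat \<Rightarrow> 'p \<Rightarrow> 'p" and e :: "'p \<Rightarrow> 'n"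
    and eps del :: "nat \<Rightarrow> 'a" and u :: 'n
  assumes res: "projective_resolution A P d e N"
    and eps_closed [simp]: "eps n \<in> carrier A"
    and eps_idem [simp]: "eps n \<otimes>\<^bsub>A\<^esub> eps n = eps n"
    and del_closed [simp]: "del n \<in> carrier A"
    and eps_del: "eps (Suc n) \<otimes>\<^bsub>A\<^esub> del n = del n \<otimes>\<^bsub>A\<^esub> eps n"
    and del_del [simp]: "del (Suc n) \<otimes>\<^bsub>A\<^esub> del n = \<zero>\<^bsub>A\<^esub>"
    and u_closed [simp]: "u \<in> carrier N"
    and eps_u [simp]: "eps 0 \<odot>\<^bsub>N\<^esub> u = u"
    and del_u [simp]: "del 0 \<odot>\<^bsub>N\<^esub> u = \<zero>\<^bsub>N\<^esub>"
    and u_gen: "z \<in> carrier N \<Longrightarrow> \<exists>a\<in>carrier A. z = a \<odot>\<^bsub>N\<^esub> u"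
    and exact_0: "x \<in> carrier A \<Longrightarrow> x \<otimes>\<^bsub>A\<^esub> eps 0 = x \<Longrightarrow> x \<odot>\<^bsub>N\<^esub> u = \<zero>\<^bsub>N\<^esub> \<Longrightarrow>
      \<exists>y\<in>carrier A. y \<otimes>\<^bsub>A\<^esub> eps 1 = y \<and> x = y \<otimes>\<^bsub>A\<^esub> del 0"
    and exact_Suc: "x \<in> carrier A \<Longrightarrow> x \<otimes>\<^bsub>A\<^esub> eps (Suc n) = x \<Longrightarrow> x \<otimes>\<^bsub>A\<^esub> del n = \<zero>\<^bsub>A\<^esub> \<Longrightarrow>
      \<exists>y\<in>carrier A. y \<otimes>\<^bsub>A\<^esub> eps (Suc (Suc n)) = y \<and> x = y \<otimes>\<^bsub>A\<^esub> del (Suc n)"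
begin

abbreviation mulA (infixl "\<cdot>" 70) where "x \<cdot> y \<equiv> x \<otimes>\<^bsub>A\<^esub> y"

lemma P_proj: "projective_module A (P n)"
  and d_hom: "module_hom A (P (Suc n)) (P n) (d n)"
  and e_hom: "module_hom A (P 0) N e"
  and e_surj: "e ` carrier (P 0) = carrier N"
  and exact_P0: "d 0 ` carrier (P (Suc 0)) = {x \<in> carrier (P 0). e x = \<zero>\<^bsub>N\<^esub>}"
  and exact_PS: "d (Suc n) ` carrier (P (Suc (Suc n))) = {x \<in> carrier (P (Suc n)). d n x = \<zero>\<^bsub>P n\<^esub>}"
  using res unfolding projective_resolution_def by auto

lemma P_module: "left_module A (P n)"
  using P_proj unfolding projective_module_def by blast

sublocale Pn: left_mod A "P n" for n
  by (rule left_mod_of_left_module[OF P_module])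

lemma reg_module: "left_module A (regular_module A)"
  by (rule left_module_regular[OF M.R.ring_axioms])

lemma M_module: "left_module A M" using M.left_mod_axioms by (simp add: left_mod_iff)
lemma N_module: "left_module A N" using N.left_mod_axioms by (simp add: left_mod_iff)

lemma d_closed [simp]: "x \<in> carrier (P (Suc n)) \<Longrightarrow> d n x \<in> carrier (P n)"
  by (rule module_hom_closed[OF d_hom])

lemma e_closed [simp]: "x \<in> carrier (P 0) \<Longrightarrow> e x \<in> carrier N"
  by (rule module_hom_closed[OF e_hom])

lemma e_d [simp]: "x \<in> carrier (P (Suc 0)) \<Longrightarrow> e (d 0 x) = \<zero>\<^bsub>N\<^esub>"
  using exact_P0 by blast

lemma d_d [simp]: "x \<in> carrier (P (Suc (Suc n))) \<Longrightarrow> d n (d (Suc n) x) = \<zero>\<^bsub>P n\<^esub>"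
  using exact_PS by blast

text \<open>A chain map from the cyclic resolution to \<open>P\<close>, given by the images of the generators. The next
  element exists by exactness of \<open>P\<close>, and multiplying by the idempotent enforces its invariance.\<close>

lemma generator_cycles:
  obtains p where "\<And>n. p n \<in> carrier (P n)" "\<And>n. eps n \<odot>\<^bsub>P n\<^esub> p n = p n" "e (p 0) = u"
    "\<And>n. d n (p (Suc n)) = del n \<odot>\<^bsub>P n\<^esub> p n"
proof -
  define I where "I = (\<lambda>n x. x \<in> carrier (P n) \<and> eps n \<odot>\<^bsub>P n\<^esub> x = x \<and>
    (\<exists>y\<in>carrier (P (Suc n)). d n y = del n \<odot>\<^bsub>P n\<^esub> x) \<and> (n = 0 \<longrightarrow> e x = u))"
  have "\<exists>p. \<forall>n. I n (p n) \<and> d n (p (Suc n)) = del n \<odot>\<^bsub>P n\<^esub> p n"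
  proof (rule dependent_nat_choice)
    obtain x where x: "x \<in> carrier (P 0)" "e x = u"
      using e_surj u_closed by (metis imageE)
    let ?p = "eps 0 \<odot>\<^bsub>P 0\<^esub> x"
    have p: "?p \<in> carrier (P 0)" "eps 0 \<odot>\<^bsub>P 0\<^esub> ?p = ?p" "e ?p = u"
      using x module_hom_smult[OF e_hom eps_closed[of 0] x(1)]
      by (simp_all flip: Pn.smult_assoc)
    have "e (del 0 \<odot>\<^bsub>P 0\<^esub> ?p) = \<zero>\<^bsub>N\<^esub>"
      using module_hom_smult[OF e_hom del_closed[of 0] p(1)] p(3) by simp
    then have "del 0 \<odot>\<^bsub>P 0\<^esub> ?p \<in> d 0 ` carrier (P (Suc 0))"
      using exact_P0 p(1) by simp
    then obtain y where "y \<in> carrier (P (Suc 0))" "d 0 y = del 0 \<odot>\<^bsub>P 0\<^esub> ?p" by force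
    then have "I 0 ?p" using p unfolding I_def by blast
    then show "\<exists>x. I 0 x" by blast
  next
    fix x n assume "I n x"
    then obtain y where x: "x \<in> carrier (P n)" "eps n \<odot>\<^bsub>P n\<^esub> x = x"
      and y: "y \<in> carrier (P (Suc n))" "d n y = del n \<odot>\<^bsub>P n\<^esub> x"
      unfolding I_def by blast
    let ?p = "eps (Suc n) \<odot>\<^bsub>P (Suc n)\<^esub> y"
    have p: "?p \<in> carrier (P (Suc n))" "eps (Suc n) \<odot>\<^bsub>P (Suc n)\<^esub> ?p = ?p"
      using y by (simp_all flip: Pn.smult_assoc)
    have dp: "d n ?p = del n \<odot>\<^bsub>P n\<^esub> x"
    proof -
      have "d n ?p = eps (Suc n) \<odot>\<^bsub>P n\<^esub> (del n \<odot>\<^bsub>P n\<^esub> x)"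
        using module_hom_smult[OF d_hom eps_closed y(1)] y(2) by simp
      also have "\<dots> = (del n \<cdot> eps n) \<odot>\<^bsub>P n\<^esub> x"
        using x(1) by (simp flip: Pn.smult_assoc eps_del)
      finally show ?thesis using x by (simp add: Pn.smult_assoc)
    qed
    have "d n (del (Suc n) \<odot>\<^bsub>P (Suc n)\<^esub> ?p) = (del (Suc n) \<cdot> del n) \<odot>\<^bsub>P n\<^esub> x"
      using module_hom_smult[OF d_hom del_closed p(1)] dp x(1) by (simp only: Pn.smult_assoc del_closed)
    then have "d n (del (Suc n) \<odot>\<^bsub>P (Suc n)\<^esub> ?p) = \<zero>\<^bsub>P n\<^esub>" using x(1) by simp
    then have "del (Suc n) \<odot>\<^bsub>P (Suc n)\<^esub> ?p \<in> d (Suc n) ` carrier (P (Suc (Suc n)))"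
      unfolding exact_PS using p(1) by simp
    then obtain z where "z \<in> carrier (P (Suc (Suc n)))" "d (Suc n) z = del (Suc n) \<odot>\<^bsub>P (Suc n)\<^esub> ?p" 
      by force
    then have "I (Suc n) ?p" using p unfolding I_def by blast
    then show "\<exists>y. I (Suc n) y \<and> d n y = del n \<odot>\<^bsub>P n\<^esub> x" using dp by blast
  qed
  then obtain p where "\<forall>n. I n (p n) \<and> d n (p (Suc n)) = del n \<odot>\<^bsub>P n\<^esub> p n" ..
  then show ?thesis by (intro that[of p]) (auto simp: I_def)
qed

text \<open>A chain map from \<open>P\<close> to the cyclic resolution, as a sequence of homomorphisms into \<open>A\<close> with values in
  the left ideals. The invariant of the recursion is that \<open>\<psi> n\<close> maps boundaries into the image of
  \<open>del n\<close>, which is what the next lifting step needs.\<close>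

lemma comparison_map:
  obtains \<psi> where "\<And>n. module_hom A (P n) (regular_module A) (\<psi> n)"
    "\<And>n x. x \<in> carrier (P n) \<Longrightarrow> \<psi> n x \<cdot> eps n = \<psi> n x"
    "\<And>x. x \<in> carrier (P 0) \<Longrightarrow> \<psi> 0 x \<odot>\<^bsub>N\<^esub> u = e x"
    "\<And>n x. x \<in> carrier (P (Suc n)) \<Longrightarrow> \<psi> n (d n x) = \<psi> (Suc n) x \<cdot> del n"
proof -
  have rmul: "module_hom A (regular_module A) (regular_module A) (\<lambda>a. a \<cdot> b)" if "b \<in> carrier A" for b
    using module_hom_right_mult[OF reg_module] that by simp
  define I where "I = (\<lambda>n f. module_hom A (P n) (regular_module A) f \<and>
    (\<forall>x\<in>carrier (P n). f x \<cdot> eps n = f x) \<and>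
    (\<forall>x\<in>carrier (P (Suc n)). \<exists>y\<in>carrier A. y \<cdot> eps (Suc n) = y \<and> f (d n x) = y \<cdot> del n) \<and>
    (n = 0 \<longrightarrow> (\<forall>x\<in>carrier (P 0). f x \<odot>\<^bsub>N\<^esub> u = e x)))"
  have "\<exists>\<psi>. \<forall>n. I n (\<psi> n) \<and> (\<forall>x\<in>carrier (P (Suc n)). \<psi> n (d n x) = \<psi> (Suc n) x \<cdot> del n)"
  proof (rule dependent_nat_choice)
    have im: "e x \<in> (\<lambda>a. a \<odot>\<^bsub>N\<^esub> u) ` carrier (regular_module A)" if "x \<in> carrier (P 0)" for x
      using u_gen[OF e_closed[OF that]] by force
    obtain h where h: "module_hom A (P 0) (regular_module A) h"
      "\<And>x. x \<in> carrier (P 0) \<Longrightarrow> h x \<odot>\<^bsub>N\<^esub> u = e x"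
      by (rule projective_lift[OF P_proj reg_module N_module
            module_hom_right_mult[OF N_module u_closed] e_hom im]) blast+
    note hc = module_hom_closed[OF h(1), simplified]
    let ?f = "\<lambda>x. h x \<cdot> eps 0"
    have f: "module_hom A (P 0) (regular_module A) ?f"
      using module_hom_comp[OF h(1) rmul[OF eps_closed]] by simp
    have fu: "?f x \<odot>\<^bsub>N\<^esub> u = e x" if "x \<in> carrier (P 0)" for x
      using h(2)[OF that] hc[OF that] by (simp add: N.smult_assoc)
    have fe: "?f x \<cdot> eps 0 = ?f x" if "x \<in> carrier (P 0)" for x
      using hc[OF that] by (simp add: M.R.m_assoc)
    have "\<exists>y\<in>carrier A. y \<cdot> eps (Suc 0) = y \<and> ?f (d 0 x) = y \<cdot> del 0"
      if x: "x \<in> carrier (P (Suc 0))" for x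
      using exact_0[of "?f (d 0 x)"] fu[OF d_closed[OF x]] fe[OF d_closed[OF x]] e_d[OF x]
        hc[OF d_closed[OF x]] by simp
    then have "I 0 ?f" unfolding I_def using f fe fu by simp
    then show "\<exists>f. I 0 f" by blast
  next
    fix f n assume "I n f"
    then have f: "module_hom A (P n) (regular_module A) f"
      and ex: "\<And>x. x \<in> carrier (P (Suc n)) \<Longrightarrow>
        \<exists>y\<in>carrier A. y \<cdot> eps (Suc n) = y \<and> f (d n x) = y \<cdot> del n"
      unfolding I_def by blast+
    have im: "f (d n x) \<in> (\<lambda>a. a \<cdot> (eps (Suc n) \<cdot> del n)) ` carrier (regular_module A)"
      if "x \<in> carrier (P (Suc n))" for x
    proof -
      from that
      obtain y where "y \<in> carrier A" "y \<cdot> eps (Suc n) = y" "f (d n x) = y \<cdot> del n"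
        using ex by blast
      then have "f (d n x) = y \<cdot> (eps (Suc n) \<cdot> del n)" by (simp flip: M.R.m_assoc)
      then show ?thesis
        using \<open>y \<in> carrier A\<close> by simp
    qed
    obtain h where h: "module_hom A (P (Suc n)) (regular_module A) h"
      "\<And>x. x \<in> carrier (P (Suc n)) \<Longrightarrow> h x \<cdot> (eps (Suc n) \<cdot> del n) = f (d n x)"
      by (rule projective_lift[OF P_proj reg_module reg_module
            rmul[OF M.R.m_closed[OF eps_closed del_closed]] module_hom_comp[OF d_hom f] im]) blast+
    note hc = module_hom_closed[OF h(1), simplified]
    let ?f = "\<lambda>x. h x \<cdot> eps (Suc n)"
    have f': "module_hom A (P (Suc n)) (regular_module A) ?f"
      using module_hom_comp[OF h(1) rmul[OF eps_closed]] by simp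
    have rel: "f (d n x) = ?f x \<cdot> del n" if "x \<in> carrier (P (Suc n))" for x
      using h(2)[OF that] hc[OF that] by (simp add: M.R.m_assoc)
    have fe: "?f x \<cdot> eps (Suc n) = ?f x" if "x \<in> carrier (P (Suc n))" for x
      using hc[OF that] by (simp add: M.R.m_assoc)
    have "\<exists>y\<in>carrier A. y \<cdot> eps (Suc (Suc n)) = y \<and> ?f (d (Suc n) x) = y \<cdot> del (Suc n)"
      if x: "x \<in> carrier (P (Suc (Suc n)))" for x
    proof (rule exact_Suc)
      have "?f (d (Suc n) x) \<cdot> del n = f \<zero>\<^bsub>P n\<^esub>"
        using rel[OF d_closed[OF x]] x by simp
      also have "\<dots> = \<zero>\<^bsub>A\<^esub>" using module_hom_zero[OF f P_module reg_module] by simp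
      finally show "?f (d (Suc n) x) \<cdot> del n = \<zero>\<^bsub>A\<^esub>" .
    qed (use fe[OF d_closed[OF x]] hc[OF d_closed[OF x]] in simp_all)
    then have "I (Suc n) ?f" unfolding I_def using f' fe by simp
    then show "\<exists>g. I (Suc n) g \<and> (\<forall>x\<in>carrier (P (Suc n)). f (d n x) = g x \<cdot> del n)"
      using rel by blast
  qed
  then obtain \<psi> where
    "\<forall>n. I n (\<psi> n) \<and> (\<forall>x\<in>carrier (P (Suc n)). \<psi> n (d n x) = \<psi> (Suc n) x \<cdot> del n)" ..
  then show ?thesis by (intro that[of \<psi>]) (auto simp: I_def)
qed

text \<open>Uniqueness of chain maps up to homotopy, for endomorphisms of \<open>P\<close>: one that induces zero on \<open>N\<close> is
  null-homotopic.\<close>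

lemma null_homotopy:
  assumes th: "\<And>n. module_hom A (P n) (P n) (\<theta> n)"
    and th_d: "\<And>n x. x \<in> carrier (P (Suc n)) \<Longrightarrow> d n (\<theta> (Suc n) x) = \<theta> n (d n x)"
    and th_e: "\<And>x. x \<in> carrier (P 0) \<Longrightarrow> e (\<theta> 0 x) = \<zero>\<^bsub>N\<^esub>"
  obtains h where "\<And>n. module_hom A (P n) (P (Suc n)) (h n)"
    "\<And>x. x \<in> carrier (P 0) \<Longrightarrow> \<theta> 0 x = d 0 (h 0 x)"
    "\<And>n x. x \<in> carrier (P (Suc n)) \<Longrightarrow> 
       \<theta> (Suc n) x = d (Suc n) (h (Suc n) x) \<oplus>\<^bsub>P (Suc n)\<^esub> h n (d n x)"
proof -
  note thc = module_hom_closed[OF th]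
  define I where "I = (\<lambda>n f. module_hom A (P n) (P (Suc n)) f \<and>
    (\<forall>x\<in>carrier (P (Suc n)). d n (f (d n x)) = \<theta> n (d n x)) \<and>
    (n = 0 \<longrightarrow> (\<forall>x\<in>carrier (P 0). \<theta> 0 x = d 0 (f x))))"
  have "\<exists>h. \<forall>n. I n (h n) \<and> (\<forall>x\<in>carrier (P (Suc n)). 
      d (Suc n) (h (Suc n) x) = \<theta> (Suc n) x \<ominus>\<^bsub>P (Suc n)\<^esub> h n (d n x))"
  proof (rule dependent_nat_choice)
    have im: "\<theta> 0 x \<in> d 0 ` carrier (P (Suc 0))" if "x \<in> carrier (P 0)" for x
      unfolding exact_P0 using th_e[OF that] thc[OF that] by simp
    obtain f where f: "module_hom A (P 0) (P (Suc 0)) f"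
        "\<And>x. x \<in> carrier (P 0) \<Longrightarrow> d 0 (f x) = \<theta> 0 x"
      by (rule projective_lift[OF P_proj P_module P_module d_hom th[of 0] im]) blast+
    have "I 0 f" unfolding I_def using f by simp
    then show "\<exists>f. I 0 f" by blast
  next
    fix f n assume "I n f"
    then have f: "module_hom A (P n) (P (Suc n)) f"
      and fd: "\<And>x. x \<in> carrier (P (Suc n)) \<Longrightarrow> d n (f (d n x)) = \<theta> n (d n x)"
      unfolding I_def by blast+
    note fc = module_hom_closed[OF f]
    have g: "module_hom A (P (Suc n)) (P (Suc n)) (\<lambda>x. \<theta> (Suc n) x \<ominus>\<^bsub>P (Suc n)\<^esub> f (d n x))"
      by (rule module_hom_diff_fun[OF th module_hom_comp[OF d_hom f] P_module P_module])
    have im: "\<theta> (Suc n) x \<ominus>\<^bsub>P (Suc n)\<^esub> f (d n x) \<in> d (Suc n) ` carrier (P (Suc (Suc n)))"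
      if x: "x \<in> carrier (P (Suc n))" for x
    proof -
      have "d n (\<theta> (Suc n) x \<ominus>\<^bsub>P (Suc n)\<^esub> f (d n x)) = d n (\<theta> (Suc n) x) \<ominus>\<^bsub>P n\<^esub> d n (f (d n x))"
        by (rule module_hom_diff[OF d_hom P_module P_module thc[OF x] fc[OF d_closed[OF x]]])
      also have "\<dots> = \<zero>\<^bsub>P n\<^esub>"
        unfolding th_d[OF x] fd[OF x] using thc[OF d_closed[OF x]] by (simp add: a_minus_def Pn.M.r_neg)
      finally show ?thesis
        unfolding exact_PS using module_hom_closed[OF g x] by simp
    qed
    obtain f' where f': "module_hom A (P (Suc n)) (P (Suc (Suc n))) f'"
        "\<And>x. x \<in> carrier (P (Suc n)) \<Longrightarrow> d (Suc n) (f' x) = \<theta> (Suc n) x \<ominus>\<^bsub>P (Suc n)\<^esub> f (d n x)"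
      by (rule projective_lift[OF P_proj P_module P_module d_hom g im]) blast+
    have "d (Suc n) (f' (d (Suc n) x)) = \<theta> (Suc n) (d (Suc n) x)" 
      if x: "x \<in> carrier (P (Suc (Suc n)))" for x
      using f'(2)[OF d_closed[OF x]] d_d[OF x] module_hom_zero[OF f P_module P_module]
        thc[OF d_closed[OF x]] by (simp add: a_minus_def)
    then have "I (Suc n) f'" unfolding I_def using f' by simp
    then show "\<exists>g. I (Suc n) g \<and> (\<forall>x\<in>carrier (P (Suc n)). 
        d (Suc n) (g x) = \<theta> (Suc n) x \<ominus>\<^bsub>P (Suc n)\<^esub> f (d n x))" using f'(2) by blast
  qed
  then obtain h where h: "\<And>n. I n (h n)" "\<And>n x. x\<in>carrier (P (Suc n)) \<Longrightarrow>
      d (Suc n) (h (Suc n) x) = \<theta> (Suc n) x \<ominus>\<^bsub>P (Suc n)\<^esub> h n (d n x)" by blast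
  have hh: "module_hom A (P n) (P (Suc n)) (h n)" for n using h(1) unfolding I_def by blast
  show ?thesis
  proof (rule that[OF hh])
    show "\<theta> 0 x = d 0 (h 0 x)" if "x \<in> carrier (P 0)" for x
      using h(1) that unfolding I_def by blast
    show "\<theta> (Suc n) x = d (Suc n) (h (Suc n) x) \<oplus>\<^bsub>P (Suc n)\<^esub> h n (d n x)"
      if "x \<in> carrier (P (Suc n))" for n x
      unfolding h(2)[OF that] using thc[OF that] module_hom_closed[OF hh d_closed[OF that]]
      by (simp add: a_minus_def Pn.M.a_assoc Pn.M.l_neg)
  qed
qed

end

section \<open>Cocycles and their values at the generators\<close>

lemma (in ring) l_diff: "a \<in> carrier R \<Longrightarrow> b \<in> carrier R \<Longrightarrow> c \<in> carrier R \<Longrightarrow>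
    (a \<ominus> b) \<otimes> c = a \<otimes> c \<ominus> b \<otimes> c"
  by (simp add: a_minus_def l_distr l_minus)

lemma (in ring) r_diff: "a \<in> carrier R \<Longrightarrow> b \<in> carrier R \<Longrightarrow> c \<in> carrier R \<Longrightarrow>
    c \<otimes> (a \<ominus> b) = c \<otimes> a \<ominus> c \<otimes> b"
  by (simp add: a_minus_def r_distr r_minus)

lemma (in abelian_group) diff_self: "a \<in> carrier G \<Longrightarrow> a \<ominus> a = \<zero>"
  by (simp add: a_minus_def r_neg)

lemma (in abelian_group) diff_eq_iff: 
  assumes "a \<in> carrier G" "b \<in> carrier G" "c \<in> carrier G"
  shows "a \<ominus> b = c \<longleftrightarrow> a = b \<oplus> c"
proof
  assume "a \<ominus> b = c"
  then have "b \<oplus> c = b \<oplus> (\<ominus> b \<oplus> a)" using assms by (simp add: a_minus_def a_comm)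
  also have "\<dots> = a" using assms by (simp add: r_neg2)
  finally show "a = b \<oplus> c" by simp
next
  assume "a = b \<oplus> c"
  then have "a \<ominus> b = \<ominus> b \<oplus> (b \<oplus> c)" using assms by (simp add: a_minus_def a_comm)
  also have "\<dots> = c" using assms by (simp add: r_neg1)
  finally show "a \<ominus> b = c" .
qed

context cyclic_resolution
begin

text \<open>The same uniqueness for the cyclic resolution, where the chain map sends the \<open>n\<close>-th generator to
  \<open>c n\<close> and the homotopy consists of ring elements.\<close>

lemma generator_homotopy:
  assumes c [simp]: "\<And>n. c n \<in> carrier A" "\<And>n. eps n \<cdot> c n = c n" "\<And>n. c n \<cdot> eps n = c n"
    and cd: "\<And>n. del n \<cdot> c n = c (Suc n) \<cdot> del n" and cu: "c 0 \<odot>\<^bsub>N\<^esub> u = u"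
  obtains k where "\<And>n. k n \<in> carrier A" "\<And>n. eps n \<cdot> k n = k n"
    "eps 0 \<ominus>\<^bsub>A\<^esub> c 0 = k 0 \<cdot> del 0"
    "\<And>n. eps (Suc n) \<ominus>\<^bsub>A\<^esub> c (Suc n) = k (Suc n) \<cdot> del (Suc n) \<oplus>\<^bsub>A\<^esub> del n \<cdot> k n"
proof -
  \<comment> \<open>The difference of the identity and the chain map; it induces zero on \<open>N\<close>.\<close>
  define t where "t = (\<lambda>n. eps n \<ominus>\<^bsub>A\<^esub> c n)"
  have t [simp]: "t n \<in> carrier A" "eps n \<cdot> t n = t n" "t n \<cdot> eps n = t n" for n
    by (simp_all add: t_def M.R.l_diff M.R.r_diff)
  have td: "del n \<cdot> t n = t (Suc n) \<cdot> del n" for n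
    by (simp add: t_def M.R.l_diff M.R.r_diff cd eps_del)
  have tu: "t 0 \<odot>\<^bsub>N\<^esub> u = \<zero>\<^bsub>N\<^esub>"
    by (simp add: t_def N.smult_l_diff cu N.M.diff_self)
  define I where "I = (\<lambda>n k. k \<in> carrier A \<and> eps n \<cdot> k = k \<and> del n \<cdot> (k \<cdot> del n) = del n \<cdot> t n \<and>
     k \<cdot> eps (Suc n) = k \<and> (n = 0 \<longrightarrow> t 0 = k \<cdot> del 0))"
  have "\<exists>k. \<forall>n. I n (k n) \<and> k (Suc n) \<cdot> del (Suc n) = t (Suc n) \<ominus>\<^bsub>A\<^esub> del n \<cdot> k n"
  proof (rule dependent_nat_choice)
    obtain y where y: "y \<in> carrier A" "y \<cdot> eps 1 = y" "t 0 = y \<cdot> del 0"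
      using exact_0[of "t 0"] tu by auto
    have "t 0 = (eps 0 \<cdot> y) \<cdot> del 0"
      using y t(2)[of 0] by (simp add: M.R.m_assoc)
    moreover have "eps 0 \<cdot> (eps 0 \<cdot> y) = eps 0 \<cdot> y" using y by (simp flip: M.R.m_assoc)
    ultimately have "I 0 (eps 0 \<cdot> y)" unfolding I_def using y by (simp add: M.R.m_assoc)
    then show "\<exists>k. I 0 k" by blast
  next
    fix k n assume "I n k"
    then have k: "k \<in> carrier A" "eps n \<cdot> k = k" "del n \<cdot> (k \<cdot> del n) = del n \<cdot> t n" 
      "k \<cdot> eps (Suc n) = k"
      unfolding I_def by blast+
    let ?x = "t (Suc n) \<ominus>\<^bsub>A\<^esub> del n \<cdot> k"
    have x: "?x \<in> carrier A" using k by simp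
    have xe: "?x \<cdot> eps (Suc n) = ?x" using k by (simp add: M.R.l_diff M.R.m_assoc)
    have xd: "?x \<cdot> del n = \<zero>\<^bsub>A\<^esub>" using k 
      by (simp add: M.R.l_diff M.R.m_assoc td M.R.diff_self)
    have ex: "eps (Suc n) \<cdot> ?x = ?x"
    proof -
      have "eps (Suc n) \<cdot> (del n \<cdot> k) = del n \<cdot> k"
        using k(1,2) by (simp add: M.R.m_assoc eps_del flip: M.R.m_assoc[of "eps (Suc n)"])
      then show ?thesis using k(1) by (simp add: M.R.r_diff)
    qed
    obtain y where y: "y \<in> carrier A" "y \<cdot> eps (Suc (Suc n)) = y" "?x = y \<cdot> del (Suc n)"
      using exact_Suc[OF x xe xd] by blast
    let ?y = "eps (Suc n) \<cdot> y"
    have yd: "?y \<cdot> del (Suc n) = ?x"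
      using ex y by (simp add: M.R.m_assoc)
    have "del (Suc n) \<cdot> (del n \<cdot> k) = \<zero>\<^bsub>A\<^esub>"
      using k(1) by (simp flip: M.R.m_assoc)
    then have "del (Suc n) \<cdot> ?x = del (Suc n) \<cdot> t (Suc n)"
      using k(1) by (simp add: M.R.r_diff) (simp add: a_minus_def)
    then have "del (Suc n) \<cdot> (?y \<cdot> del (Suc n)) = del (Suc n) \<cdot> t (Suc n)"
      unfolding yd .
    then have "I (Suc n) ?y" unfolding I_def using y by (simp add: M.R.m_assoc flip: M.R.m_assoc[of "eps (Suc n)" "eps (Suc n)"])
    then show "\<exists>k'. I (Suc n) k' \<and> k' \<cdot> del (Suc n) = ?x" using yd by blast
  qed
  then obtain k where k: "\<And>n. I n (k n)"
     "\<And>n. k (Suc n) \<cdot> del (Suc n) = t (Suc n) \<ominus>\<^bsub>A\<^esub> del n \<cdot> k n" by blast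
  have kc: "k n \<in> carrier A" "eps n \<cdot> k n = k n" for n using k(1)[of n] unfolding I_def by blast+
  have "t 0 = k 0 \<cdot> del 0" using k(1)[of 0] unfolding I_def by blast
  moreover have "t (Suc n) = k (Suc n) \<cdot> del (Suc n) \<oplus>\<^bsub>A\<^esub> del n \<cdot> k n" for n
    using M.R.diff_eq_iff[of "t (Suc n)" "del n \<cdot> k n" "k (Suc n) \<cdot> del (Suc n)"] k(2)[of n] kc
    by (simp add: M.R.a_comm)
  ultimately show ?thesis using that[OF kc] unfolding t_def by blast
qed

text \<open>The cocycles and coboundaries of the complex of vectors fixed by the idempotents.\<close>

definition eps_cocycles :: "nat \<Rightarrow> 'm set" where
  "eps_cocycles n = {v \<in> carrier M. eps n \<odot>\<^bsub>M\<^esub> v = v \<and> del n \<odot>\<^bsub>M\<^esub> v = \<zero>\<^bsub>M\<^esub>}"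

fun eps_coboundaries :: "nat \<Rightarrow> 'm set" where
  "eps_coboundaries 0 = {\<zero>\<^bsub>M\<^esub>}"
| "eps_coboundaries (Suc n) = (\<lambda>v. del n \<odot>\<^bsub>M\<^esub> v) ` {v \<in> carrier M. eps n \<odot>\<^bsub>M\<^esub> v = v}"

lemma cocycles_iff: "f \<in> cocycles A P d m M \<longleftrightarrow> f \<in> extensional (carrier (P m)) \<and>
    module_hom A (P m) M f \<and> (\<forall>x\<in>carrier (P (Suc m)). f (d m x) = \<zero>\<^bsub>M\<^esub>)"
  by (auto simp: cocycles_def hom_space_def)

lemma coboundaries_Suc_iff: "f \<in> coboundaries A P d (Suc n) M \<longleftrightarrow>
    (\<exists>g. module_hom A (P n) M g \<and> f = (\<lambda>x\<in>carrier (P (Suc n)). g (d n x)))"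
proof
  assume "f \<in> coboundaries A P d (Suc n) M"
  then show "\<exists>g. module_hom A (P n) M g \<and> f = (\<lambda>x\<in>carrier (P (Suc n)). g (d n x))"
    by (auto simp: hom_space_def compose_def)
next
  assume "\<exists>g. module_hom A (P n) M g \<and> f = (\<lambda>x\<in>carrier (P (Suc n)). g (d n x))"
  then obtain g where g: "module_hom A (P n) M g" "f = (\<lambda>x\<in>carrier (P (Suc n)). g (d n x))" by blast
  have "module_hom A (P n) M (restrict g (carrier (P n)))"
    using g(1) by (auto simp: module_hom_def Pi_iff)
  moreover have "f = compose (carrier (P (Suc n))) (restrict g (carrier (P n))) (d n)"
    using g(2) by (auto simp: compose_def restrict_def fun_eq_iff)
  ultimately show "f \<in> coboundaries A P d (Suc n) M"
    by (auto simp: hom_space_def)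
qed

text \<open>The comparison theorem for Ext: evaluation at \<open>p\<close> identifies cocycles on \<open>P m\<close> modulo coboundaries
  with the explicit complex. Let \<open>\<psi>\<close> be the comparison map. The composite \<open>x \<mapsto> \<psi> x \<odot> p\<close> is homotopic to
  the identity of \<open>P\<close>, so a cocycle \<open>f\<close> differs from \<open>x \<mapsto> \<psi> x \<odot> f p\<close> by a coboundary; this reduces the
  claim on coboundaries to the vector \<open>f p\<close>. Conversely \<open>x \<mapsto> \<psi> x \<odot> v\<close> is a cocycle for every explicit
  cocycle \<open>v\<close>, and its value at \<open>p\<close> differs from \<open>v\<close> by an explicit coboundary because the other
  composite is homotopic to the identity.\<close>

theorem cocycle_evaluation:
  obtains p where "p \<in> carrier (P m)"
    "\<And>f. f \<in> cocycles A P d m M \<Longrightarrow> f p \<in> eps_cocycles m"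
    "\<And>f. f \<in> cocycles A P d m M \<Longrightarrow> f \<in> coboundaries A P d m M \<longleftrightarrow> f p \<in> eps_coboundaries m"
    "\<And>v. v \<in> eps_cocycles m \<Longrightarrow> \<exists>f\<in>cocycles A P d m M. v \<ominus>\<^bsub>M\<^esub> f p \<in> eps_coboundaries m"
proof -
  obtain p where p [simp]: "\<And>n. p n \<in> carrier (P n)" "\<And>n. eps n \<odot>\<^bsub>P n\<^esub> p n = p n"
    and pu: "e (p 0) = u" and dp: "\<And>n. d n (p (Suc n)) = del n \<odot>\<^bsub>P n\<^esub> p n"
    using generator_cycles by blast
  obtain \<psi> where \<psi>: "\<And>n. module_hom A (P n) (regular_module A) (\<psi> n)"
    and \<psi>e: "\<And>n x. x \<in> carrier (P n) \<Longrightarrow> \<psi> n x \<cdot> eps n = \<psi> n x"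
    and \<psi>u: "\<And>x. x \<in> carrier (P 0) \<Longrightarrow> \<psi> 0 x \<odot>\<^bsub>N\<^esub> u = e x"
    and \<psi>d: "\<And>n x. x \<in> carrier (P (Suc n)) \<Longrightarrow> \<psi> n (d n x) = \<psi> (Suc n) x \<cdot> del n"
    using comparison_map by blast
  have \<psi>c [simp]: "\<psi> n x \<in> carrier A" if "x \<in> carrier (P n)" for n x
    using module_hom_closed[OF \<psi> that] by simp
  have \<psi>s: "\<psi> n (a \<odot>\<^bsub>P n\<^esub> x) = a \<cdot> \<psi> n x" if "a \<in> carrier A" "x \<in> carrier (P n)" for n a x
    using module_hom_smult[OF \<psi> that] by simp
  define \<theta> where "\<theta> = (\<lambda>n x. x \<ominus>\<^bsub>P n\<^esub> \<psi> n x \<odot>\<^bsub>P n\<^esub> p n)"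
  have ret: "module_hom A (P n) (P n) (\<lambda>x. \<psi> n x \<odot>\<^bsub>P n\<^esub> p n)" for n
    by (rule module_hom_comp[OF \<psi> module_hom_right_mult[OF P_module p(1)]])
  have ident: "module_hom A (P n) (P n) (\<lambda>x. x)" for n by (simp add: module_hom_def)
  have \<theta>: "module_hom A (P n) (P n) (\<theta> n)" for n
    unfolding \<theta>_def by (rule module_hom_diff_fun[OF ident ret P_module P_module])
  have \<theta>d: "d n (\<theta> (Suc n) x) = \<theta> n (d n x)" if x: "x \<in> carrier (P (Suc n))" for n x
  proof -
    have "d n (\<theta> (Suc n) x) = d n x \<ominus>\<^bsub>P n\<^esub> d n (\<psi> (Suc n) x \<odot>\<^bsub>P (Suc n)\<^esub> p (Suc n))"
      unfolding \<theta>_def using x by (intro module_hom_diff[OF d_hom P_module P_module]) simp_all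
    also have "d n (\<psi> (Suc n) x \<odot>\<^bsub>P (Suc n)\<^esub> p (Suc n)) = \<psi> n (d n x) \<odot>\<^bsub>P n\<^esub> p n"
      using module_hom_smult[OF d_hom[of n], of "\<psi> (Suc n) x" "p (Suc n)"] x
      by (simp add: dp \<psi>d Pn.smult_assoc)
    finally show ?thesis by (simp add: \<theta>_def)
  qed
  have \<theta>e: "e (\<theta> 0 x) = \<zero>\<^bsub>N\<^esub>" if x: "x \<in> carrier (P 0)" for x
  proof -
    have "e (\<theta> 0 x) = e x \<ominus>\<^bsub>N\<^esub> e (\<psi> 0 x \<odot>\<^bsub>P 0\<^esub> p 0)"
      unfolding \<theta>_def using x by (intro module_hom_diff[OF e_hom P_module N_module]) simp_all
    also have "e (\<psi> 0 x \<odot>\<^bsub>P 0\<^esub> p 0) = e x"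
      using module_hom_smult[OF e_hom, of "\<psi> 0 x" "p 0"] x by (simp add: pu \<psi>u)
    finally show ?thesis using x by (simp add: N.M.diff_self)
  qed
  obtain h where h: "\<And>n. module_hom A (P n) (P (Suc n)) (h n)"
    and h0: "\<And>x. x \<in> carrier (P 0) \<Longrightarrow> \<theta> 0 x = d 0 (h 0 x)"
    and hS: "\<And>n x. x \<in> carrier (P (Suc n)) \<Longrightarrow> 
       \<theta> (Suc n) x = d (Suc n) (h (Suc n) x) \<oplus>\<^bsub>P (Suc n)\<^esub> h n (d n x)"
    using null_homotopy[OF \<theta> \<theta>d \<theta>e] by blast
  note hc = module_hom_closed[OF h]

  have eps_cocycles: "f (p m) \<in> eps_cocycles m" if "f \<in> cocycles A P d m M" for f
  proof -
    have f: "module_hom A (P m) M f" and fd: "\<forall>x\<in>carrier (P (Suc m)). f (d m x) = \<zero>\<^bsub>M\<^esub>"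
      using that by (simp_all add: cocycles_iff)
    have "del m \<odot>\<^bsub>M\<^esub> f (p m) = f (d m (p (Suc m)))"
      using module_hom_smult[OF f del_closed p(1)] by (simp add: dp)
    then show ?thesis
      using fd module_hom_smult[OF f eps_closed[of m] p(1)] module_hom_closed[OF f p(1)] 
      by (simp add: eps_cocycles_def)
  qed

  have f_decomp: "f x = \<psi> m x \<odot>\<^bsub>M\<^esub> f (p m) \<oplus>\<^bsub>M\<^esub> f (\<theta> m x)"
    if f: "module_hom A (P m) M f" and x: "x \<in> carrier (P m)" for f x
  proof -
    have "f (\<theta> m x) = f x \<ominus>\<^bsub>M\<^esub> f (\<psi> m x \<odot>\<^bsub>P m\<^esub> p m)"
      unfolding \<theta>_def using x by (intro module_hom_diff[OF f P_module M_module]) simp_all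
    also have "f (\<psi> m x \<odot>\<^bsub>P m\<^esub> p m) = \<psi> m x \<odot>\<^bsub>M\<^esub> f (p m)"
      using module_hom_smult[OF f] x by simp
    finally have "f x \<ominus>\<^bsub>M\<^esub> \<psi> m x \<odot>\<^bsub>M\<^esub> f (p m) = f (\<theta> m x)" by simp
    then show ?thesis
      using x module_hom_closed[OF f] module_hom_closed[OF \<theta> x]
        M.M.diff_eq_iff[of "f x" "\<psi> m x \<odot>\<^bsub>M\<^esub> f (p m)" "f (\<theta> m x)"] by simp
  qed

  have eps_coboundaries: "f \<in> coboundaries A P d m M \<longleftrightarrow> f (p m) \<in> eps_coboundaries m" if "f \<in> cocycles A P d m M" for f
  proof -
    have ext: "f \<in> extensional (carrier (P m))" 
      and f: "module_hom A (P m) M f" and fd: "\<forall>x\<in>carrier (P (Suc m)). f (d m x) = \<zero>\<^bsub>M\<^esub>"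
      using that by (simp_all add: cocycles_iff)
    note fc = module_hom_closed[OF f]
    show ?thesis
    proof (cases m)
      case 0
      have "f = (\<lambda>x\<in>carrier (P 0). \<zero>\<^bsub>M\<^esub>)" if "f (p m) = \<zero>\<^bsub>M\<^esub>"
      proof
        fix x show "f x = (\<lambda>x\<in>carrier (P 0). \<zero>\<^bsub>M\<^esub>) x"
        proof (cases "x \<in> carrier (P 0)")
          case True
          then have "f (\<theta> m x) = \<zero>\<^bsub>M\<^esub>" using h0[of x] fd hc[of x 0] 0 by simp
          then show ?thesis using f_decomp[OF f, of x] True that 0 by simp
        qed (use ext 0 in \<open>simp add: extensional_def\<close>)
      qed
      then show ?thesis using 0 p(1)[of 0] by (auto simp: hom_space_def)
    next
      case (Suc n)
      have 1: "f (p m) \<in> eps_coboundaries m" if g: "module_hom A (P n) M g" 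
        and fg: "f = (\<lambda>x\<in>carrier (P (Suc n)). g (d n x))" for g
      proof -
        have "f (p m) = del n \<odot>\<^bsub>M\<^esub> g (p n)"
          using fg p(1)[of "Suc n"] Suc by (simp add: dp module_hom_smult[OF g])
        moreover have "eps n \<odot>\<^bsub>M\<^esub> g (p n) = g (p n)" 
          using module_hom_smult[OF g eps_closed p(1), of n] by simp
        ultimately show ?thesis using Suc module_hom_closed[OF g p(1)] by auto
      qed
      have 2: "\<exists>g. module_hom A (P n) M g \<and> f = (\<lambda>x\<in>carrier (P (Suc n)). g (d n x))"
        if fp: "f (p m) \<in> eps_coboundaries m"
      proof -
        obtain y where y: "y \<in> carrier M" "f (p m) = del n \<odot>\<^bsub>M\<^esub> y"
          using fp Suc by auto
        have f': "module_hom A (P (Suc n)) M f" using f Suc by simp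
        \<comment> \<open>The first summand accounts for \<open>x \<mapsto> \<psi> x \<odot> f p\<close>, the second for the homotopy.\<close>
        let ?g = "\<lambda>z. \<psi> n z \<odot>\<^bsub>M\<^esub> y \<oplus>\<^bsub>M\<^esub> f (h n z)"
        have "module_hom A (P n) M ?g"
          by (rule module_hom_add_fun[OF module_hom_comp[OF \<psi> module_hom_right_mult[OF M_module y(1)]]
               module_hom_comp[OF h f'] P_module M_module])
        moreover have "f = (\<lambda>x\<in>carrier (P (Suc n)). ?g (d n x))"
        proof
          fix x show "f x = (\<lambda>x\<in>carrier (P (Suc n)). ?g (d n x)) x"
          proof (cases "x \<in> carrier (P (Suc n))")
            case True
            have "f (\<theta> m x) = f (d (Suc n) (h (Suc n) x)) \<oplus>\<^bsub>M\<^esub> f (h n (d n x))"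
              using hS[OF True] module_hom_add[OF f'] hc[OF True] hc[OF d_closed[OF True]] Suc by simp
            also have "\<dots> = f (h n (d n x))"
              using fd hc[OF True] Suc module_hom_closed[OF f' hc[OF d_closed[OF True]]] by simp
            finally have *: "f (\<theta> m x) = f (h n (d n x))" .
            have "\<psi> m x \<odot>\<^bsub>M\<^esub> f (p m) = \<psi> n (d n x) \<odot>\<^bsub>M\<^esub> y"
              using True y Suc by (simp add: \<psi>d M.smult_assoc)
            then show ?thesis using f_decomp[OF f, of x] * True Suc by simp
          qed (use ext Suc in \<open>simp add: extensional_def\<close>)
        qed
        ultimately show ?thesis by blast
      qed
      show ?thesis using 1 2 coboundaries_Suc_iff[of f n] Suc by auto
    qed
  qed

  \<comment> \<open>The composite of the two chain maps on the cyclic resolution.\<close>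
  define c where "c = (\<lambda>n. \<psi> n (p n))"
  have c: "c n \<in> carrier A" "eps n \<cdot> c n = c n" "c n \<cdot> eps n = c n" "del n \<cdot> c n = c (Suc n) \<cdot> del n" for n
    using \<psi>s[OF eps_closed[of n] p(1)[of n]] \<psi>s[OF del_closed[of n] p(1)[of n]] \<psi>e[OF p(1)] \<psi>d[OF p(1), of n]
    by (simp_all add: c_def dp)
  have cu: "c 0 \<odot>\<^bsub>N\<^esub> u = u" using \<psi>u[OF p(1)] pu by (simp add: c_def)
  obtain k where k: "\<And>n. k n \<in> carrier A" "\<And>n. eps n \<cdot> k n = k n"
    and k0: "eps 0 \<ominus>\<^bsub>A\<^esub> c 0 = k 0 \<cdot> del 0"
    and kS: "\<And>n. eps (Suc n) \<ominus>\<^bsub>A\<^esub> c (Suc n) = k (Suc n) \<cdot> del (Suc n) \<oplus>\<^bsub>A\<^esub> del n \<cdot> k n"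
    by (rule generator_homotopy[OF c cu]) blast+

  have surj: "\<exists>f\<in>cocycles A P d m M. v \<ominus>\<^bsub>M\<^esub> f (p m) \<in> eps_coboundaries m" if "v \<in> eps_cocycles m" for v
  proof -
    have v: "v \<in> carrier M" "eps m \<odot>\<^bsub>M\<^esub> v = v" "del m \<odot>\<^bsub>M\<^esub> v = \<zero>\<^bsub>M\<^esub>"
      using that by (simp_all add: eps_cocycles_def)
    let ?f = "\<lambda>x. \<psi> m x \<odot>\<^bsub>M\<^esub> v"
    have f: "module_hom A (P m) M ?f"
      by (rule module_hom_comp[OF \<psi> module_hom_right_mult[OF M_module v(1)]])
    have "?f (d m x) = \<zero>\<^bsub>M\<^esub>" if "x \<in> carrier (P (Suc m))" for x
      using that v by (simp add: \<psi>d M.smult_assoc)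
    moreover have "module_hom A (P m) M (restrict ?f (carrier (P m)))"
      using f by (simp add: module_hom_def Pi_iff)
    ultimately have coc: "restrict ?f (carrier (P m)) \<in> cocycles A P d m M"
      by (simp add: cocycles_iff)
    have *: "v \<ominus>\<^bsub>M\<^esub> ?f (p m) = (eps m \<ominus>\<^bsub>A\<^esub> c m) \<odot>\<^bsub>M\<^esub> v"
      using v c(1) by (simp add: M.smult_l_diff c_def)
    have "v \<ominus>\<^bsub>M\<^esub> ?f (p m) \<in> eps_coboundaries m"
    proof (cases m)
      case 0
      then show ?thesis unfolding * using k0 k v by (simp add: M.smult_assoc)
    next
      case (Suc n)
      have "(eps m \<ominus>\<^bsub>A\<^esub> c m) \<odot>\<^bsub>M\<^esub> v = del n \<odot>\<^bsub>M\<^esub> (k n \<odot>\<^bsub>M\<^esub> v)"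
        using kS[of n] k v Suc by (simp add: M.smult_l_distr M.smult_assoc)
      moreover have "eps n \<odot>\<^bsub>M\<^esub> (k n \<odot>\<^bsub>M\<^esub> v) = k n \<odot>\<^bsub>M\<^esub> v"
        using k v by (simp flip: M.smult_assoc)
      ultimately show ?thesis unfolding * using Suc k v by auto
    qed
    then show ?thesis using coc by (intro bexI[OF _ coc]) simp
  qed
  show ?thesis by (rule that[of "p m"]) (use p(1)[of m] eps_cocycles eps_coboundaries surj in auto)
qed

end

section \<open>Ext as a vector space\<close>

lemma ring_of_type_algebra_simps [simp]:
  "carrier ring_of_type_algebra = UNIV" "x \<oplus>\<^bsub>ring_of_type_algebra\<^esub> y = x + y"
  "x \<otimes>\<^bsub>ring_of_type_algebra\<^esub> y = x * y" "\<one>\<^bsub>ring_of_type_algebra\<^esub> = 1"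
  "\<zero>\<^bsub>ring_of_type_algebra\<^esub> = 0"
  by (simp_all add: ring_of_type_algebra_def)

text \<open>The laws of a quotient of cocycles need not be checked directly: they follow from those of the
  target once a bijection respects the operations.\<close>

lemma vector_space_transport:
  fixes Z :: "('k::field, 'z) module" and W :: "('k, 'w) module"
  assumes W: "module ring_of_type_algebra W"
    and bij: "bij_betw \<Psi> (carrier Z) (carrier W)"
    and zero: "\<zero>\<^bsub>Z\<^esub> \<in> carrier Z" 
    and add_closed: "\<And>x y. x \<in> carrier Z \<Longrightarrow> y \<in> carrier Z \<Longrightarrow> x \<oplus>\<^bsub>Z\<^esub> y \<in> carrier Z"
    and smult_closed: "\<And>k x. x \<in> carrier Z \<Longrightarrow> k \<odot>\<^bsub>Z\<^esub> x \<in> carrier Z"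
    and hom: "module_hom ring_of_type_algebra Z W \<Psi>" "\<Psi> \<zero>\<^bsub>Z\<^esub> = \<zero>\<^bsub>W\<^esub>"
  shows "module ring_of_type_algebra Z"
proof -
  interpret W: module ring_of_type_algebra W by fact
  note [simp] = zero add_closed smult_closed hom(2)
  have c [simp]: "\<Psi> x \<in> carrier W" if "x \<in> carrier Z" for x using that bij bij_betwE by blast
  have a [simp]: "\<Psi> (x \<oplus>\<^bsub>Z\<^esub> y) = \<Psi> x \<oplus>\<^bsub>W\<^esub> \<Psi> y" if "x \<in> carrier Z" "y \<in> carrier Z" for x y
    using module_hom_add[OF hom(1)] that by blast
  have s [simp]: "\<Psi> (k \<odot>\<^bsub>Z\<^esub> x) = k \<odot>\<^bsub>W\<^esub> \<Psi> x" if "x \<in> carrier Z" for x k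
    using module_hom_smult[OF hom(1), of k x] that by simp
  have inj: "x = y" if "\<Psi> x = \<Psi> y" "x \<in> carrier Z" "y \<in> carrier Z" for x y
    using bij that by (auto simp: bij_betw_def dest: inj_onD)
  have "abelian_group Z"
  proof (rule abelian_groupI)
    fix x assume x: "x \<in> carrier Z"
    obtain y where y: "y \<in> carrier Z" "\<Psi> y = \<ominus>\<^bsub>W\<^esub> \<Psi> x"
      using bij x c[OF x] W.a_inv_closed[OF c[OF x]] by (metis bij_betw_imp_surj_on imageE)
    then have "y \<oplus>\<^bsub>Z\<^esub> x = \<zero>\<^bsub>Z\<^esub>" using x by (intro inj) (simp_all add: W.l_neg)
    then show "\<exists>y\<in>carrier Z. y \<oplus>\<^bsub>Z\<^esub> x = \<zero>\<^bsub>Z\<^esub>" using y by blast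
  qed (auto intro!: inj simp: W.a_ac)
  then show ?thesis
    by (intro module.intro module_axioms.intro W.cring_axioms)
      (auto intro!: inj simp: W.smult_l_distr[simplified] W.smult_r_distr[simplified] W.smult_assoc1[simplified] W.smult_one[simplified])
qed

text \<open>Scalars act on modules through \<open>k \<odot> 1\<close>, which has to be central for Ext to be a vector space.\<close>

locale cyclic_resolution_algebra = cyclic_resolution A M N P d e eps del u
  for A :: "('k::field, 'a) module" and M :: "('a, 'm) module" and N :: "('a, 'n) module"
    and P :: "nat \<Rightarrow> ('a, 'p) module" and d e eps del u +
  assumes scalar_closed [simp]: "k \<odot>\<^bsub>A\<^esub> \<one>\<^bsub>A\<^esub> \<in> carrier A"
    and scalar_central: "a \<in> carrier A \<Longrightarrow> (k \<odot>\<^bsub>A\<^esub> \<one>\<^bsub>A\<^esub>) \<otimes>\<^bsub>A\<^esub> a = a \<otimes>\<^bsub>A\<^esub> (k \<odot>\<^bsub>A\<^esub> \<one>\<^bsub>A\<^esub>)"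
begin

abbreviation Cocyc where "Cocyc m \<equiv> cocycles A P d m M"
abbreviation Cobnd where "Cobnd m \<equiv> coboundaries A P d m M"
text \<open>The space of which Ext is the quotient, as a constant of its own: the simplifier would otherwise
  rewrite the operations of the updated record to those of the space of all homomorphisms.\<close>

definition cocycle_space where "cocycle_space m = hom_space A (P m) M \<lparr>carrier := Cocyc m\<rparr>"

lemma cocycle_space_simps [simp]:
  "carrier (cocycle_space m) = Cocyc m"
  "f \<oplus>\<^bsub>cocycle_space m\<^esub> g = (\<lambda>x\<in>carrier (P m). f x \<oplus>\<^bsub>M\<^esub> g x)"
  "\<zero>\<^bsub>cocycle_space m\<^esub> = (\<lambda>x\<in>carrier (P m). \<zero>\<^bsub>M\<^esub>)"
  "k \<odot>\<^bsub>cocycle_space m\<^esub> f = (\<lambda>x\<in>carrier (P m). (k \<odot>\<^bsub>A\<^esub> \<one>\<^bsub>A\<^esub>) \<odot>\<^bsub>M\<^esub> f x)"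
  by (simp_all add: cocycle_space_def hom_space_def)

lemma cocycles_closed [simp]: "f \<in> Cocyc m \<Longrightarrow> x \<in> carrier (P m) \<Longrightarrow> f x \<in> carrier M"
  using cocycles_iff module_hom_closed by metis

lemma module_hom_restrict:
  "module_hom A (P m) M (restrict f (carrier (P m))) \<longleftrightarrow> module_hom A (P m) M f"
  by (auto simp: module_hom_def Pi_iff)

lemma cocycles_restrict:
  "restrict f (carrier (P m)) \<in> Cocyc m \<longleftrightarrow>
    module_hom A (P m) M f \<and> (\<forall>x\<in>carrier (P (Suc m)). f (d m x) = \<zero>\<^bsub>M\<^esub>)"
  by (auto simp: cocycles_iff module_hom_restrict)

lemma zero_cocycle: "\<zero>\<^bsub>cocycle_space m\<^esub> \<in> Cocyc m"
  unfolding cocycle_space_simps cocycles_restrict by (auto simp: module_hom_def)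

lemma add_cocycle: "f \<in> Cocyc m \<Longrightarrow> g \<in> Cocyc m \<Longrightarrow> f \<oplus>\<^bsub>cocycle_space m\<^esub> g \<in> Cocyc m"
  unfolding cocycle_space_simps cocycles_restrict
  by (intro conjI module_hom_add_fun) (auto simp: cocycles_iff P_module M_module)

lemma smult_hom:
  assumes f: "module_hom A (P m) M f"
  shows "module_hom A (P m) M (\<lambda>x. (k \<odot>\<^bsub>A\<^esub> \<one>\<^bsub>A\<^esub>) \<odot>\<^bsub>M\<^esub> f x)"
proof -
  have "(k \<odot>\<^bsub>A\<^esub> \<one>\<^bsub>A\<^esub>) \<odot>\<^bsub>M\<^esub> f (a \<odot>\<^bsub>P m\<^esub> x) = a \<odot>\<^bsub>M\<^esub> ((k \<odot>\<^bsub>A\<^esub> \<one>\<^bsub>A\<^esub>) \<odot>\<^bsub>M\<^esub> f x)"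
    if "a \<in> carrier A" "x \<in> carrier (P m)" for a x
    using module_hom_smult[OF f that] scalar_central[OF that(1), of k] that module_hom_closed[OF f that(2)]
      M.smult_assoc[OF that(1) scalar_closed] M.smult_assoc[OF scalar_closed that(1)] by metis
  then show ?thesis
    using module_hom_closed[OF f] module_hom_add[OF f]
    by (auto simp: module_hom_def M.smult_r_distr)
qed

lemma smult_cocycle: "f \<in> Cocyc m \<Longrightarrow> k \<odot>\<^bsub>cocycle_space m\<^esub> f \<in> Cocyc m"
  unfolding cocycle_space_simps cocycles_restrict
  by (intro conjI smult_hom) (auto simp: cocycles_iff)

lemma minus_one_hom: 
  assumes f: "module_hom A (P m) M f"
  shows "module_hom A (P m) M (\<lambda>x. \<ominus>\<^bsub>M\<^esub> f x)"
  using module_hom_closed[OF f] module_hom_add[OF f] module_hom_smult[OF f]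
  by (auto simp: module_hom_def M.smult_r_minus M.M.minus_add)

lemma cocycle_space_group: "abelian_group (cocycle_space m)"
proof (rule abelian_groupI)
  fix f assume "f \<in> carrier (cocycle_space m)"
  then have f: "f \<in> Cocyc m" by simp
  let ?g = "\<lambda>x\<in>carrier (P m). \<ominus>\<^bsub>M\<^esub> f x"
  have "?g \<in> Cocyc m"
    unfolding cocycles_restrict using f by (intro conjI minus_one_hom) (auto simp: cocycles_iff)
  moreover have "?g \<oplus>\<^bsub>cocycle_space m\<^esub> f = \<zero>\<^bsub>cocycle_space m\<^esub>" using f by (auto simp: fun_eq_iff M.M.l_neg)
  ultimately show "\<exists>g\<in>carrier (cocycle_space m). g \<oplus>\<^bsub>cocycle_space m\<^esub> f = \<zero>\<^bsub>cocycle_space m\<^esub>" by (intro bexI[of _ ?g]) simp_all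
next
  fix f assume "f \<in> carrier (cocycle_space m)"
  then have f: "f \<in> Cocyc m" by simp
  then have "f \<in> extensional (carrier (P m))" by (simp add: cocycles_iff)
  then show "\<zero>\<^bsub>cocycle_space m\<^esub> \<oplus>\<^bsub>cocycle_space m\<^esub> f = f" using f by (auto simp: fun_eq_iff extensional_def)
qed (use zero_cocycle add_cocycle in \<open>auto simp: fun_eq_iff M.M.a_ac\<close>)

text \<open>A linear map \<open>\<pi>\<close> on \<open>M\<close> whose restriction to explicit cocycles has the explicit coboundaries as kernel
  and is onto \<open>W\<close> induces \<open>Ext \<cong> W\<close>. It sends the class of \<open>f\<close> to \<open>\<pi> (f p)\<close>. An endomorphism \<open>g\<close> of
  \<open>M\<close> acts on cocycles by \<open>f \<mapsto> g \<circ> f\<close>, so any map of \<open>W\<close> that \<open>\<pi>\<close> intertwines with \<open>g\<close> describes the action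
  on Ext; the element \<open>p\<close> is not changed by \<open>g\<close>.\<close>

theorem Ext_iso:
  fixes W :: "('k, 'w) module" and \<pi> :: "'m \<Rightarrow> 'w"
  assumes W: "module ring_of_type_algebra W"
    and \<pi>_closed: "\<And>x. x \<in> carrier M \<Longrightarrow> \<pi> x \<in> carrier W"
    and \<pi>_add: "\<And>x y. x \<in> carrier M \<Longrightarrow> y \<in> carrier M \<Longrightarrow> \<pi> (x \<oplus>\<^bsub>M\<^esub> y) = \<pi> x \<oplus>\<^bsub>W\<^esub> \<pi> y"
    and \<pi>_smult: "\<And>k x. x \<in> carrier M \<Longrightarrow> \<pi> ((k \<odot>\<^bsub>A\<^esub> \<one>\<^bsub>A\<^esub>) \<odot>\<^bsub>M\<^esub> x) = k \<odot>\<^bsub>W\<^esub> \<pi> x"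
    and ker: "\<And>v. v \<in> eps_cocycles m \<Longrightarrow> \<pi> v = \<zero>\<^bsub>W\<^esub> \<longleftrightarrow> v \<in> eps_coboundaries m"
    and onto: "\<And>w. w \<in> carrier W \<Longrightarrow> \<exists>v\<in>eps_cocycles m. \<pi> v = w"
  obtains \<Psi> where "module ring_of_type_algebra (Ext_space A P d m M)"
    "module_hom ring_of_type_algebra (Ext_space A P d m M) W \<Psi>"
    "bij_betw \<Psi> (carrier (Ext_space A P d m M)) (carrier W)"
    "\<And>g act C. module_hom A M M g \<Longrightarrow> (\<And>x. x \<in> carrier M \<Longrightarrow> \<pi> (g x) = act (\<pi> x)) \<Longrightarrow>
       C \<in> carrier (Ext_space A P d m M) \<Longrightarrow>
       Ext_map A P d m M M g C \<in> carrier (Ext_space A P d m M) \<and>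
       \<Psi> (Ext_map A P d m M M g C) = act (\<Psi> C)"
proof -
  let ?H = "cocycle_space m" and ?Z = "Ext_space A P d m M"
  interpret W: module ring_of_type_algebra W by fact
  interpret H: abelian_group ?H by (rule cocycle_space_group)
  obtain p where p: "p \<in> carrier (P m)"
    and pc: "\<And>f. f \<in> Cocyc m \<Longrightarrow> f p \<in> eps_cocycles m"
    and pb: "\<And>f. f \<in> Cocyc m \<Longrightarrow> f \<in> Cobnd m \<longleftrightarrow> f p \<in> eps_coboundaries m"
    and ps: "\<And>v. v \<in> eps_cocycles m \<Longrightarrow> \<exists>f\<in>Cocyc m. v \<ominus>\<^bsub>M\<^esub> f p \<in> eps_coboundaries m"
    using cocycle_evaluation[of m] by blast
  define \<Theta> where "\<Theta> = (\<lambda>f. \<pi> (f p))"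
  have \<Theta>c: "\<Theta> f \<in> carrier W" if "f \<in> Cocyc m" for f
    using that p \<pi>_closed by (simp add: \<Theta>_def)
  have \<Theta>a: "\<Theta> (f \<oplus>\<^bsub>?H\<^esub> g) = \<Theta> f \<oplus>\<^bsub>W\<^esub> \<Theta> g" if "f \<in> Cocyc m" "g \<in> Cocyc m" for f g
    using that p by (simp add: \<Theta>_def \<pi>_add)
  have \<Theta>s: "\<Theta> (k \<odot>\<^bsub>?H\<^esub> f) = k \<odot>\<^bsub>W\<^esub> \<Theta> f" if "f \<in> Cocyc m" for f k
    using that p by (simp add: \<Theta>_def \<pi>_smult)
  interpret \<Theta>: abelian_group_hom ?H W \<Theta>
  proof (rule abelian_group_homI[OF cocycle_space_group W.abelian_group_axioms])
    show "group_hom (add_monoid ?H) (add_monoid W) \<Theta>"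
      by (intro group_hom.intro group_hom_axioms.intro H.a_group W.a_group)
        (simp add: hom_def Pi_iff \<Theta>c \<Theta>a del: cocycle_space_simps(2))
  qed
  have BC: "Cobnd m \<subseteq> Cocyc m"
  proof (cases m)
    case 0
    have "Cobnd 0 = {\<zero>\<^bsub>cocycle_space 0\<^esub>}" by (simp add: cocycle_space_def)
    then show ?thesis using zero_cocycle[of 0] 0 by simp
  next
    case (Suc n)
    have "f \<in> Cocyc (Suc n)" if "f \<in> Cobnd (Suc n)" for f
    proof -
      obtain g where g: "module_hom A (P n) M g" "f = (\<lambda>x\<in>carrier (P (Suc n)). g (d n x))"
        using \<open>f \<in> Cobnd (Suc n)\<close> unfolding coboundaries_Suc_iff by blast
      show ?thesis
        unfolding g(2) cocycles_restrict
        using module_hom_comp[OF d_hom g(1)] module_hom_zero[OF g(1) P_module M_module] by simp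
    qed
    then show ?thesis using Suc by blast
  qed
  have B: "Cobnd m = a_kernel ?H W \<Theta>"
    using BC ker pc pb by (auto simp: a_kernel_def' \<Theta>_def)
  interpret B: abelian_subgroup "Cobnd m" ?H
    unfolding B by (rule \<Theta>.abelian_subgroup_a_kernel)
  have Zc: "carrier ?Z = carrier (?H A_Mod Cobnd m)"
    and Za: "\<And>C C2. C \<oplus>\<^bsub>?Z\<^esub> C2 = C \<otimes>\<^bsub>?H A_Mod Cobnd m\<^esub> C2"
    and Z0: "\<zero>\<^bsub>?Z\<^esub> = Cobnd m"
    and Zs: "\<And>k C. k \<odot>\<^bsub>?Z\<^esub> C = (\<Union>f\<in>C. Cobnd m +>\<^bsub>?H\<^esub> (k \<odot>\<^bsub>?H\<^esub> f))"
    by (simp_all add: Ext_space_def quotient_module_def A_FactGroup_def FactGroup_def A_RCOSETS_def set_add_def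
        flip: cocycle_space_def del: cocycle_space_simps)
  have Z_cosets: "carrier ?Z = (\<lambda>f. Cobnd m +>\<^bsub>?H\<^esub> f) ` Cocyc m"
    by (auto simp: Ext_space_def quotient_module_def A_RCOSETS_def' simp flip: cocycle_space_def simp del: cocycle_space_simps(2-4))
  have mem: "f' \<in> Cocyc m \<and> \<Theta> f' = \<Theta> f" if f': "f' \<in> Cobnd m +>\<^bsub>?H\<^esub> f" and f: "f \<in> Cocyc m" for f f'
  proof -
    obtain b where b: "b \<in> Cobnd m" "f' = b \<oplus>\<^bsub>?H\<^esub> f" using f' by (auto simp: a_r_coset_def' simp del: cocycle_space_simps)
    have "b \<in> Cocyc m" "\<Theta> b = \<zero>\<^bsub>W\<^esub>" using b(1) unfolding B a_kernel_def' by simp_all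
    then show ?thesis using b(2) f add_cocycle \<Theta>a \<Theta>c by (simp del: cocycle_space_simps)
  qed
  have coset_eq: "Cobnd m +>\<^bsub>?H\<^esub> f' = Cobnd m +>\<^bsub>?H\<^esub> f" 
    if "f \<in> Cocyc m" "f' \<in> Cocyc m" "\<Theta> f' = \<Theta> f" for f f'
  proof -
    have f: "f \<in> carrier ?H" "f' \<in> carrier ?H" using that by simp_all
    have "\<Theta> (f' \<oplus>\<^bsub>?H\<^esub> \<ominus>\<^bsub>?H\<^esub> f) = \<zero>\<^bsub>W\<^esub>"
      using f that(3) \<Theta>c[OF that(1)] by (simp add: W.r_neg del: cocycle_space_simps)
    then have "f' \<oplus>\<^bsub>?H\<^esub> \<ominus>\<^bsub>?H\<^esub> f \<in> Cobnd m"
      using f unfolding B a_kernel_def' by (simp del: cocycle_space_simps)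
    then have "f' \<in> Cobnd m +>\<^bsub>?H\<^esub> f" using f B.a_rcos_module by blast
    then show ?thesis using H.a_repr_independence[OF _ f(1) B.a_subgroup] by metis
  qed
  have self: "f \<in> Cobnd m +>\<^bsub>?H\<^esub> f" if "f \<in> Cocyc m" for f
    using B.a_rcos_self that by simp
  define \<Psi> where "\<Psi> = (\<lambda>C. the_elem (\<Theta> ` C))"
  have \<Psi>: "\<Psi> (Cobnd m +>\<^bsub>?H\<^esub> f) = \<Theta> f" if "f \<in> Cocyc m" for f
  proof -
    have "\<Theta> ` (Cobnd m +>\<^bsub>?H\<^esub> f) = {\<Theta> f}"
    proof (intro equalityI subsetI)
      show "w \<in> {\<Theta> f}" if "w \<in> \<Theta> ` (Cobnd m +>\<^bsub>?H\<^esub> f)" for w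
        using that mem[OF _ \<open>f \<in> Cocyc m\<close>] by blast
      show "w \<in> \<Theta> ` (Cobnd m +>\<^bsub>?H\<^esub> f)" if "w \<in> {\<Theta> f}" for w
        using that self[OF \<open>f \<in> Cocyc m\<close>] by blast
    qed
    then show ?thesis by (simp add: \<Psi>_def)
  qed
  have Zs': "k \<odot>\<^bsub>?Z\<^esub> (Cobnd m +>\<^bsub>?H\<^esub> f) = Cobnd m +>\<^bsub>?H\<^esub> (k \<odot>\<^bsub>?H\<^esub> f)" if f: "f \<in> Cocyc m" for k f
  proof -
    have "Cobnd m +>\<^bsub>?H\<^esub> (k \<odot>\<^bsub>?H\<^esub> f') = Cobnd m +>\<^bsub>?H\<^esub> (k \<odot>\<^bsub>?H\<^esub> f)" if "f' \<in> Cobnd m +>\<^bsub>?H\<^esub> f" for f'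
      using mem[OF that f] f by (intro coset_eq smult_cocycle) (simp_all add: \<Theta>s del: cocycle_space_simps)
    then show ?thesis unfolding Zs using self[OF f] by blast
  qed
  have surj: "\<Theta> ` carrier ?H = carrier W"
  proof (intro equalityI subsetI)
    fix w assume "w \<in> carrier W"
    then obtain v where v: "v \<in> eps_cocycles m" "\<pi> v = w" using onto by blast
    obtain f where f: "f \<in> Cocyc m" "v \<ominus>\<^bsub>M\<^esub> f p \<in> eps_coboundaries m" using ps[OF v(1)] by blast
    have vM: "v \<in> carrier M" "f p \<in> carrier M" using v f p by (simp_all add: eps_cocycles_def)
    have cd: "v \<ominus>\<^bsub>M\<^esub> f p \<in> eps_cocycles m"
      using v(1) pc[OF f(1)] by (auto simp: eps_cocycles_def M.smult_r_diff M.M.diff_self)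
    then have "\<pi> (v \<ominus>\<^bsub>M\<^esub> f p) = \<zero>\<^bsub>W\<^esub>" using ker f(2) by blast
    then have "\<pi> (f p) = \<pi> (f p \<oplus>\<^bsub>M\<^esub> (v \<ominus>\<^bsub>M\<^esub> f p))"
      using vM \<pi>_closed by (simp add: \<pi>_add)
    also have "f p \<oplus>\<^bsub>M\<^esub> (v \<ominus>\<^bsub>M\<^esub> f p) = v"
      using M.M.diff_eq_iff[of v "f p" "v \<ominus>\<^bsub>M\<^esub> f p"] vM by simp
    finally show "w \<in> \<Theta> ` carrier ?H" using f v by (auto simp: \<Theta>_def)
  qed (use \<Theta>c in auto)
  have inj: "inj_on \<Psi> (carrier ?Z)"
    unfolding \<Psi>_def Zc B by (rule \<Theta>.A_FactGroup_inj_on)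
  have bij: "bij_betw \<Psi> (carrier ?Z) (carrier W)"
    unfolding bij_betw_def using inj \<Theta>.A_FactGroup_onto[OF surj] unfolding \<Psi>_def Zc B by simp
  have hom: "module_hom ring_of_type_algebra ?Z W \<Psi>"
    unfolding module_hom_def
  proof (intro conjI ballI)
    show "\<Psi> \<in> carrier ?Z \<rightarrow> carrier W" using bij bij_betwE by blast
    show "\<Psi> (C \<oplus>\<^bsub>?Z\<^esub> C2) = \<Psi> C \<oplus>\<^bsub>W\<^esub> \<Psi> C2" if "C \<in> carrier ?Z" "C2 \<in> carrier ?Z" for C C2
      using \<Theta>.A_FactGroup_hom that unfolding Zc Za \<Psi>_def B hom_def by simp
    show "\<Psi> (k \<odot>\<^bsub>?Z\<^esub> C) = k \<odot>\<^bsub>W\<^esub> \<Psi> C" if "C \<in> carrier ?Z" for k C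
      using that unfolding Z_cosets by (auto simp: Zs' \<Psi> \<Theta>s smult_cocycle simp del: cocycle_space_simps)
  qed
  have Z0': "Cobnd m = Cobnd m +>\<^bsub>?H\<^esub> \<zero>\<^bsub>?H\<^esub>" 
    using H.a_coset_add_zero[OF B.a_subset] by simp
  have mod: "module ring_of_type_algebra ?Z"
  proof (rule vector_space_transport[OF W bij _ _ _ hom])
    show "\<zero>\<^bsub>?Z\<^esub> \<in> carrier ?Z" unfolding Z0 Z_cosets using Z0' zero_cocycle by blast
    show "C \<oplus>\<^bsub>?Z\<^esub> C2 \<in> carrier ?Z" if "C \<in> carrier ?Z" "C2 \<in> carrier ?Z" for C C2
      using that unfolding Zc Za by (rule monoid.m_closed[OF group.is_monoid[OF B.a_factorgroup_is_group]])
    show "k \<odot>\<^bsub>?Z\<^esub> C \<in> carrier ?Z" if "C \<in> carrier ?Z" for k C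
      using that unfolding Z_cosets by (auto simp: Zs' smult_cocycle simp del: cocycle_space_simps)
    show "\<Psi> \<zero>\<^bsub>?Z\<^esub> = \<zero>\<^bsub>W\<^esub>"
      unfolding Z0 by (subst Z0') (simp add: \<Psi> zero_cocycle del: cocycle_space_simps)
  qed
  show ?thesis
  proof (rule that[OF mod hom bij])
    fix g act C assume g: "module_hom A M M g" and act: "\<And>x. x \<in> carrier M \<Longrightarrow> \<pi> (g x) = act (\<pi> x)"
      and C: "C \<in> carrier ?Z"
    obtain f where f: "f \<in> Cocyc m" "C = Cobnd m +>\<^bsub>?H\<^esub> f" using C unfolding Z_cosets by blast
    let ?g = "\<lambda>f. compose (carrier (P m)) g f"
    have gc: "?g f' \<in> Cocyc m" if "f' \<in> Cocyc m" for f'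
      unfolding compose_def cocycles_restrict using that module_hom_zero[OF g M_module M_module]
      by (intro conjI module_hom_comp[OF _ g]) (simp_all add: cocycles_iff)
    have g\<Theta>: "\<Theta> (?g f') = act (\<Theta> f')" if "f' \<in> Cocyc m" for f'
      using that p act by (simp add: \<Theta>_def compose_def)
    have "Ext_map A P d m M M g C = (\<Union>f'\<in>C. Cobnd m +>\<^bsub>?H\<^esub> ?g f')"
      by (simp add: Ext_map_def a_r_coset_def' cocycle_space_def)
    also have "\<dots> = Cobnd m +>\<^bsub>?H\<^esub> ?g f"
    proof -
      have "Cobnd m +>\<^bsub>?H\<^esub> ?g f' = Cobnd m +>\<^bsub>?H\<^esub> ?g f" if "f' \<in> C" for f'
        using mem[of f' f] that f by (intro coset_eq gc) (simp_all add: g\<Theta>)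
      then show ?thesis using self[OF f(1)] f(2) by blast
    qed
    finally have E: "Ext_map A P d m M M g C = Cobnd m +>\<^bsub>?H\<^esub> ?g f" .
    show "Ext_map A P d m M M g C \<in> carrier ?Z \<and> \<Psi> (Ext_map A P d m M M g C) = act (\<Psi> C)"
      unfolding E unfolding f(2) \<Psi>[OF f(1)] \<Psi>[OF gc[OF f(1)]] g\<Theta>[OF f(1)] Z_cosets using gc[OF f(1)] by blast
  qed
qed

end

section \<open>Generation of SL(2,Z) and transport of representations\<close>

text \<open>From here on, the dollar sign only denotes the components of vectors, not those of power series.\<close>

no_notation fps_nth (infixl \<open>$\<close> 75)

definition mat22 :: "'a::comm_ring_1 \<Rightarrow> 'a \<Rightarrow> 'a \<Rightarrow> 'a \<Rightarrow> 'a ^ 2 ^ 2" where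
  "mat22 a b c d = vector [vector [a, b], vector [c, d]]"

lemma mat22_nth [simp]: "mat22 a b c d $ 1 $ 1 = a" "mat22 a b c d $ 1 $ 2 = b"
  "mat22 a b c d $ 2 $ 1 = c" "mat22 a b c d $ 2 $ 2 = d"
  by (simp_all add: mat22_def)

lemma mat22_eq_iff: "A = B \<longleftrightarrow> A $ 1 $ 1 = B $ 1 $ 1 \<and> A $ 1 $ 2 = B $ 1 $ 2 \<and>
    A $ 2 $ 1 = B $ 2 $ 1 \<and> A $ 2 $ 2 = B $ 2 $ 2" for A B :: "'a ^ 2 ^ 2"
  unfolding vec_eq_iff forall_2 by blast

lemma mat22_mult: "mat22 a b c d ** mat22 a' b' c' d' =
    mat22 (a * a' + b * c') (a * b' + b * d') (c * a' + d * c') (c * b' + d * d')"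
  by (simp add: mat22_eq_iff matrix_matrix_mult_def sum_2)

lemma mat22_one: "mat 1 = mat22 1 0 0 1" by (simp add: mat22_eq_iff mat_def)

lemma T_mat_eq: "T_mat = mat22 1 1 0 1" and S_mat_eq: "S_mat = mat22 0 (-1) 1 0"
  by (simp_all add: T_mat_def S_mat_def mat22_def)

lemma det_mat22: "det (mat22 a b c d) = a * d - b * c" by (simp add: det_2)

lemma mat22_cases: obtains a b c d where "A = mat22 a b c d"
  using that[of "A $ 1 $ 1" "A $ 1 $ 2" "A $ 2 $ 1" "A $ 2 $ 2"] by (simp add: mat22_eq_iff)

lemma SL2Z_simps [simp]: "A \<in> carrier SL2Z \<longleftrightarrow> det A = 1" "A \<otimes>\<^bsub>SL2Z\<^esub> B = A ** B" "\<one>\<^bsub>SL2Z\<^esub> = mat 1"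
  by (simp_all add: SL2Z_def)

text \<open>The Euclidean algorithm on the first column: with \<open>q = a div c\<close>, multiplication by \<open>T\<^sup>-\<^sup>q\<close> and then by
  \<open>S\<close> replaces the lower left entry \<open>c\<close> by \<open>a mod c\<close>. When it vanishes, the matrix is \<open>\<plusminus>1\<close> times a power
  of \<open>T\<close>, and \<open>-1 = S\<^sup>2\<close>.\<close>

lemma SL2Z_generated [consumes 1, case_names T S mult inverse]:
  fixes Q :: "int ^ 2 ^ 2 \<Rightarrow> bool"
  assumes A: "det A = 1"
    and T: "Q T_mat" and S: "Q S_mat"
    and mult: "\<And>A B. det A = 1 \<Longrightarrow> det B = 1 \<Longrightarrow> Q A \<Longrightarrow> Q B \<Longrightarrow> Q (A ** B)"
    and inverse: "\<And>A B. det A = 1 \<Longrightarrow> det B = 1 \<Longrightarrow> Q A \<Longrightarrow> A ** B = mat 1 \<Longrightarrow> B ** A = mat 1 \<Longrightarrow> Q B"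
  shows "Q A"
proof -
  have T1: "Q (mat22 1 1 0 1)" and S1: "Q (mat22 0 (-1) 1 0)"
    using T S by (simp_all add: T_mat_eq S_mat_eq)
  have Tm: "Q (mat22 1 (-1) 0 1)"
    by (rule inverse[OF _ _ T1]) (simp_all add: det_mat22 mat22_mult mat22_one)
  have Sm: "Q (mat22 0 1 (-1) 0)"
    by (rule inverse[OF _ _ S1]) (simp_all add: det_mat22 mat22_mult mat22_one)
  have one: "Q (mat22 1 0 0 1)"
    using mult[OF _ _ T1 Tm] by (simp add: det_mat22 mat22_mult)
  have Tn: "Q (mat22 1 n 0 1)" for n
  proof (induction n rule: int_induct[where k = 0])
    case base then show ?case by (rule one)
  next
    case (step1 i) then show ?case 
      using mult[OF _ _ step1(2) T1] by (simp add: det_mat22 mat22_mult add.commute)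
  next
    case (step2 i) then show ?case 
      using mult[OF _ _ step2(2) Tm] by (simp add: det_mat22 mat22_mult)
  qed
  have neg: "Q (mat22 (-1) 0 0 (-1))"
    using mult[OF _ _ S1 S1] by (simp add: det_mat22 mat22_mult)
  have "Q (mat22 a b c d)" if "a * d - b * c = 1" for a b c d
    using that
  proof (induction "nat \<bar>c\<bar>" arbitrary: a b c d rule: less_induct)
    case less
    show ?case
    proof (cases "c = 0")
      case True
      then have "a * d = 1" using less.prems by simp
      then consider "a = 1" "d = 1" | "a = -1" "d = -1" by (auto simp: zmult_eq_1_iff)
      then show ?thesis
      proof cases
        case 1 then show ?thesis using Tn True by simp
      next
        case 2 then show ?thesis 
          using mult[OF _ _ neg Tn[of "-b"]] True by (simp add: det_mat22 mat22_mult)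
      qed
    next
      case False
      define q where "q = a div c"
      have "\<bar>a mod c\<bar> < \<bar>c\<bar>" using False by (simp add: abs_mod_less)
      then have lt: "nat \<bar>a - q * c\<bar> < nat \<bar>c\<bar>" 
        by (simp add: q_def minus_div_mult_eq_mod)
      have "Q (mat22 (- c) (- d) (a - q * c) (b - q * d))"
        by (rule less.hyps[OF lt]) (use less.prems in \<open>simp add: algebra_simps\<close>)
      then have "Q (mat22 0 1 (-1) 0 ** mat22 (- c) (- d) (a - q * c) (b - q * d))"
        by (intro mult[OF _ _ Sm]) (use less.prems in \<open>simp_all add: det_mat22 algebra_simps\<close>)
      then have "Q (mat22 1 q 0 1 ** (mat22 0 1 (-1) 0 ** mat22 (- c) (- d) (a - q * c) (b - q * d)))"
        by (intro mult[OF _ _ Tn]) (use less.prems in \<open>simp_all add: det_mat22 mat22_mult algebra_simps\<close>)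
      then show ?thesis by (simp add: mat22_mult)
    qed
  qed
  then show ?thesis using A by (cases A rule: mat22_cases) (simp add: det_mat22)
qed

lemma SL2Z_inverse:
  assumes "det (A :: int ^ 2 ^ 2) = 1"
  obtains B where "det B = 1" "A ** B = mat 1" "B ** A = mat 1"
proof (cases A rule: mat22_cases)
  case (1 a b c d)
  have "a * d - b * c = 1" using assms by (simp add: 1 det_mat22)
  then show ?thesis
    by (intro that[of "mat22 d (-b) (-c) a"]) (simp_all add: 1 det_mat22 mat22_mult mat22_one algebra_simps)
qed

lemma linear_rep_iff: "linear_rep G (V, \<rho>) \<longleftrightarrow> module ring_of_type_algebra V \<and>
     (\<forall>g\<in>carrier G. module_hom ring_of_type_algebra V V (\<rho> g)) \<and>
     (\<forall>x\<in>carrier V. \<rho> \<one>\<^bsub>G\<^esub> x = x) \<and>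
     (\<forall>g\<in>carrier G. \<forall>h\<in>carrier G. \<forall>x\<in>carrier V. \<rho> (g \<otimes>\<^bsub>G\<^esub> h) x = \<rho> g (\<rho> h x))"
  by (simp add: linear_rep_def)

text \<open>An action with prescribed values at the generators exists, since the action on \<open>W\<close> can be transported
  along the bijection \<open>\<Psi>\<close>; and whichever action is taken, \<open>\<Psi>\<close> is an isomorphism, because the elements
  that it intertwines form a subgroup containing the generators.\<close>

lemma rep_via_generators:
  fixes Z :: "('k::field, 'z) module" and W :: "('k, 'w) module"
  assumes W: "linear_rep SL2Z (W, act)" and Z: "module ring_of_type_algebra Z"
    and hom: "module_hom ring_of_type_algebra Z W \<Psi>"
    and bij: "bij_betw \<Psi> (carrier Z) (carrier W)"
    and T: "\<And>x. x \<in> carrier Z \<Longrightarrow> fT x \<in> carrier Z \<and> \<Psi> (fT x) = act T_mat (\<Psi> x)"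
    and S: "\<And>x. x \<in> carrier Z \<Longrightarrow> fS x \<in> carrier Z \<and> \<Psi> (fS x) = act S_mat (\<Psi> x)"
  shows "\<exists>\<rho>. linear_rep SL2Z (Z, \<rho>) \<and> (\<forall>x\<in>carrier Z. \<rho> T_mat x = fT x) \<and> 
           (\<forall>x\<in>carrier Z. \<rho> S_mat x = fS x)"
    and "linear_rep SL2Z (Z, \<rho>) \<Longrightarrow> \<forall>x\<in>carrier Z. \<rho> T_mat x = fT x \<Longrightarrow>
           \<forall>x\<in>carrier Z. \<rho> S_mat x = fS x \<Longrightarrow> rep_iso SL2Z (Z, \<rho>) (W, act)"
proof -
  interpret Z: module ring_of_type_algebra Z by fact
  define \<Phi> where "\<Phi> = inv_into (carrier Z) \<Psi>"
  have \<Phi>\<Psi>: "\<Phi> (\<Psi> x) = x" if "x \<in> carrier Z" for x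
    using bij_betw_inv_into_left[OF bij that] by (simp add: \<Phi>_def)
  have \<Psi>\<Phi>: "\<Psi> (\<Phi> y) = y" if "y \<in> carrier W" for y
    using bij_betw_inv_into_right[OF bij that] by (simp add: \<Phi>_def)
  have \<Psi>c: "\<Psi> x \<in> carrier W" if "x \<in> carrier Z" for x using bij bij_betwE that by blast
  have \<Phi>c: "\<Phi> y \<in> carrier Z" if "y \<in> carrier W" for y
    using bij_betw_inv_into[OF bij] bij_betwE that unfolding \<Phi>_def by blast
  have inj: "x = y" if "\<Psi> x = \<Psi> y" "x \<in> carrier Z" "y \<in> carrier Z" for x y
    using bij that by (auto simp: bij_betw_def dest: inj_onD)
  have W1: "module_hom ring_of_type_algebra W W (act g)" if "det g = 1" for g
    using W that by (simp add: linear_rep_iff)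
  have W2: "act (mat 1) x = x" if "x \<in> carrier W" for x
    using W that by (simp add: linear_rep_iff)
  have W3: "act (g ** h) x = act g (act h x)" if "det g = 1" "det h = 1" "x \<in> carrier W" for g h x
    using W that by (simp add: linear_rep_iff)
  have Wc: "act g x \<in> carrier W" if "det g = 1" "x \<in> carrier W" for g x
    using module_hom_closed[OF W1] that by blast
  have dT: "det T_mat = 1" and dS: "det S_mat = 1" by (simp_all add: T_mat_eq S_mat_eq det_mat22)
  define r where "r = (\<lambda>g x. \<Phi> (act g (\<Psi> x)))"
  have rc: "r g x \<in> carrier Z" "\<Psi> (r g x) = act g (\<Psi> x)" if "det g = 1" "x \<in> carrier Z" for g x
    using that by (simp_all add: r_def \<Psi>c \<Phi>c Wc \<Psi>\<Phi>)
  have "linear_rep SL2Z (Z, r)"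
    unfolding linear_rep_iff SL2Z_simps
  proof (intro conjI ballI Z)
    fix g :: "int ^ 2 ^ 2" assume "g \<in> carrier SL2Z"
    then have g: "det g = 1" by simp
    show "module_hom ring_of_type_algebra Z Z (r g)"
      unfolding module_hom_def
    proof (intro conjI ballI)
      show "r g \<in> carrier Z \<rightarrow> carrier Z" using rc(1)[OF g] by blast
      show "r g (x \<oplus>\<^bsub>Z\<^esub> y) = r g x \<oplus>\<^bsub>Z\<^esub> r g y" if "x \<in> carrier Z" "y \<in> carrier Z" for x y
        using that by (intro inj)
          (simp_all add: rc[OF g] module_hom_add[OF hom] module_hom_add[OF W1[OF g]] \<Psi>c)
      show "r g (k \<odot>\<^bsub>Z\<^esub> x) = k \<odot>\<^bsub>Z\<^esub> r g x" if "k \<in> carrier ring_of_type_algebra" "x \<in> carrier Z" for k x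
        using that by (intro inj)
          (simp_all add: rc[OF g] module_hom_smult[OF hom] module_hom_smult[OF W1[OF g]] \<Psi>c
            Z.smult_closed)
    qed
  next
    show "r (mat 1) x = x" if "x \<in> carrier Z" for x using that by (simp add: r_def W2 \<Psi>c \<Phi>\<Psi>)
  next
    fix g h x assume "g \<in> carrier SL2Z" "h \<in> carrier SL2Z" and x: "x \<in> carrier Z"
    then have gh: "det g = 1" "det h = 1" by simp_all
    then have "det (g ** h) = 1" by (simp add: det_mul)
    then show "r (g ** h) x = r g (r h x)"
      by (intro inj) (simp_all add: rc gh x W3 \<Psi>c)
  qed
  moreover have "r T_mat x = fT x" "r S_mat x = fS x" if "x \<in> carrier Z" for x
    using T[OF that] S[OF that] \<Phi>\<Psi>[of "fT x"] \<Phi>\<Psi>[of "fS x"] by (simp_all add: r_def)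
  ultimately show "\<exists>\<rho>. linear_rep SL2Z (Z, \<rho>) \<and> (\<forall>x\<in>carrier Z. \<rho> T_mat x = fT x) \<and> 
           (\<forall>x\<in>carrier Z. \<rho> S_mat x = fS x)" by blast

  assume \<rho>: "linear_rep SL2Z (Z, \<rho>)" and \<rho>T: "\<forall>x\<in>carrier Z. \<rho> T_mat x = fT x"
    and \<rho>S: "\<forall>x\<in>carrier Z. \<rho> S_mat x = fS x"
  have \<rho>c: "\<rho> g x \<in> carrier Z" if "det g = 1" "x \<in> carrier Z" for g x
    using \<rho> that by (auto simp: linear_rep_iff module_hom_def)
  have \<rho>m: "\<rho> (g ** h) x = \<rho> g (\<rho> h x)" if "det g = 1" "det h = 1" "x \<in> carrier Z" for g h x
    using \<rho> that by (simp add: linear_rep_iff)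
  have \<rho>1: "\<rho> (mat 1) x = x" if "x \<in> carrier Z" for x
    using \<rho> that by (simp add: linear_rep_iff)
  have "\<forall>x\<in>carrier Z. \<Psi> (\<rho> g x) = act g (\<Psi> x)" if "det g = 1" for g
    using that
  proof (induction g rule: SL2Z_generated)
    case (mult g h)
    then show ?case by (simp add: \<rho>m \<rho>c W3 \<Psi>c)
  next
    case (inverse g h)
    note hg = \<open>h ** g = mat 1\<close>
    show ?case
    proof
      fix x assume x: "x \<in> carrier Z"
      have "\<Psi> (\<rho> h x) = act (h ** g) (\<Psi> (\<rho> h x))"
        using inverse x by (simp add: hg W2 \<Psi>c \<rho>c)
      also have "\<dots> = act h (act g (\<Psi> (\<rho> h x)))"
        by (rule W3) (use inverse x in \<open>simp_all add: \<Psi>c \<rho>c\<close>)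
      also have "\<dots> = act h (\<Psi> (\<rho> g (\<rho> h x)))"
        using inverse x by (simp add: \<rho>c)
      also have "\<rho> g (\<rho> h x) = x" using inverse x \<rho>m[of g h x] by (simp add: \<rho>1)
      finally show "\<Psi> (\<rho> h x) = act h (\<Psi> x)" .
    qed
  qed (use T S \<rho>T \<rho>S in simp_all)
  then show "rep_iso SL2Z (Z, \<rho>) (W, act)"
    using W \<rho> hom bij by (auto simp: rep_iso_def)
qed

section \<open>Permutation representations\<close>

lemma span_on_simps [simp]:
  "f \<oplus>\<^bsub>span_on I\<^esub> g = (\<lambda>x. f x + g x)" "k \<odot>\<^bsub>span_on I\<^esub> f = (\<lambda>x. k * f x)"
  "\<zero>\<^bsub>span_on I\<^esub> = (\<lambda>_. 0)"
  by (simp_all add: span_on_def)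

lemma span_on_carrier: "finite I \<Longrightarrow> f \<in> carrier (span_on I) \<longleftrightarrow> (\<forall>x. x \<notin> I \<longrightarrow> f x = 0)"
  by (auto simp: span_on_def intro: finite_subset[of _ I])

lemma lin_ext_eq:
  assumes "finite I" "\<And>x. x \<notin> I \<Longrightarrow> f x = 0"
  shows "lin_ext w f y = (\<Sum>x\<in>I. f x * w x y)"
  unfolding lin_ext_def by (rule sum.mono_neutral_left) (use assms in auto)

text \<open>Covers subspaces of \<open>span_on\<close> as well, since only closure of the carrier is required.\<close>

lemma vector_space_span_on:
  fixes V :: "('k::field, 'x \<Rightarrow> 'k) module"
  assumes V: "add V = (\<lambda>f g x. f x + g x)" "module.smult V = (\<lambda>k f x. k * f x)" "ring.zero V = (\<lambda>_. 0)"
    and zero: "(\<lambda>_. 0) \<in> carrier V"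
    and add: "\<And>f g. f \<in> carrier V \<Longrightarrow> g \<in> carrier V \<Longrightarrow> (\<lambda>x. f x + g x) \<in> carrier V"
    and smult: "\<And>k f. f \<in> carrier V \<Longrightarrow> (\<lambda>x. k * f x) \<in> carrier V"
  shows "module ring_of_type_algebra V"
proof -
  have "abelian_group V"
  proof (rule abelian_groupI)
    show "\<exists>g\<in>carrier V. g \<oplus>\<^bsub>V\<^esub> f = \<zero>\<^bsub>V\<^esub>" if "f \<in> carrier V" for f
      using smult[OF that, of "-1"] by (intro bexI[of _ "\<lambda>x. -1 * f x"]) (auto simp: V)
  qed (use zero add in \<open>auto simp: V add.assoc add.commute\<close>)
  then show ?thesis
    by (intro module.intro module_axioms.intro cring_from_type_algebra)
      (use smult in \<open>auto simp: V algebra_simps\<close>)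
qed

lemma module_span_on: "module ring_of_type_algebra (span_on I :: ('k::field, 'x \<Rightarrow> 'k) module)"
proof (rule vector_space_span_on)
  fix f g :: "'x \<Rightarrow> 'k" assume fg: "f \<in> carrier (span_on I)" "g \<in> carrier (span_on I)"
  have "{x. f x + g x \<noteq> 0} \<subseteq> {x. f x \<noteq> 0} \<union> {x. g x \<noteq> 0}" by auto
  then show "(\<lambda>x. f x + g x) \<in> carrier (span_on I)"
    using fg by (auto simp: span_on_def intro: finite_subset)
next
  fix k and f :: "'x \<Rightarrow> 'k" assume f: "f \<in> carrier (span_on I)"
  have "{x. k * f x \<noteq> 0} \<subseteq> {x. f x \<noteq> 0}" by auto
  then show "(\<lambda>x. k * f x) \<in> carrier (span_on I)"
    using f by (auto simp: span_on_def intro: finite_subset)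
qed (auto simp: span_on_def)

text \<open>Permuting basis vectors by \<open>p\<close> amounts to composing coefficient functions with the inverse \<open>p'\<close>.\<close>

lemma lin_ext_bij:
  assumes I: "finite I" and f: "\<And>x. x \<notin> I \<Longrightarrow> f x = 0" and y: "y \<in> I"
    and p: "\<And>x. x \<in> I \<Longrightarrow> p' (p x) = x" "p' y \<in> I" "p (p' y) = y"
  shows "lin_ext (\<lambda>x. basis_vec (p x)) f y = f (p' y)"
proof -
  have "f x * basis_vec (p x) y = (if x = p' y then f x else 0)" if "x \<in> I" for x
    using p(1)[OF that] p(3) by (auto simp: basis_vec_def)
  then show ?thesis using I p(2) by (simp add: lin_ext_eq[OF I f])
qed

lemma lin_ext_basis_outside:
  assumes I: "finite I" and f: "\<And>x. x \<notin> I \<Longrightarrow> f x = 0" and p: "\<And>x. x \<in> I \<Longrightarrow> p x \<in> I" and y: "y \<notin> I"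
  shows "lin_ext (\<lambda>x. basis_vec (p x)) f y = 0"
proof -
  have "(\<Sum>x\<in>I. f x * basis_vec (p x) y) = 0"
    by (rule sum.neutral) (use p y in \<open>auto simp: basis_vec_def\<close>)
  then show ?thesis by (simp add: lin_ext_eq[OF I f])
qed

text \<open>Stated for an invariant subspace \<open>V\<close> of the permutation module, so that it also applies to the twisted
  module.\<close>

lemma linear_rep_span_on:
  fixes V :: "('k::field, 'x \<Rightarrow> 'k) module"
  assumes I: "finite I" and V: "module ring_of_type_algebra V"
    "add V = (\<lambda>f g x. f x + g x)" "module.smult V = (\<lambda>k f x. k * f x)"
    and sub: "carrier V \<subseteq> carrier (span_on I)"
    and inv: "\<And>g f. g \<in> carrier G \<Longrightarrow> f \<in> carrier V \<Longrightarrow> lin_ext (\<lambda>x. basis_vec (act g x)) f \<in> carrier V"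
    and act: "\<And>g x. g \<in> carrier G \<Longrightarrow> x \<in> I \<Longrightarrow> act g x \<in> I"
     "\<And>x. x \<in> I \<Longrightarrow> act \<one>\<^bsub>G\<^esub> x = x"
     "\<And>g h x. g \<in> carrier G \<Longrightarrow> h \<in> carrier G \<Longrightarrow> x \<in> I \<Longrightarrow> act (g \<otimes>\<^bsub>G\<^esub> h) x = act g (act h x)"
  shows "linear_rep G (V, \<lambda>g. lin_ext (\<lambda>x. basis_vec (act g x)))"
proof -
  have z: "f x = 0" if "f \<in> carrier V" "x \<notin> I" for f x using sub that span_on_carrier[OF I] by blast
  have le: "lin_ext (\<lambda>x. basis_vec (p x)) f y = (\<Sum>x\<in>I. f x * basis_vec (p x) y)" 
    if "f \<in> carrier V" for f p and y :: 'x
    by (rule lin_ext_eq[OF I z[OF that]])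
  show ?thesis
    unfolding linear_rep_iff
  proof (intro conjI ballI V(1))
    fix g assume g: "g \<in> carrier G"
    interpret module ring_of_type_algebra V by fact
    show "module_hom ring_of_type_algebra V V (lin_ext (\<lambda>x. basis_vec (act g x)))"
      unfolding module_hom_def
    proof (intro conjI ballI ext)
      fix f f' y assume "f \<in> carrier V" "f' \<in> carrier V"
      moreover from this have "f \<oplus>\<^bsub>V\<^esub> f' \<in> carrier V" by simp
      ultimately show "lin_ext (\<lambda>x. basis_vec (act g x)) (f \<oplus>\<^bsub>V\<^esub> f') y = 
         (lin_ext (\<lambda>x. basis_vec (act g x)) f \<oplus>\<^bsub>V\<^esub> lin_ext (\<lambda>x. basis_vec (act g x)) f') y"
        by (simp add: V(2) le) (simp add: V(2) le ring_distribs sum.distrib)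
    next
      fix k f y assume "f \<in> carrier V"
      moreover from this have "k \<odot>\<^bsub>V\<^esub> f \<in> carrier V" by simp
      ultimately show "lin_ext (\<lambda>x. basis_vec (act g x)) (k \<odot>\<^bsub>V\<^esub> f) y = 
         (k \<odot>\<^bsub>V\<^esub> lin_ext (\<lambda>x. basis_vec (act g x)) f) y"
        by (simp add: V(3) le) (simp add: V(3) le sum_distrib_left mult.assoc)
    qed (use inv[OF g] in blast)
  next
    fix f assume f: "f \<in> carrier V"
    show "lin_ext (\<lambda>x. basis_vec (act \<one>\<^bsub>G\<^esub> x)) f = f"
    proof
      fix y show "lin_ext (\<lambda>x. basis_vec (act \<one>\<^bsub>G\<^esub> x)) f y = f y"
      proof (cases "y \<in> I")
        case True then show ?thesis
          using lin_ext_bij[OF I z[OF f] True, of "\<lambda>x. x" "act \<one>\<^bsub>G\<^esub>"] act(2) by simp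
      next
        case False
        have "lin_ext (\<lambda>x. basis_vec (act \<one>\<^bsub>G\<^esub> x)) f y = 0"
          by (rule lin_ext_basis_outside[OF I]) (use z[OF f] act(2) False in simp_all)
        then show ?thesis using z[OF f False] by simp
      qed
    qed
  next
    fix g h f assume g: "g \<in> carrier G" and h: "h \<in> carrier G" and f: "f \<in> carrier V"
    show "lin_ext (\<lambda>x. basis_vec (act (g \<otimes>\<^bsub>G\<^esub> h) x)) f =
      lin_ext (\<lambda>x. basis_vec (act g x)) (lin_ext (\<lambda>x. basis_vec (act h x)) f)"
    proof
      fix y
      have "lin_ext (\<lambda>x. basis_vec (act g x)) (lin_ext (\<lambda>x. basis_vec (act h x)) f) y
         = (\<Sum>z\<in>I. (\<Sum>x\<in>I. f x * basis_vec (act h x) z) * basis_vec (act g z) y)"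
        by (simp add: le[OF inv[OF h f]] le[OF f])
      also have "\<dots> = (\<Sum>z\<in>I. \<Sum>x\<in>I. f x * (basis_vec (act h x) z * basis_vec (act g z) y))"
        by (simp add: sum_distrib_right mult.assoc)
      also have "\<dots> = (\<Sum>x\<in>I. \<Sum>z\<in>I. f x * (basis_vec (act h x) z * basis_vec (act g z) y))"
        by (rule sum.swap)
      also have "\<dots> = (\<Sum>x\<in>I. f x * basis_vec (act g (act h x)) y)"
      proof (rule sum.cong[OF refl])
        fix x assume x: "x \<in> I"
        have "f x * (basis_vec (act h x) z * basis_vec (act g z) y) = 
           (if z = act h x then f x * basis_vec (act g (act h x)) y else 0)" for z
          by (simp add: basis_vec_def)
        then show "(\<Sum>z\<in>I. f x * (basis_vec (act h x) z * basis_vec (act g z) y)) =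
            f x * basis_vec (act g (act h x)) y"
          using act(1)[OF h x] I by simp
      qed
      also have "\<dots> = lin_ext (\<lambda>x. basis_vec (act (g \<otimes>\<^bsub>G\<^esub> h) x)) f y"
        by (simp add: le[OF f] act(3)[OF g h])
      finally show "lin_ext (\<lambda>x. basis_vec (act (g \<otimes>\<^bsub>G\<^esub> h) x)) f y = 
        lin_ext (\<lambda>x. basis_vec (act g x)) (lin_ext (\<lambda>x. basis_vec (act h x)) f) y" by simp
    qed
  qed
qed

lemma linear_rep_perm_rep:
  assumes I: "finite I"
    and act: "\<And>g x. g \<in> carrier G \<Longrightarrow> x \<in> I \<Longrightarrow> act g x \<in> I"
     "\<And>x. x \<in> I \<Longrightarrow> act \<one>\<^bsub>G\<^esub> x = x"
     "\<And>g h x. g \<in> carrier G \<Longrightarrow> h \<in> carrier G \<Longrightarrow> x \<in> I \<Longrightarrow> act (g \<otimes>\<^bsub>G\<^esub> h) x = act g (act h x)"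
  shows "linear_rep G (perm_rep act I :: ('g, 'k::field, 'x \<Rightarrow> 'k) rep)"
  unfolding perm_rep_def
proof (rule linear_rep_span_on[OF I module_span_on _ _ subset_refl _ act])
  fix g and f :: "'x \<Rightarrow> 'k" assume g: "g \<in> carrier G" and f: "f \<in> carrier (span_on I)"
  then have "f x = 0" if "x \<notin> I" for x using that by (simp add: span_on_carrier[OF I])
  then have "lin_ext (\<lambda>x. basis_vec (act g x)) f y = 0" if "y \<notin> I" for y
    by (rule lin_ext_basis_outside[OF I]) (use act(1)[OF g] that in simp_all)
  then show "lin_ext (\<lambda>x. basis_vec (act g x)) f \<in> carrier (span_on I)"
    by (simp add: span_on_carrier[OF I])
qed (simp_all add: span_on_def)

lemma linear_rep_trivial: "linear_rep G trivial_rep"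
proof -
  have "abelian_group \<lparr> carrier = UNIV, monoid.mult = undefined, one = undefined,
       ring.zero = (0 :: 'k::field), add = (+), module.smult = ((*) :: 'k \<Rightarrow> 'k \<Rightarrow> 'k) \<rparr>" (is "abelian_group ?V")
    by (rule abelian_groupI) (auto simp: algebra_simps intro: exI[of _ "- x" for x])
  then have "module ring_of_type_algebra ?V"
    by (intro module.intro module_axioms.intro cring_from_type_algebra) (auto simp: algebra_simps)
  then show ?thesis by (simp add: trivial_rep_def linear_rep_iff module_hom_def)
qed

lemma linear_rep_sum:
  fixes V :: "('g, 'k::field, 'v) rep" and W :: "('g, 'k, 'w) rep"
  assumes V: "linear_rep G V" and W: "linear_rep G W"
  shows "linear_rep G (V \<oplus>\<^sub>r W)"
proof -
  obtain V' \<rho> where V': "V = (V', \<rho>)" by (cases V)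
  obtain W' act where W': "W = (W', act)" by (cases W)
  interpret V: module ring_of_type_algebra V' using V by (simp add: V' linear_rep_iff)
  interpret W: module ring_of_type_algebra W' using W by (simp add: W' linear_rep_iff)
  let ?S = "fst ((V', \<rho>) \<oplus>\<^sub>r (W', act))"
  have g: "abelian_group ?S"
  proof (rule abelian_groupI)
    fix z assume "z \<in> carrier ?S"
    then show "\<exists>z'\<in>carrier ?S. z' \<oplus>\<^bsub>?S\<^esub> z = \<zero>\<^bsub>?S\<^esub>"
      by (intro bexI[of _ "(\<ominus>\<^bsub>V'\<^esub> fst z, \<ominus>\<^bsub>W'\<^esub> snd z)"]) 
        (auto simp: rep_sum_def V.l_neg W.l_neg)
  qed (auto simp: rep_sum_def V.a_ac W.a_ac)
  have "module ring_of_type_algebra ?S"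
    using V.smult_closed W.smult_closed V.smult_l_distr W.smult_l_distr V.smult_r_distr W.smult_r_distr
      V.smult_assoc1 W.smult_assoc1 V.smult_one W.smult_one g
    by (intro module.intro module_axioms.intro V.cring_axioms) (auto simp: rep_sum_def)
  then show ?thesis
    using V W unfolding V' W' by (auto simp: rep_sum_def linear_rep_iff module_hom_def Pi_iff)
qed

section \<open>The Drinfel'd double of a finite group\<close>

locale finite_group = group G for G :: "'a monoid" (structure) +
  assumes fin [simp]: "finite (carrier G)"
begin

lemma inv_cancel1 [simp]: "x \<in> carrier G \<Longrightarrow> z \<in> carrier G \<Longrightarrow> inv x \<otimes> (x \<otimes> z) = z"
  by (simp flip: m_assoc)

lemma inv_cancel2 [simp]: "x \<in> carrier G \<Longrightarrow> z \<in> carrier G \<Longrightarrow> x \<otimes> (inv x \<otimes> z) = z"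
  by (simp flip: m_assoc)

lemmas grp = m_assoc inv_mult_group

text \<open>Conjugation by the inverse of \<open>k\<close>, as it appears when group elements act on coefficient functions.
  The basis vector \<open>u(x, y)\<close> of \<open>L\<close> lies in the component of \<open>grading x y\<close>, that is, this is the element
  \<open>h\<close> for which \<open>\<delta>\<^sub>h\<close> fixes it.\<close>

definition conj_by where "conj_by k x = inv k \<otimes> x \<otimes> k"
definition grading where "grading x y = inv y \<otimes> x \<otimes> y \<otimes> inv x"

lemma conj_by_closed [simp]: "k \<in> carrier G \<Longrightarrow> x \<in> carrier G \<Longrightarrow> conj_by k x \<in> carrier G"
  by (simp add: conj_by_def)
lemma grading_closed [simp]: "y \<in> carrier G \<Longrightarrow> x \<in> carrier G \<Longrightarrow> grading x y \<in> carrier G"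
  by (simp add: grading_def)
lemma grading_conj_by: "k \<in> carrier G \<Longrightarrow> x \<in> carrier G \<Longrightarrow> y \<in> carrier G \<Longrightarrow> grading (conj_by k x) (conj_by k y) = conj_by k (grading x y)"
  by (simp add: conj_by_def grading_def grp)
lemma conj_by_mult: "k \<in> carrier G \<Longrightarrow> l \<in> carrier G \<Longrightarrow> x \<in> carrier G \<Longrightarrow> conj_by (k \<otimes> l) x = conj_by l (conj_by k x)"
  by (simp add: conj_by_def grp)
lemma conj_by_one [simp]: "x \<in> carrier G \<Longrightarrow> conj_by \<one> x = x"
  by (simp add: conj_by_def)

lemma conj_by_hom: "k \<in> carrier G \<Longrightarrow> x \<in> carrier G \<Longrightarrow> y \<in> carrier G \<Longrightarrow> conj_by k (x \<otimes> y) = conj_by k x \<otimes> conj_by k y"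
  by (simp add: conj_by_def grp)
lemma conj_by_inv: "k \<in> carrier G \<Longrightarrow> x \<in> carrier G \<Longrightarrow> conj_by k (inv x) = inv (conj_by k x)"
  by (simp add: conj_by_def grp)

lemma conj_by_of_one [simp]: "k \<in> carrier G \<Longrightarrow> conj_by k \<one> = \<one>"
  by (simp add: conj_by_def)

lemma conj_by_eq_one_iff: "k \<in> carrier G \<Longrightarrow> x \<in> carrier G \<Longrightarrow> conj_by k x = \<one> \<longleftrightarrow> x = \<one>"
  by (metis conj_by_mult conj_by_of_one conj_by_one inv_closed r_inv)

text \<open>This is why commuting pairs appear: they span the component at the unit.\<close>

lemma grading_eq_one_iff: 
  assumes "x \<in> carrier G" "y \<in> carrier G" shows "grading x y = \<one> \<longleftrightarrow> x \<otimes> y = y \<otimes> x"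
proof -
  have "grading x y = inv y \<otimes> (x \<otimes> y) \<otimes> inv x" using assms by (simp add: grading_def grp)
  also have "\<dots> = \<one> \<longleftrightarrow> inv y \<otimes> (x \<otimes> y) = x"
    using assms inv_solve_right[of \<one> "inv y \<otimes> (x \<otimes> y)" x] by auto
  also have "\<dots> \<longleftrightarrow> x \<otimes> y = y \<otimes> x"
    using assms inv_solve_left[of x y "x \<otimes> y"] by auto
  finally show ?thesis .
qed

abbreviation D :: "('k::field, 'a \<times> 'a \<Rightarrow> 'k) module" where "D \<equiv> drinfeld_double G"
abbreviation L :: "('a \<times> 'a \<Rightarrow> 'k::field, 'a \<times> 'a \<Rightarrow> 'k) module" where "L \<equiv> dual_double G"

lemma finite_pairs [simp]: "finite (carrier G \<times> carrier G)" by simp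

lemma D_carrier: "f \<in> carrier D \<longleftrightarrow> (\<forall>x. x \<notin> carrier G \<times> carrier G \<longrightarrow> f x = 0)"
  by (simp add: drinfeld_double_def span_on_carrier)
lemma L_carrier: "f \<in> carrier L \<longleftrightarrow> (\<forall>x. x \<notin> carrier G \<times> carrier G \<longrightarrow> f x = 0)"
  by (simp add: dual_double_def span_on_carrier)

lemma D_memI: "(\<And>x y. x \<notin> carrier G \<or> y \<notin> carrier G \<Longrightarrow> f (x, y) = 0) \<Longrightarrow> f \<in> carrier D"
  unfolding D_carrier by auto
lemma L_memI: "(\<And>x y. x \<notin> carrier G \<or> y \<notin> carrier G \<Longrightarrow> f (x, y) = 0) \<Longrightarrow> f \<in> carrier L"
  unfolding L_carrier by auto
lemma L_zero: "f \<in> carrier L \<Longrightarrow> x \<notin> carrier G \<or> y \<notin> carrier G \<Longrightarrow> f (x, y) = 0"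
  unfolding L_carrier by auto
lemma D_zero: "f \<in> carrier D \<Longrightarrow> x \<notin> carrier G \<or> y \<notin> carrier G \<Longrightarrow> f (x, y) = 0"
  unfolding D_carrier by auto

lemma D_ops [simp]: "f \<oplus>\<^bsub>D\<^esub> g = (\<lambda>x. f x + g x)" "c \<odot>\<^bsub>D\<^esub> f = (\<lambda>x. c * f x)" "\<zero>\<^bsub>D\<^esub> = (\<lambda>_. 0)"
  by (simp_all add: drinfeld_double_def)
lemma L_ops [simp]: "\<phi> \<oplus>\<^bsub>L\<^esub> \<psi> = (\<lambda>x. \<phi> x + \<psi> x)" "\<zero>\<^bsub>L\<^esub> = (\<lambda>_. 0)"
  by (simp_all add: dual_double_def)

lemma lin_ext_pairs:
  assumes "f \<in> carrier D \<or> f \<in> carrier L"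
  shows "lin_ext w f z = (\<Sum>a\<in>carrier G. \<Sum>b\<in>carrier G. f (a, b) * w (a, b) z)"
proof -
  have "lin_ext w f z = (\<Sum>p\<in>carrier G \<times> carrier G. f p * w p z)"
    by (rule lin_ext_eq) (use assms in \<open>auto simp: D_carrier L_carrier\<close>)
  then show ?thesis by (simp add: sum.cartesian_product case_prod_unfold)
qed

text \<open>The product on coefficients: \<open>(\<delta>\<^sub>a \<otimes> b)(\<delta>\<^sub>c \<otimes> d)\<close> contributes to \<open>\<delta>\<^sub>x \<otimes> y\<close> only if \<open>a = x\<close>, \<open>d\<close> is determined by
  \<open>b d = y\<close>, and \<open>c\<close> is the conjugate of \<open>x\<close>.\<close>

lemma D_mult:
  assumes f: "f \<in> carrier D" and g: "g \<in> carrier D"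
  shows "(f \<otimes>\<^bsub>D\<^esub> g) (x, y) = (if x \<in> carrier G \<and> y \<in> carrier G
     then \<Sum>b\<in>carrier G. f (x, b) * g (conj_by b x, inv b \<otimes> y) else 0)"
proof -
  define w where "w = (\<lambda>a b c d. if a = b \<otimes> c \<otimes> inv b then basis_vec (a, b \<otimes> d) else (\<lambda>_. 0 :: 'b))"
  have inner: "lin_ext (\<lambda>(c, d). w a b c d) g (x, y) = 
      (if x = a \<and> y \<in> carrier G then g (conj_by b x, inv b \<otimes> y) else 0)"
    if ab: "a \<in> carrier G" "b \<in> carrier G" for a b
  proof -
    have "g (c, d) * w a b c d (x, y) =
        (if c = conj_by b a then (if d = inv b \<otimes> y then (if x = a \<and> y \<in> carrier G then g (c, d) else 0) else 0) else 0)"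
      if "c \<in> carrier G" "d \<in> carrier G" for c d
    proof -
      have "a = b \<otimes> c \<otimes> inv b \<longleftrightarrow> c = conj_by b a"
        using ab that by (auto simp: conj_by_def grp)
      moreover have "y = b \<otimes> d \<longleftrightarrow> y \<in> carrier G \<and> d = inv b \<otimes> y"
        using ab that by auto
      ultimately show ?thesis by (auto simp: w_def basis_vec_def)
    qed
    then have "lin_ext (\<lambda>(c, d). w a b c d) g (x, y) = 
      (\<Sum>c\<in>carrier G. \<Sum>d\<in>carrier G. 
        (if c = conj_by b a then (if d = inv b \<otimes> y then (if x = a \<and> y \<in> carrier G then g (c, d) else 0) else 0) else 0))"
      using g by (simp add: lin_ext_pairs)
    also have "\<dots> = (\<Sum>c\<in>carrier G. (if c = conj_by b a then (\<Sum>d\<in>carrier G. (if d = inv b \<otimes> y then (if x = a \<and> y \<in> carrier G then g (c, d) else 0) else 0)) else 0))"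
      by (rule sum.cong) auto
    also have "\<dots> = (if x = a \<and> y \<in> carrier G then g (conj_by b x, inv b \<otimes> y) else 0)"
      using ab by (auto simp: sum.delta)
    finally show ?thesis .
  qed
  have "(f \<otimes>\<^bsub>D\<^esub> g) (x, y) = lin_ext (\<lambda>(a, b). lin_ext (\<lambda>(c, d). w a b c d) g) f (x, y)"
    by (simp add: drinfeld_double_def w_def)
  also have "\<dots> = (\<Sum>a\<in>carrier G. \<Sum>b\<in>carrier G. f (a, b) * (if x = a \<and> y \<in> carrier G then g (conj_by b x, inv b \<otimes> y) else 0))"
    using f inner by (simp add: lin_ext_pairs)
  also have "\<dots> = (\<Sum>a\<in>carrier G. if a = x then (\<Sum>b\<in>carrier G. f (a, b) * (if y \<in> carrier G then g (conj_by b x, inv b \<otimes> y) else 0)) else 0)"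
    by (rule sum.cong) auto
  finally show ?thesis by (simp add: sum.delta)
qed

lemma lin_ext_pairs_bij:
  fixes \<phi> :: "'a \<times> 'a \<Rightarrow> 'k::field"
  assumes \<phi>: "\<phi> \<in> carrier L"
    and p: "\<And>z. z \<in> carrier G \<times> carrier G \<Longrightarrow> p z \<in> carrier G \<times> carrier G"
      "\<And>z. z \<in> carrier G \<times> carrier G \<Longrightarrow> q (p z) = z"
    and q: "\<And>z. z \<in> carrier G \<times> carrier G \<Longrightarrow> q z \<in> carrier G \<times> carrier G"
      "\<And>z. z \<in> carrier G \<times> carrier G \<Longrightarrow> p (q z) = z"
  shows "lin_ext (\<lambda>z. basis_vec (p z)) \<phi> z = (if z \<in> carrier G \<times> carrier G then \<phi> (q z) else 0)"
proof -
  have z: "\<phi> z = 0" if "z \<notin> carrier G \<times> carrier G" for z using \<phi> that L_carrier by blast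
  show ?thesis
  proof (cases "z \<in> carrier G \<times> carrier G")
    case True
    have "lin_ext (\<lambda>z. basis_vec (p z)) \<phi> z = \<phi> (q z)"
      by (rule lin_ext_bij[OF finite_pairs z True]) (use True p(2) q in simp_all)
    then show ?thesis using True by simp
  next
    case False
    then show ?thesis using lin_ext_basis_outside[OF finite_pairs z p(1) False] by simp
  qed
qed

lemma coadjoint_group_eq:
  assumes \<phi>: "\<phi> \<in> carrier L" and k: "k \<in> carrier G"
  shows "coadjoint_group G k \<phi> (x, y) = (if x \<in> carrier G \<and> y \<in> carrier G then \<phi> (conj_by k x, conj_by k y) else 0)"
proof -
  let ?p = "\<lambda>(a, b). (k \<otimes> a \<otimes> inv k, k \<otimes> b \<otimes> inv k)" and ?q = "\<lambda>(a, b). (conj_by k a, conj_by k b)"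
  have "lin_ext (\<lambda>z. basis_vec (?p z)) \<phi> (x, y) = 
      (if (x, y) \<in> carrier G \<times> carrier G then \<phi> (?q (x, y)) else 0)"
    by (rule lin_ext_pairs_bij[OF \<phi>]) (use k in \<open>auto simp: conj_by_def grp\<close>)
  then show ?thesis unfolding coadjoint_group_def by (simp add: case_prod_unfold)
qed

lemma coadjoint_group_closed:
  "\<phi> \<in> carrier L \<Longrightarrow> k \<in> carrier G \<Longrightarrow> coadjoint_group G k \<phi> \<in> carrier L"
  by (rule L_memI) (simp add: coadjoint_group_eq, blast)

lemma coadjoint_delta_eq:
  assumes \<phi>: "\<phi> \<in> carrier L"
  shows "coadjoint_delta G h \<phi> (x, y) = 
    (if x \<in> carrier G \<and> y \<in> carrier G \<and> h = grading x y then \<phi> (x, y) else 0)"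
proof -
  have "\<phi> (a, b) * (if h = grading a b then basis_vec (a, b) else (\<lambda>_. 0)) (x, y) =
     (if a = x then (if b = y then (if h = grading x y then \<phi> (x, y) else 0) else 0) else 0)" for a b
    by (cases "a = x"; cases "b = y"; cases "h = grading a b") (simp_all add: basis_vec_def)
  then have "coadjoint_delta G h \<phi> (x, y) = (\<Sum>a\<in>carrier G. \<Sum>b\<in>carrier G. 
     (if a = x then (if b = y then (if h = grading x y then \<phi> (x, y) else 0) else 0) else 0))"
    unfolding coadjoint_delta_def using \<phi> by (simp add: lin_ext_pairs grading_def)
  also have "\<dots> = (\<Sum>a\<in>carrier G. (if a = x then (\<Sum>b\<in>carrier G. 
     (if b = y then (if h = grading x y then \<phi> (x, y) else 0) else 0)) else 0))"
    by (rule sum.cong) auto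
  also have "\<dots> = (if x \<in> carrier G \<and> y \<in> carrier G \<and> h = grading x y then \<phi> (x, y) else 0)"
    by (auto simp: sum.delta)
  finally show ?thesis .
qed

lemma L_smult:
  assumes f: "f \<in> carrier D" and \<phi>: "\<phi> \<in> carrier L"
  shows "(f \<odot>\<^bsub>L\<^esub> \<phi>) (x, y) = (if x \<in> carrier G \<and> y \<in> carrier G
     then \<Sum>k\<in>carrier G. f (grading x y, k) * \<phi> (conj_by k x, conj_by k y) else 0)"
proof -
  have "(f \<odot>\<^bsub>L\<^esub> \<phi>) (x, y) = lin_ext (\<lambda>(h, k). coadjoint_delta G h (coadjoint_group G k \<phi>)) f (x, y)"
    by (simp add: dual_double_def)
  also have "\<dots> = (\<Sum>h\<in>carrier G. \<Sum>k\<in>carrier G. f (h, k) * 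
     (if x \<in> carrier G \<and> y \<in> carrier G \<and> h = grading x y then \<phi> (conj_by k x, conj_by k y) else 0))"
    using f \<phi> by (simp add: lin_ext_pairs coadjoint_delta_eq coadjoint_group_closed coadjoint_group_eq
        cong: if_cong)
  also have "\<dots> = (\<Sum>h\<in>carrier G. if h = grading x y then (\<Sum>k\<in>carrier G. f (h, k) * 
     (if x \<in> carrier G \<and> y \<in> carrier G then \<phi> (conj_by k x, conj_by k y) else 0)) else 0)"
    by (rule sum.cong) auto
  finally show ?thesis by (auto simp: sum.delta)
qed

lemma sum_translate: 
  assumes "b \<in> carrier G"
  shows "(\<Sum>l\<in>carrier G. F l) = (\<Sum>k\<in>carrier G. F (b \<otimes> k))"
  by (rule sum.reindex_bij_witness[of _ "\<lambda>k. b \<otimes> k" "\<lambda>l. inv b \<otimes> l"]) (use assms in auto)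

lemma D_one: "\<one>\<^bsub>D\<^esub> = (\<lambda>(a, b). if a \<in> carrier G \<and> b = \<one> then 1 else 0)"
  by (simp add: drinfeld_double_def)

lemma L_smult_closed: 
  assumes "f \<in> carrier D" "\<phi> \<in> carrier L" shows "f \<odot>\<^bsub>L\<^esub> \<phi> \<in> carrier L"
  by (rule L_memI) (use assms in \<open>simp add: L_smult, blast\<close>)

lemma D_one_closed: "\<one>\<^bsub>D\<^esub> \<in> carrier D"
  by (rule D_memI) (auto simp: D_one)

lemma L_smult_one:
  assumes \<phi>: "\<phi> \<in> carrier L" shows "\<one>\<^bsub>D\<^esub> \<odot>\<^bsub>L\<^esub> \<phi> = \<phi>"
proof
  fix z :: "'a \<times> 'a"
  obtain x y where z: "z = (x, y)" by (cases z)
  show "(\<one>\<^bsub>D\<^esub> \<odot>\<^bsub>L\<^esub> \<phi>) z = \<phi> z"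
  proof (cases "x \<in> carrier G \<and> y \<in> carrier G")
    case True
    have "(\<Sum>k\<in>carrier G. \<one>\<^bsub>D\<^esub> (grading x y, k) * \<phi> (conj_by k x, conj_by k y)) = 
        (\<Sum>k\<in>carrier G. if k = \<one> then \<phi> (conj_by k x, conj_by k y) else 0)"
      by (rule sum.cong) (use True in \<open>simp_all add: D_one\<close>)
    then show ?thesis using True by (simp add: z L_smult[OF D_one_closed \<phi>])
  next
    case False
    then show ?thesis using L_zero[OF \<phi>, of x y] L_zero[OF L_smult_closed[OF D_one_closed \<phi>], of x y]
      unfolding z by auto
  qed
qed

lemma D_mult_closed: 
  assumes "f \<in> carrier D" "g \<in> carrier D" shows "f \<otimes>\<^bsub>D\<^esub> g \<in> carrier D"
  by (rule D_memI) (use assms in \<open>simp add: D_mult, blast\<close>)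

lemma D_add_closed: "f \<in> carrier D \<Longrightarrow> g \<in> carrier D \<Longrightarrow> f \<oplus>\<^bsub>D\<^esub> g \<in> carrier D"
  by (rule D_memI) (simp add: D_zero)

lemma L_add_closed: "f \<in> carrier L \<Longrightarrow> g \<in> carrier L \<Longrightarrow> f \<oplus>\<^bsub>L\<^esub> g \<in> carrier L"
  by (rule L_memI) (simp add: L_zero)

text \<open>Associativity is the substitution \<open>l = b k\<close> in the double sum; it uses that the grading is compatible
  with conjugation.\<close>

lemma L_smult_mult:
  assumes f: "f \<in> carrier D" and g: "g \<in> carrier D" and \<phi>: "\<phi> \<in> carrier L"
  shows "(f \<otimes>\<^bsub>D\<^esub> g) \<odot>\<^bsub>L\<^esub> \<phi> = f \<odot>\<^bsub>L\<^esub> (g \<odot>\<^bsub>L\<^esub> \<phi>)"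
proof
  fix z :: "'a \<times> 'a"
  obtain x y where z: "z = (x, y)" by (cases z)
  note fg = D_mult_closed[OF f g]
  show "((f \<otimes>\<^bsub>D\<^esub> g) \<odot>\<^bsub>L\<^esub> \<phi>) z = (f \<odot>\<^bsub>L\<^esub> (g \<odot>\<^bsub>L\<^esub> \<phi>)) z"
  proof (cases "x \<in> carrier G \<and> y \<in> carrier G")
    case True
    let ?c = "grading x y"
    have "((f \<otimes>\<^bsub>D\<^esub> g) \<odot>\<^bsub>L\<^esub> \<phi>) (x, y) = (\<Sum>l\<in>carrier G. \<Sum>b\<in>carrier G. 
        f (?c, b) * g (conj_by b ?c, inv b \<otimes> l) * \<phi> (conj_by l x, conj_by l y))"
      using True by (simp add: L_smult[OF fg \<phi>] D_mult[OF f g] sum_distrib_right)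
    also have "\<dots> = (\<Sum>b\<in>carrier G. \<Sum>l\<in>carrier G. 
        f (?c, b) * g (conj_by b ?c, inv b \<otimes> l) * \<phi> (conj_by l x, conj_by l y))"
      by (rule sum.swap)
    also have "\<dots> = (\<Sum>b\<in>carrier G. \<Sum>k\<in>carrier G. 
        f (?c, b) * g (conj_by b ?c, k) * \<phi> (conj_by k (conj_by b x), conj_by k (conj_by b y)))"
    proof (rule sum.cong[OF refl])
      fix b assume b: "b \<in> carrier G"
      show "(\<Sum>l\<in>carrier G. f (?c, b) * g (conj_by b ?c, inv b \<otimes> l) * \<phi> (conj_by l x, conj_by l y)) =
        (\<Sum>k\<in>carrier G. f (?c, b) * g (conj_by b ?c, k) * \<phi> (conj_by k (conj_by b x), conj_by k (conj_by b y)))"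
        by (subst sum_translate[OF b], rule sum.cong) (use b True in \<open>simp_all add: conj_by_mult\<close>)
    qed
    also have "\<dots> = (f \<odot>\<^bsub>L\<^esub> (g \<odot>\<^bsub>L\<^esub> \<phi>)) (x, y)"
      using True by (simp add: L_smult[OF f L_smult_closed[OF g \<phi>]] L_smult[OF g \<phi>] grading_conj_by sum_distrib_left mult.assoc)
    finally show ?thesis by (simp add: z)
  next
    case False
    then show ?thesis using L_zero[OF L_smult_closed[OF fg \<phi>], of x y] 
      L_zero[OF L_smult_closed[OF f L_smult_closed[OF g \<phi>]], of x y]
      unfolding z by auto
  qed
qed

lemma L_smult_distrib:
  assumes f: "f \<in> carrier D" and g: "g \<in> carrier D" and \<phi>: "\<phi> \<in> carrier L" and \<psi>: "\<psi> \<in> carrier L"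
  shows "(f \<oplus>\<^bsub>D\<^esub> g) \<odot>\<^bsub>L\<^esub> \<phi> = f \<odot>\<^bsub>L\<^esub> \<phi> \<oplus>\<^bsub>L\<^esub> g \<odot>\<^bsub>L\<^esub> \<phi>"
    and "f \<odot>\<^bsub>L\<^esub> (\<phi> \<oplus>\<^bsub>L\<^esub> \<psi>) = f \<odot>\<^bsub>L\<^esub> \<phi> \<oplus>\<^bsub>L\<^esub> f \<odot>\<^bsub>L\<^esub> \<psi>"
proof -
  have "((f \<oplus>\<^bsub>D\<^esub> g) \<odot>\<^bsub>L\<^esub> \<phi>) (x, y) = (f \<odot>\<^bsub>L\<^esub> \<phi> \<oplus>\<^bsub>L\<^esub> g \<odot>\<^bsub>L\<^esub> \<phi>) (x, y)" for x y
    unfolding L_smult[OF D_add_closed[OF f g] \<phi>] 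
    by (simp add: L_smult[OF f \<phi>] L_smult[OF g \<phi>] ring_distribs sum.distrib)
  then show "(f \<oplus>\<^bsub>D\<^esub> g) \<odot>\<^bsub>L\<^esub> \<phi> = f \<odot>\<^bsub>L\<^esub> \<phi> \<oplus>\<^bsub>L\<^esub> g \<odot>\<^bsub>L\<^esub> \<phi>" by (intro ext) (metis surj_pair)
  have "(f \<odot>\<^bsub>L\<^esub> (\<phi> \<oplus>\<^bsub>L\<^esub> \<psi>)) (x, y) = (f \<odot>\<^bsub>L\<^esub> \<phi> \<oplus>\<^bsub>L\<^esub> f \<odot>\<^bsub>L\<^esub> \<psi>) (x, y)" for x y
    unfolding L_smult[OF f L_add_closed[OF \<phi> \<psi>]] 
    by (simp add: L_smult[OF f \<phi>] L_smult[OF f \<psi>] ring_distribs sum.distrib)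
  then show "f \<odot>\<^bsub>L\<^esub> (\<phi> \<oplus>\<^bsub>L\<^esub> \<psi>) = f \<odot>\<^bsub>L\<^esub> \<phi> \<oplus>\<^bsub>L\<^esub> f \<odot>\<^bsub>L\<^esub> \<psi>" by (intro ext) (metis surj_pair)
qed

lemma L_module:
  assumes "ring (D :: ('k::field, _) module)"
  shows "left_module (D :: ('k, _) module) L"
proof -
  have "abelian_group (L :: (_, 'a \<times> 'a \<Rightarrow> 'k) module)"
  proof (rule abelian_groupI)
    show "\<exists>y\<in>carrier L. y \<oplus>\<^bsub>L\<^esub> x = \<zero>\<^bsub>L\<^esub>" if "x \<in> carrier L" for x :: "'a \<times> 'a \<Rightarrow> 'k"
      using that by (intro bexI[of _ "\<lambda>z. - x z"] L_memI) (simp_all add: L_zero)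
  qed (simp_all add: L_carrier ac_simps)
  then show ?thesis
    unfolding left_module_def using assms
    by (intro conjI ballI L_smult_closed L_smult_distrib L_smult_one L_smult_mult) simp_all
qed

lemma D_scalar: "c \<odot>\<^bsub>D\<^esub> \<one>\<^bsub>D\<^esub> \<in> carrier D"
  by (rule D_memI) (auto simp: D_one)

lemma D_scalar_left: 
  assumes f: "f \<in> carrier D" shows "(c \<odot>\<^bsub>D\<^esub> \<one>\<^bsub>D\<^esub>) \<otimes>\<^bsub>D\<^esub> f = (\<lambda>z. c * f z)"
proof
  fix z :: "'a \<times> 'a" obtain x y where z: "z = (x, y)" by (cases z)
  have "(\<Sum>b\<in>carrier G. (c \<odot>\<^bsub>D\<^esub> \<one>\<^bsub>D\<^esub>) (x, b) * f (conj_by b x, inv b \<otimes> y)) =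
     (\<Sum>b\<in>carrier G. if b = \<one> then c * f (conj_by b x, inv b \<otimes> y) else 0)" if "x \<in> carrier G"
    by (rule sum.cong) (use that in \<open>auto simp: D_one\<close>)
  then show "((c \<odot>\<^bsub>D\<^esub> \<one>\<^bsub>D\<^esub>) \<otimes>\<^bsub>D\<^esub> f) z = c * f z"
    using f unfolding z by (auto simp: D_mult[OF D_scalar f] D_zero simp del: D_ops)
qed

lemma D_scalar_right: 
  assumes f: "f \<in> carrier D" shows "f \<otimes>\<^bsub>D\<^esub> (c \<odot>\<^bsub>D\<^esub> \<one>\<^bsub>D\<^esub>) = (\<lambda>z. c * f z)"
proof
  fix z :: "'a \<times> 'a" obtain x y where z: "z = (x, y)" by (cases z)
  have "(\<Sum>b\<in>carrier G. f (x, b) * (c \<odot>\<^bsub>D\<^esub> \<one>\<^bsub>D\<^esub>) (conj_by b x, inv b \<otimes> y)) =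
     (\<Sum>b\<in>carrier G. if b = y then c * f (x, b) else 0)" if "x \<in> carrier G" "y \<in> carrier G"
  proof (rule sum.cong[OF refl])
    fix b assume "b \<in> carrier G"
    then have "inv b \<otimes> y = \<one> \<longleftrightarrow> b = y" using that by (metis inv_cancel2 inv_equality l_inv r_one inv_inv)
    then show "f (x, b) * (c \<odot>\<^bsub>D\<^esub> \<one>\<^bsub>D\<^esub>) (conj_by b x, inv b \<otimes> y) = (if b = y then c * f (x, b) else 0)"
      using that \<open>b \<in> carrier G\<close> by (auto simp: D_one)
  qed
  then show "(f \<otimes>\<^bsub>D\<^esub> (c \<odot>\<^bsub>D\<^esub> \<one>\<^bsub>D\<^esub>)) z = c * f z"
    using f unfolding z by (auto simp: D_mult[OF f D_scalar] D_zero simp del: D_ops)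
qed

lemma L_scalar:
  assumes \<phi>: "\<phi> \<in> carrier L" shows "(c \<odot>\<^bsub>D\<^esub> \<one>\<^bsub>D\<^esub>) \<odot>\<^bsub>L\<^esub> \<phi> = (\<lambda>z. c * \<phi> z)"
proof
  fix z :: "'a \<times> 'a" obtain x y where z: "z = (x, y)" by (cases z)
  have "(\<Sum>k\<in>carrier G. (c \<odot>\<^bsub>D\<^esub> \<one>\<^bsub>D\<^esub>) (grading x y, k) * \<phi> (conj_by k x, conj_by k y)) =
     (\<Sum>k\<in>carrier G. if k = \<one> then c * \<phi> (conj_by k x, conj_by k y) else 0)" if "x \<in> carrier G" "y \<in> carrier G"
    by (rule sum.cong) (use that in \<open>auto simp: D_one\<close>)
  then show "((c \<odot>\<^bsub>D\<^esub> \<one>\<^bsub>D\<^esub>) \<odot>\<^bsub>L\<^esub> \<phi>) z = c * \<phi> z"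
    using \<phi> unfolding z by (auto simp: L_smult[OF D_scalar \<phi>] L_zero simp del: D_ops)
qed

lemma T_map_eq:
  assumes \<phi>: "\<phi> \<in> carrier L"
  shows "T_map G \<phi> (x, y) = (if x \<in> carrier G \<and> y \<in> carrier G then \<phi> (x, inv x \<otimes> y) else 0)"
proof -
  let ?p = "\<lambda>(a, b). (a, a \<otimes> b)" and ?q = "\<lambda>(a, b). (a, inv a \<otimes> b)"
  have "lin_ext (\<lambda>z. basis_vec (?p z)) \<phi> (x, y) = 
      (if (x, y) \<in> carrier G \<times> carrier G then \<phi> (?q (x, y)) else 0)"
    by (rule lin_ext_pairs_bij[OF \<phi>]) (auto simp: grp)
  then show ?thesis unfolding T_map_def by (simp add: case_prod_unfold)
qed

lemma S_map_eq:
  assumes \<phi>: "\<phi> \<in> carrier L"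
  shows "S_map G \<phi> (x, y) = (if x \<in> carrier G \<and> y \<in> carrier G then \<phi> (x \<otimes> inv y \<otimes> inv x, x) else 0)"
proof -
  let ?p = "\<lambda>(a, b). (b, inv b \<otimes> inv a \<otimes> b)" and ?q = "\<lambda>(a, b). (a \<otimes> inv b \<otimes> inv a, a)"
  have "lin_ext (\<lambda>z. basis_vec (?p z)) \<phi> (x, y) = 
      (if (x, y) \<in> carrier G \<times> carrier G then \<phi> (?q (x, y)) else 0)"
    by (rule lin_ext_pairs_bij[OF \<phi>]) (auto simp: grp)
  then show ?thesis unfolding S_map_def by (simp add: case_prod_unfold)
qed

text \<open>A map that pulls coefficient functions back along a substitution of pairs is \<open>D\<close>-linear if the
  substitution preserves the grading (so it commutes with the \<open>\<delta>\<^sub>h\<close>) and commutes with conjugation (so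
  it commutes with the group elements). Both \<open>T\<close> and \<open>S\<close> are of this kind.\<close>

lemma pullback_hom:
  fixes F :: "('a \<times> 'a \<Rightarrow> 'k::field) \<Rightarrow> 'a \<times> 'a \<Rightarrow> 'k"
  assumes F: "\<And>\<phi> x y. \<phi> \<in> carrier L \<Longrightarrow>
      F \<phi> (x, y) = (if x \<in> carrier G \<and> y \<in> carrier G then \<phi> (q1 x y, q2 x y) else 0)"
    and q: "\<And>x y. x \<in> carrier G \<Longrightarrow> y \<in> carrier G \<Longrightarrow> q1 x y \<in> carrier G"
      "\<And>x y. x \<in> carrier G \<Longrightarrow> y \<in> carrier G \<Longrightarrow> q2 x y \<in> carrier G"
    and conj_by: "\<And>k x y. k \<in> carrier G \<Longrightarrow> x \<in> carrier G \<Longrightarrow> y \<in> carrier G \<Longrightarrow>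
        conj_by k (q1 x y) = q1 (conj_by k x) (conj_by k y)"
      "\<And>k x y. k \<in> carrier G \<Longrightarrow> x \<in> carrier G \<Longrightarrow> y \<in> carrier G \<Longrightarrow>
        conj_by k (q2 x y) = q2 (conj_by k x) (conj_by k y)"
    and grading: "\<And>x y. x \<in> carrier G \<Longrightarrow> y \<in> carrier G \<Longrightarrow> grading (q1 x y) (q2 x y) = grading x y"
  shows "module_hom (D :: ('k, _) module) L L F"
proof -
  have closed: "F \<phi> \<in> carrier L" if "\<phi> \<in> carrier L" for \<phi>
    by (rule L_memI) (use that in \<open>simp add: F, blast\<close>)
  have add: "F (\<phi> \<oplus>\<^bsub>L\<^esub> \<psi>) = F \<phi> \<oplus>\<^bsub>L\<^esub> F \<psi>" if "\<phi> \<in> carrier L" "\<psi> \<in> carrier L" for \<phi> \<psi>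
  proof -
    have "F (\<phi> \<oplus>\<^bsub>L\<^esub> \<psi>) (x, y) = (F \<phi> \<oplus>\<^bsub>L\<^esub> F \<psi>) (x, y)" for x y
      unfolding F[OF L_add_closed[OF that]] by (simp add: F that)
    then show ?thesis by (intro ext) (metis surj_pair)
  qed
  have smult: "F (f \<odot>\<^bsub>L\<^esub> \<phi>) = f \<odot>\<^bsub>L\<^esub> F \<phi>" if f: "f \<in> carrier D" and \<phi>: "\<phi> \<in> carrier L" for f \<phi>
  proof -
    have "F (f \<odot>\<^bsub>L\<^esub> \<phi>) (x, y) = (f \<odot>\<^bsub>L\<^esub> F \<phi>) (x, y)" for x y
    proof (cases "x \<in> carrier G \<and> y \<in> carrier G")
      case True
      then show ?thesis
        by (simp add: F[OF L_smult_closed[OF f \<phi>]] F[OF \<phi>]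
            L_smult[OF f \<phi>] L_smult[OF f closed[OF \<phi>]] q conj_by grading)
    next
      case False
      then show ?thesis
        using L_zero[OF closed[OF L_smult_closed[OF f \<phi>]], of x y]
          L_zero[OF L_smult_closed[OF f closed[OF \<phi>]], of x y] by auto
    qed
    then show ?thesis by (intro ext) (metis surj_pair)
  qed
  show ?thesis
    unfolding module_hom_def using closed add smult by blast
qed

lemma T_map_hom: "module_hom (D :: ('k::field, _) module) L L (T_map G)"
  by (rule pullback_hom[where ?q1.0 = "\<lambda>x y. x" and ?q2.0 = "\<lambda>x y. inv x \<otimes> y", OF T_map_eq])
    (simp_all add: conj_by_hom conj_by_inv, simp_all add: grading_def grp)

lemma S_map_hom: "module_hom (D :: ('k::field, _) module) L L (S_map G)"
  by (rule pullback_hom[where ?q1.0 = "\<lambda>x y. x \<otimes> inv y \<otimes> inv x" and ?q2.0 = "\<lambda>x y. x", OF S_map_eq])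
    (simp_all add: conj_by_hom conj_by_inv, simp_all add: grading_def grp)

section \<open>The group algebra inside the double\<close>

text \<open>The element \<open>\<delta>\<^sub>e \<otimes> c\<close> for an element \<open>c\<close> of the group algebra. These form a subring isomorphic to the group
  algebra, with unit \<open>\<delta>\<^sub>e \<otimes> e\<close>.\<close>

definition at_unit :: "('a \<Rightarrow> 'k::field) \<Rightarrow> 'a \<times> 'a \<Rightarrow> 'k" where
  "at_unit c = (\<lambda>(a, b). if a = \<one> \<and> b \<in> carrier G then c b else 0)"

lemma at_unit_closed [simp]: "at_unit c \<in> carrier D"
  by (auto simp: at_unit_def D_carrier)

lemma mult_at_unit:
  assumes f: "f \<in> carrier D"
  shows "f \<otimes>\<^bsub>D\<^esub> at_unit c = at_unit (\<lambda>y. \<Sum>b\<in>carrier G. f (\<one>, b) * c (inv b \<otimes> y))"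
proof
  fix z :: "'a \<times> 'a" obtain x y where z: "z = (x, y)" by (cases z)
  have "(\<Sum>b\<in>carrier G. f (x, b) * at_unit c (conj_by b x, inv b \<otimes> y)) = 
     (if x = \<one> then \<Sum>b\<in>carrier G. f (\<one>, b) * c (inv b \<otimes> y) else 0)" 
    if "x \<in> carrier G" "y \<in> carrier G"
    using that by (auto simp: at_unit_def conj_by_eq_one_iff)
  then show "(f \<otimes>\<^bsub>D\<^esub> at_unit c) z = at_unit (\<lambda>y. \<Sum>b\<in>carrier G. f (\<one>, b) * c (inv b \<otimes> y)) z"
    unfolding z D_mult[OF f at_unit_closed] by (auto simp: at_unit_def)
qed

lemma L_smult_at_unit:
  assumes \<phi>: "\<phi> \<in> carrier L"
  shows "(at_unit c \<odot>\<^bsub>L\<^esub> \<phi>) (x, y) = (if x \<in> carrier G \<and> y \<in> carrier G \<and> x \<otimes> y = y \<otimes> x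
     then \<Sum>k\<in>carrier G. c k * \<phi> (conj_by k x, conj_by k y) else 0)"
  unfolding L_smult[OF at_unit_closed \<phi>] by (auto simp: at_unit_def grading_eq_one_iff)

end

section \<open>Representations on projective lines\<close>

lemma mat_act_nth [simp]:
  "mat_act A v $ 1 = of_int (A $ 1 $ 1) * v $ 1 + of_int (A $ 1 $ 2) * v $ 2"
  "mat_act A v $ 2 = of_int (A $ 2 $ 1) * v $ 1 + of_int (A $ 2 $ 2) * v $ 2"
  by (simp_all add: mat_act_def matrix_vector_mult_def sum_2)

lemma vec2_eq_iff: "v = w \<longleftrightarrow> v $ 1 = w $ 1 \<and> v $ 2 = w $ 2" for v w :: "'a ^ 2"
  unfolding vec_eq_iff forall_2 by blast

lemma mat_act_mult: "mat_act (A ** B) v = mat_act A (mat_act B v)"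
  by (simp add: vec2_eq_iff matrix_matrix_mult_def sum_2 algebra_simps)

lemma mat_act_one [simp]: "mat_act (mat 1) v = v"
  by (simp add: vec2_eq_iff mat_def)

lemma mat_act_zero [simp]: "mat_act A 0 = 0"
  by (simp add: vec2_eq_iff)

lemma mat_act_scale: "mat_act A (c *s v) = c *s mat_act A v"
  by (simp add: vec2_eq_iff algebra_simps)

lemma mat_act_minus: "mat_act A (- v) = - mat_act A v"
  by (simp add: vec2_eq_iff algebra_simps)

lemma mat_act_eq_zero_iff:
  assumes "B ** A = mat 1" shows "mat_act A v = 0 \<longleftrightarrow> v = 0"
  using assms by (metis mat_act_mult mat_act_one mat_act_zero)

lemma mat_act_line: "mat_act A ` range (\<lambda>c. c *s v) = range (\<lambda>c. c *s mat_act A v)"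
  by (simp add: image_image mat_act_scale)

lemma proj_line_image:
  assumes "B ** A = mat 1" "l \<in> proj_line" shows "mat_act A ` l \<in> proj_line"
proof -
  obtain v where "v \<noteq> 0" "l = range (\<lambda>c. c *s v)" using assms(2) unfolding proj_line_def by blast
  then show ?thesis
    unfolding proj_line_def using mat_act_line[of A v] mat_act_eq_zero_iff[OF assms(1)] by blast
qed

lemma linear_rep_proj_line:
  "linear_rep SL2Z (proj_line_rep TYPE('n::{comm_ring_1, finite}) :: (_, 'k::field, _) rep)"
  unfolding proj_line_rep_def
proof (rule linear_rep_perm_rep)
  show "mat_act g ` l \<in> proj_line" if "g \<in> carrier SL2Z" "l \<in> proj_line" for g and l :: "('n ^ 2) set"
  proof -
    from that have "det g = 1" by simp
    then obtain B where "B ** g = mat 1" using SL2Z_inverse by blast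
    then show ?thesis using proj_line_image that by blast
  qed
qed (simp_all add: image_image mat_act_mult)

abbreviation nonzero_3 :: "(3 ^ 2) set" where "nonzero_3 \<equiv> UNIV - {0}"

lemma three_3 [simp]: "(3::3) = 0" by simp

lemma neg_one_neq_one_3: "(-1 :: 3) \<noteq> 1" by simp

abbreviation twisted_space :: "('k::field, 3 ^ 2 \<Rightarrow> 'k) module" where
  "twisted_space \<equiv> span_on nonzero_3 \<lparr> carrier := {v \<in> carrier (span_on nonzero_3).
        \<forall>c\<in>{1, - 1}. lin_ext (\<lambda>x. basis_vec (c *s x)) v = (\<lambda>x. chi2 c * v x)} \<rparr>"

text \<open>The condition on the two scalars says that the function is odd.\<close>

lemma twisted_carrier:
  "f \<in> carrier twisted_space \<longleftrightarrow> f 0 = 0 \<and> (\<forall>x. f (- x) = - f x)"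
proof -
  have fin: "finite nonzero_3" by simp
  have 1: "lin_ext (\<lambda>x. basis_vec (c *s x)) f = (\<lambda>x. f (c *s x))"
    if f0: "f 0 = 0" and c: "c * c = 1" for c :: 3
  proof
    fix y
    have z: "f x = 0" if "x \<notin> nonzero_3" for x using f0 that by auto
    have cc: "c *s (c *s x) = x" for x :: "3 ^ 2" using c by (simp add: vector_smult_assoc)
    have nz: "c *s x \<noteq> 0" if "x \<noteq> 0" for x :: "3 ^ 2" using cc that by (metis vector_smult_rzero)
    show "lin_ext (\<lambda>x. basis_vec (c *s x)) f y = f (c *s y)"
    proof (cases "y \<in> nonzero_3")
      case True
      show ?thesis by (rule lin_ext_bij[OF fin z True]) (use cc nz True in simp_all)
    next
      case False
      have "lin_ext (\<lambda>x. basis_vec (c *s x)) f y = 0"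
        by (rule lin_ext_basis_outside[OF fin z _ False]) (use nz in simp_all)
      then show ?thesis using False f0 by simp
    qed
  qed
  have neg: "(-1 :: 3) *s x = - x" for x :: "3 ^ 2" by (simp add: vec2_eq_iff)
  have "f \<in> carrier twisted_space \<longleftrightarrow> f 0 = 0 \<and> 
      (\<forall>c\<in>{1, - 1 :: 3}. lin_ext (\<lambda>x. basis_vec (c *s x)) f = (\<lambda>x. chi2 c * f x))"
    by (auto simp: span_on_carrier[OF fin])
  also have "\<dots> \<longleftrightarrow> f 0 = 0 \<and> (\<forall>c\<in>{1, - 1 :: 3}. (\<lambda>x. f (c *s x)) = (\<lambda>x. chi2 c * f x))"
  proof (rule conj_cong[OF refl], rule ball_cong[OF refl])
    fix c :: 3 assume "f 0 = 0" "c \<in> {1, - 1}"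
    moreover from this have "c * c = 1" by auto
    ultimately show "(lin_ext (\<lambda>x. basis_vec (c *s x)) f = (\<lambda>x. chi2 c * f x)) = ((\<lambda>x. f (c *s x)) = (\<lambda>x. chi2 c * f x))"
      using 1 by simp
  qed
  also have "\<dots> \<longleftrightarrow> f 0 = 0 \<and> (\<forall>x. f (- x) = - f x)"
    using neg_one_neq_one_3 neg by (simp add: chi2_def fun_eq_iff neg)
  finally show ?thesis .
qed

lemma twisted_rep_eq: "twisted_proj_line_rep = (twisted_space, \<lambda>g. lin_ext (\<lambda>x. basis_vec (mat_act g x)))"
  by (simp add: twisted_proj_line_rep_def perm_rep_def Let_def)

lemma lin_ext_mat_act:
  assumes AB: "A ** B = mat 1" "B ** A = mat 1" and f: "f 0 = 0"
  shows "lin_ext (\<lambda>x. basis_vec (mat_act A x)) f = (\<lambda>y :: 3 ^ 2. f (mat_act B y))"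
proof
  fix y :: "3 ^ 2"
  have z: "f x = 0" if "x \<notin> nonzero_3" for x using f that by auto
  note nzA = mat_act_eq_zero_iff[OF AB(2)] and nzB = mat_act_eq_zero_iff[OF AB(1)]
  show "lin_ext (\<lambda>x. basis_vec (mat_act A x)) f y = f (mat_act B y)"
  proof (cases "y \<in> nonzero_3")
    case True
    show ?thesis
      by (rule lin_ext_bij[OF _ z True]) (use True in \<open>simp_all add: AB nzB flip: mat_act_mult\<close>)
  next
    case False
    have "lin_ext (\<lambda>x. basis_vec (mat_act A x)) f y = 0"
      by (rule lin_ext_basis_outside[OF _ z _ False]) (simp_all add: nzA)
    then show ?thesis using False f by simp
  qed
qed

lemma linear_rep_twisted: "linear_rep SL2Z (twisted_proj_line_rep :: (_, 'k::field, _) rep)"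
  unfolding twisted_rep_eq
proof (rule linear_rep_span_on[where I = nonzero_3])
  show "module ring_of_type_algebra (twisted_space :: ('k, _) module)"
  proof (rule vector_space_span_on)
    show "(\<lambda>x. f x + g x) \<in> carrier twisted_space"
      if "f \<in> carrier twisted_space" "g \<in> carrier twisted_space" for f g :: "_ \<Rightarrow> 'k"
      using that unfolding twisted_carrier by simp
    show "(\<lambda>x. k * f x) \<in> carrier twisted_space"
      if "f \<in> carrier twisted_space" for k and f :: "_ \<Rightarrow> 'k"
      using that unfolding twisted_carrier by simp
    show "(\<lambda>_. 0) \<in> carrier (twisted_space :: ('k, _) module)"
      unfolding twisted_carrier by simp
  qed (simp_all add: span_on_def)
  fix g :: "int ^ 2 ^ 2" assume "g \<in> carrier SL2Z"
  then obtain B where B: "g ** B = mat 1" "B ** g = mat 1" using SL2Z_inverse by auto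
  show "lin_ext (\<lambda>x. basis_vec (mat_act g x)) f \<in> carrier twisted_space"
    if "f \<in> carrier twisted_space" for f :: "_ \<Rightarrow> 'k"
    using that unfolding twisted_carrier by (simp add: lin_ext_mat_act[OF B] mat_act_minus)
  show "mat_act g x \<in> nonzero_3" if "x \<in> nonzero_3" for x using that mat_act_eq_zero_iff[OF B(2), of x] by simp
qed (auto simp: span_on_def mat_act_mult)

section \<open>Sums over lines\<close>

text \<open>The passage from functions on vectors to functions on lines. Summing over the nonzero vectors of a
  line needs no choice of a representative, so it is linear and equivariant on all functions. On a
  line over \<open>Z\<^sub>2\<close> it is the value at the only nonzero vector; on a line over \<open>Z\<^sub>3\<close> it is twice the common
  value of an even function, and 2 is invertible.\<close>

definition line_sum :: "('n::comm_ring_1 ^ 2 \<Rightarrow> 'k::field) \<Rightarrow> ('n ^ 2) set \<Rightarrow> 'k" where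
  "line_sum F l = (if l \<in> proj_line then \<Sum>v\<in>l - {0}. F v else 0)"

lemma line_sum_add: "line_sum (\<lambda>v. F v + F' v) l = line_sum F l + line_sum F' l"
  by (simp add: line_sum_def sum.distrib)
lemma line_sum_scale: "line_sum (\<lambda>v. k * F v) l = k * line_sum F l"
  by (simp add: line_sum_def sum_distrib_left)

lemma line_sum_equivariant:
  fixes F :: "'n::{comm_ring_1, finite} ^ 2 \<Rightarrow> 'k::field"
  assumes AB: "A ** B = mat 1" "B ** A = mat 1"
  shows "lin_ext (\<lambda>l. basis_vec (mat_act A ` l)) (line_sum F) = line_sum (\<lambda>v. F (mat_act B v))"
proof
  fix l :: "('n ^ 2) set"
  have fin: "finite (proj_line :: ('n ^ 2) set set)" by simp
  have z: "line_sum F l = 0" if "l \<notin> proj_line" for l using that by (simp add: line_sum_def)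
  show "lin_ext (\<lambda>l. basis_vec (mat_act A ` l)) (line_sum F) l = line_sum (\<lambda>v. F (mat_act B v)) l"
  proof (cases "l \<in> proj_line")
    case True
    have Bl: "mat_act B ` l \<in> proj_line" by (rule proj_line_image[OF AB(1) True])
    have inj: "inj_on (mat_act B) (l - {0})"
      by (rule inj_on_inverseI[of _ "mat_act A"]) (simp add: AB flip: mat_act_mult)
    have im: "mat_act B ` l - {0} = mat_act B ` (l - {0})"
      using mat_act_eq_zero_iff[OF AB(1)] by auto
    have "lin_ext (\<lambda>l. basis_vec (mat_act A ` l)) (line_sum F) l = line_sum F (mat_act B ` l)"
      by (rule lin_ext_bij[OF fin z True]) (use Bl in \<open>simp_all add: image_image AB flip: mat_act_mult\<close>)
    also have "\<dots> = (\<Sum>v\<in>l - {0}. F (mat_act B v))"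
      using Bl by (simp add: line_sum_def im sum.reindex[OF inj])
    finally show ?thesis using True by (simp add: line_sum_def)
  next
    case False
    have "lin_ext (\<lambda>l. basis_vec (mat_act A ` l)) (line_sum F) l = 0"
      by (rule lin_ext_basis_outside[OF fin z _ False]) (use proj_line_image[OF AB(2)] in auto)
    then show ?thesis using False by (simp add: line_sum_def)
  qed
qed

lemma UNIV_2_eq: "(UNIV :: 2 set) = {0, 1}"
proof -
  have "x = 0 \<or> x = 1" for x :: 2 using exhaust_2[of x] by auto
  then show ?thesis by auto
qed

lemma UNIV_3_eq: "(UNIV :: 3 set) = {0, 1, -1}"
proof -
  have "x = 0 \<or> x = 1 \<or> x = -1" for x :: 3 using exhaust_3[of x] by auto
  then show ?thesis by auto
qed

lemma line_2: "range (\<lambda>c. c *s v) = {0, v}" for v :: "2 ^ 2"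
  by (simp add: UNIV_2_eq vec2_eq_iff)

lemma line_3: "range (\<lambda>c. c *s v) = {0, v, - v}" for v :: "3 ^ 2"
proof -
  have neg: "(-1 :: 3) *s v = - v" by (simp add: vec2_eq_iff)
  show ?thesis by (simp only: UNIV_3_eq image_insert image_empty neg vector_smult_lzero vector_smult_lid)
qed

lemma line_sum_2: "v \<noteq> 0 \<Longrightarrow> line_sum F {0, v} = F v" for v :: "2 ^ 2"
  unfolding line_sum_def proj_line_def using line_2[of v] by auto

lemma neg_neq_3: "v \<noteq> 0 \<Longrightarrow> - v \<noteq> v" for v :: "3 ^ 2"
proof -
  have "- x = x \<Longrightarrow> x = 0" for x :: 3 using exhaust_3[of x] by auto
  then show "v \<noteq> 0 \<Longrightarrow> - v \<noteq> v" by (auto simp: vec2_eq_iff)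
qed

lemma line_sum_3: 
  fixes v :: "3 ^ 2" assumes v: "v \<noteq> 0" shows "line_sum F {0, v, - v} = F v + F (- v)"
proof -
  have l: "{0, v, - v} \<in> proj_line" unfolding proj_line_def using line_3[of v] v by auto
  have "{0, v, - v} - {0} = {v, - v}" using v by auto
  then show ?thesis using l neg_neq_3[OF v] by (simp add: line_sum_def)
qed

lemma proj_line_2: "l \<in> (proj_line :: (2 ^ 2) set set) \<longleftrightarrow> (\<exists>v. v \<noteq> 0 \<and> l = {0, v})"
  unfolding proj_line_def line_2 by blast

lemma proj_line_3: "l \<in> (proj_line :: (3 ^ 2) set set) \<longleftrightarrow> (\<exists>v. v \<noteq> 0 \<and> l = {0, v, - v})"
  unfolding proj_line_def line_3 by blast

section \<open>Arithmetic modulo 2 and 3\<close>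

lemma all_3: "(\<forall>a :: 3. Q a) \<longleftrightarrow> Q 0 \<and> Q 1 \<and> Q (-1)"
  using UNIV_3_eq by (metis UNIV_I insertE empty_iff)

lemma all_2: "(\<forall>a :: 2. Q a) \<longleftrightarrow> Q 0 \<and> Q 1"
  using UNIV_2_eq by (metis UNIV_I insertE empty_iff)

lemma two_3 [simp]: "(2 :: 3) = - 1" by simp

lemma arith_3 [simp]: "(0 :: 3) \<noteq> 1" "(1 :: 3) \<noteq> - 1" "(-1 :: 3) \<noteq> 1" "(-1 :: 3) \<noteq> 0" "(0 :: 3) \<noteq> -1"
  by simp_all

lemma arith_2 [simp]: "(0 :: 2) \<noteq> 1" by simp

lemma two_2: "(2 :: 2) = 0" by simp

lemma double_2 [simp]: "b + b = (0 :: 2)" "- b = b" "b + (b + c) = c" for b c :: 2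
proof -
  have 1: "\<forall>b :: 2. b + b = 0" by (simp add: all_2)
  have 2: "\<forall>b :: 2. - b = b" by (simp add: all_2)
  show "b + b = 0" "- b = b" "b + (b + c) = c" using 1 2 by (simp_all flip: add.assoc)
qed

lemma triple_3: "a + a = - a" for a :: 3
proof -
  have "\<forall>a :: 3. a + a = - a" by (simp add: all_3)
  then show ?thesis by blast
qed

lemma ex_vec2: "\<exists>v :: 'a ^ 2. v $ 1 = p \<and> v $ 2 = q"
  by (rule exI[of _ "\<chi> i. if i = 1 then p else q"]) simp

section \<open>Commuting pairs in the symmetric group on three letters\<close>

text \<open>The symmetric group on three letters as the group of affine maps \<open>x \<mapsto> a \<plusminus> x\<close> of \<open>Z\<^sub>3\<close>: the element
  \<open>el a b\<close> is the rotation by \<open>a\<close> after the \<open>b\<close>-th power of the reflection \<open>x \<mapsto> -x\<close>. With these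
  coordinates, all computations in the group are arithmetic modulo 3 and 2.\<close>

locale sym3 = finite_group G for G :: "'a monoid" (structure) +
  fixes el :: "3 \<Rightarrow> 2 \<Rightarrow> 'a"
  assumes el_mult [simp]: "el a b \<otimes> el c d = el (a + (if b = 0 then c else - c)) (b + d)"
    and el_inj [simp]: "el a b = el c d \<longleftrightarrow> a = c \<and> b = d"
    and el_surj: "carrier G = range (\<lambda>(a, b). el a b)"
begin

lemma el_closed [simp]: "el a b \<in> carrier G"
  unfolding el_surj by auto

lemma el_cases: 
  assumes "x \<in> carrier G" obtains a b where "x = el a b"
  using assms unfolding el_surj by auto

lemma el_one: "\<one> = el 0 0"
proof -
  have "el 0 0 \<otimes> el 0 0 = el 0 0" by simp
  then show ?thesis by (metis el_closed r_cancel_one')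
qed

lemma el_inv [simp]: "inv (el a b) = el (if b = 0 then - a else a) b"
  by (rule inv_equality) (simp_all add: el_one)

lemma sum_el: "(\<Sum>k\<in>carrier G. F k) = F (el 0 0) + F (el 1 0) + F (el (-1) 0) 
    + F (el 0 1) + F (el 1 1) + F (el (-1) 1)"
proof -
  have inj: "inj (\<lambda>(a, b). el a b)" by (auto simp: inj_on_def)
  have U: "(UNIV :: (3 \<times> 2) set) = {(0, 0), (1, 0), (-1, 0), (0, 1), (1, 1), (-1, 1)}" (is "_ = ?S")
  proof (rule UNIV_eq_I)
    have all: "\<forall>a b. (a, b) \<in> ?S" by (simp add: all_3 all_2)
    show "p \<in> ?S" for p
      using all[rule_format, of "fst p" "snd p"] by (simp only: prod.collapse)
  qed
  have "(\<Sum>k\<in>carrier G. F k) = (\<Sum>p\<in>UNIV. F (case p of (a, b) \<Rightarrow> el a b))"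
    unfolding el_surj by (simp add: sum.reindex[OF inj])
  also have "\<dots> = F (el 0 0) + F (el 1 0) + F (el (-1) 0) + F (el 0 1) + F (el 1 1) + F (el (-1) 1)"
    unfolding U by (simp add: add.assoc)
  finally show ?thesis .
qed

text \<open>Commuting pairs are parametrized by vectors of exponents. In \<open>rot_pair v\<close> both elements are rotations;
  in \<open>refl_pair a v\<close> both are powers of the reflection \<open>x \<mapsto> a - x\<close>. The two components of \<open>v\<close> are taken in
  the opposite order, since \<open>u(c, d) \<mapsto> u(c, cd)\<close> adds the exponent of \<open>c\<close> to that of \<open>d\<close>, whereas the matrix
  of \<open>T\<close> adds the second component to the first.\<close>

definition rot_pair :: "3 ^ 2 \<Rightarrow> 'a \<times> 'a" where "rot_pair v = (el (v $ 2) 0, el (v $ 1) 0)"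
definition refl_el :: "3 \<Rightarrow> 2 \<Rightarrow> 'a" where "refl_el a c = el (if c = 0 then 0 else a) c"
lemma refl_el_closed: "refl_el a c \<in> carrier G" by (simp add: refl_el_def)
definition refl_pair :: "3 \<Rightarrow> 2 ^ 2 \<Rightarrow> 'a \<times> 'a" where "refl_pair a v = (refl_el a (v $ 2), refl_el a (v $ 1))"

lemma conj_by_rot_rot: "conj_by (el k 0) (el a 0) = el a 0"
  by (simp add: conj_by_def)
lemma conj_by_ref_rot: "conj_by (el 0 1) (el a 0) = el (- a) 0"
  by (simp add: conj_by_def)
text \<open>Because \<open>-2 = 1\<close> modulo 3, conjugation by a rotation shifts the index of the reflection by exactly the
  angle of the rotation, so the rotations permute the three reflections freely.\<close>

lemma conj_by_rot_refl_el: "conj_by (el k 0) (refl_el a c) = refl_el (a + k) c"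
  by (simp add: conj_by_def refl_el_def algebra_simps)
lemma conj_by_ref_refl_el: "conj_by (el 0 1) (refl_el a c) = refl_el (- a) c"
  by (simp add: conj_by_def refl_el_def)

definition commuting where "commuting x y \<longleftrightarrow> x \<in> carrier G \<and> y \<in> carrier G \<and> x \<otimes> y = y \<otimes> x"

lemma commuting_rot_pair: "commuting (el a 0) (el b 0)"
  by (simp add: commuting_def add.commute)

lemma commuting_refl_el: "commuting (refl_el a c) (refl_el a d)"
  by (simp add: commuting_def refl_el_def add.commute)

text \<open>Two rotations always commute. A rotation that commutes with a reflection is trivial, as it equals its
  inverse modulo 3, and two reflections commute only if they are equal.\<close>

lemma commuting_cases:
  assumes "commuting x y"
  obtains (rot_pair) v where "(x, y) = rot_pair v" | (refl_pair) a v where "v \<noteq> 0" "(x, y) = refl_pair a v"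
proof -
  obtain a b c d where xy: "x = el a b" "y = el c d" 
    using assms el_cases unfolding commuting_def by metis
  have eq: "a + (if b = 0 then c else - c) = c + (if d = 0 then a else - a)"
    using assms unfolding commuting_def xy by simp
  have bd: "b = 0 \<or> b = 1" "d = 0 \<or> d = 1" using UNIV_2_eq by auto
  have fix0: "z = 0" if "z = - z" for z :: 3
  proof -
    have "\<forall>z :: 3. z = - z \<longrightarrow> z = 0" by (simp add: all_3)
    then show ?thesis using that by blast
  qed
  obtain v :: "2 ^ 2" where v: "v $ 1 = d" "v $ 2 = b" using ex_vec2[of d b] by (elim exE conjE)
  obtain w :: "3 ^ 2" where w: "w $ 1 = c" "w $ 2 = a" using ex_vec2[of c a] by (elim exE conjE)
  show ?thesis
  proof (cases "b = 0 \<and> d = 0")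
    case True
    then show ?thesis using rot_pair[of w] w xy by (simp add: rot_pair_def)
  next
    case False
    then have v0: "v \<noteq> 0" using v by (auto simp: vec2_eq_iff)
    consider "b = 0" "d = 1" | "b = 1" "d = 0" | "b = 1" "d = 1" using False bd by blast
    then show ?thesis
    proof cases
      case 1
      then have "a = 0" using eq by (intro fix0) (simp add: add.commute)
      then show ?thesis using refl_pair[OF v0, of c] v xy 1 by (simp add: refl_pair_def refl_el_def)
    next
      case 2
      then have "c = 0" using eq by (intro fix0) (simp add: add.commute)
      then show ?thesis using refl_pair[OF v0, of a] v xy 2 by (simp add: refl_pair_def refl_el_def)
    next
      case 3
      then have "a - c = - (a - c)" using eq by simp
      then have "a = c" using fix0 by fastforce
      then show ?thesis using refl_pair[OF v0, of a] v xy 3 by (simp add: refl_pair_def refl_el_def)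
    qed
  qed
qed

lemma rot_pair_inj: "rot_pair v = rot_pair w \<longleftrightarrow> v = w"
  by (auto simp: rot_pair_def vec2_eq_iff)

lemma refl_pair_inj: 
  assumes "v \<noteq> 0" shows "refl_pair a v = refl_pair b w \<longleftrightarrow> a = b \<and> v = w"
proof
  assume eq: "refl_pair a v = refl_pair b w"
  then have "v = w" by (simp add: refl_pair_def refl_el_def vec2_eq_iff)
  moreover have "a = b" using eq assms by (auto simp: refl_pair_def refl_el_def vec2_eq_iff split: if_splits)
  ultimately show "a = b \<and> v = w" by simp
qed simp

lemma refl_pair_neq_rot_pair: "v \<noteq> 0 \<Longrightarrow> refl_pair a v \<noteq> rot_pair w"
  by (auto simp: refl_pair_def refl_el_def rot_pair_def vec2_eq_iff)

definition supp_comm :: "('a \<times> 'a \<Rightarrow> 'k::field) \<Rightarrow> bool" where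
  "supp_comm \<phi> \<longleftrightarrow> (\<forall>x y. \<not> commuting x y \<longrightarrow> \<phi> (x, y) = 0)"

lemma supp_comm_L: "supp_comm \<phi> \<Longrightarrow> \<phi> \<in> carrier L"
  by (rule L_memI) (auto simp: supp_comm_def commuting_def)

text \<open>A vector supported on commuting pairs is determined by its values on \<open>rot_pair\<close> and \<open>refl_pair\<close>, and by
  \<open>L_construct\<close> these can be prescribed. The nonzero vectors suffice for \<open>refl_pair\<close>: at \<open>v = 0\<close> it is the
  pair of units, which is also \<open>rot_pair 0\<close>.\<close>

lemma L_ext:
  assumes "supp_comm \<phi>" "supp_comm \<psi>" "\<And>v. \<phi> (rot_pair v) = \<psi> (rot_pair v)"
    "\<And>a v. v \<noteq> 0 \<Longrightarrow> \<phi> (refl_pair a v) = \<psi> (refl_pair a v)"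
  shows "\<phi> = \<psi>"
proof
  fix z :: "'a \<times> 'a"
  obtain x y where z: "z = (x, y)" by (cases z)
  show "\<phi> z = \<psi> z"
  proof (cases "commuting x y")
    case True
    then show ?thesis unfolding z by (cases rule: commuting_cases) (simp_all add: assms(3,4))
  qed (use assms(1,2) in \<open>simp add: z supp_comm_def\<close>)
qed

lemma L_construct:
  obtains \<phi> :: "'a \<times> 'a \<Rightarrow> 'k::field" where "supp_comm \<phi>" "\<And>v. \<phi> (rot_pair v) = F v" 
    "\<And>a v. v \<noteq> 0 \<Longrightarrow> \<phi> (refl_pair a v) = H a v"
proof -
  define \<phi> where "\<phi> = (\<lambda>z. if \<exists>v. z = rot_pair v then F (THE v. z = rot_pair v) 
     else if \<exists>a v. v \<noteq> 0 \<and> z = refl_pair a v then (case (THE p. snd p \<noteq> 0 \<and> z = refl_pair (fst p) (snd p)) of (a, v) \<Rightarrow> H a v) else 0)"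
  have "\<phi> (rot_pair v) = F v" for v by (simp add: \<phi>_def rot_pair_inj)
  moreover have "\<phi> (refl_pair a v) = H a v" if v: "v \<noteq> 0" for a v
  proof -
    have "(THE p. snd p \<noteq> 0 \<and> refl_pair a v = refl_pair (fst p) (snd p)) = (a, v)"
      by (rule the_equality) (use v in \<open>auto simp: refl_pair_inj\<close>)
    then show ?thesis using v refl_pair_neq_rot_pair[OF v] by (auto simp: \<phi>_def)
  qed
  moreover have "supp_comm \<phi>"
    unfolding supp_comm_def
  proof (intro allI impI)
    fix x y assume nc: "\<not> commuting x y"
    have "(x, y) \<noteq> rot_pair v" for v using nc commuting_rot_pair by (auto simp: rot_pair_def)
    moreover have "(x, y) \<noteq> refl_pair a v" for a v using nc commuting_refl_el by (auto simp: refl_pair_def)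
    ultimately show "\<phi> (x, y) = 0" by (simp add: \<phi>_def)
  qed
  ultimately show ?thesis using that by blast
qed

text \<open>On exponents, \<open>T\<close> and \<open>S\<close> pull functions back along the inverses of their matrices, as required for the
  action of the matrices on the basis vectors.\<close>

lemma T_map_rot_pair: 
  "\<phi> \<in> carrier L \<Longrightarrow> T_map G \<phi> (rot_pair v) = \<phi> (rot_pair (mat_act (mat22 1 (-1) 0 1) v))"
  by (simp add: rot_pair_def T_map_eq)
lemma T_map_refl_pair:
  "\<phi> \<in> carrier L \<Longrightarrow> T_map G \<phi> (refl_pair a v) = \<phi> (refl_pair a (mat_act (mat22 1 (-1) 0 1) v))"
proof -
  assume \<phi>: "\<phi> \<in> carrier L"
  have *: "inv (refl_el a c) \<otimes> refl_el a d = refl_el a (d + c)" for c d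
  proof -
    have "\<forall>c d. inv (refl_el a c) \<otimes> refl_el a d = refl_el a (d + c)" by (simp add: all_2 refl_el_def)
    then show ?thesis by blast
  qed
  show ?thesis using \<phi> by (simp add: refl_pair_def T_map_eq refl_el_closed *)
qed
lemma S_map_rot_pair: 
  "\<phi> \<in> carrier L \<Longrightarrow> S_map G \<phi> (rot_pair v) = \<phi> (rot_pair (mat_act (mat22 0 1 (-1) 0) v))"
  by (simp add: rot_pair_def S_map_eq)
lemma S_map_refl_pair:
  "\<phi> \<in> carrier L \<Longrightarrow> S_map G \<phi> (refl_pair a v) = \<phi> (refl_pair a (mat_act (mat22 0 1 (-1) 0) v))"
proof -
  assume \<phi>: "\<phi> \<in> carrier L"
  have *: "refl_el a c \<otimes> inv (refl_el a d) \<otimes> inv (refl_el a c) = refl_el a d" for c d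
  proof -
    have "\<forall>c d. refl_el a c \<otimes> inv (refl_el a d) \<otimes> inv (refl_el a c) = refl_el a d" by (simp add: all_2 refl_el_def)
    then show ?thesis by blast
  qed
  show ?thesis using \<phi> by (simp add: refl_pair_def S_map_eq refl_el_closed *)
qed

section \<open>The generators and differentials of the resolution\<close>

text \<open>With \<open>c = \<plusminus>1\<close>, \<open>sign_idem c\<close> is \<open>\<delta>\<^sub>e \<otimes> (1 + c t)/2\<close> for the reflection \<open>t\<close>; in characteristic 3 the
  factor \<open>1/2\<close> is \<open>-1\<close>. The differentials are \<open>\<delta>\<^sub>e \<otimes> (s - s\<^sup>2)\<close> and \<open>\<delta>\<^sub>e \<otimes> (1 + s + s\<^sup>2)\<close> for the rotation
  \<open>s\<close> by 1. The difference \<open>s - s\<^sup>2\<close> is used in place of \<open>1 - s\<close>, as conjugation by \<open>t\<close> just changes its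
  sign.\<close>

definition sign_idem :: "'k::field \<Rightarrow> 'a \<times> 'a \<Rightarrow> 'k" where
  "sign_idem \<sigma>' = at_unit (\<lambda>k. if k = el 0 0 then -1 else if k = el 0 1 then - \<sigma>' else 0)"
definition rot_diff :: "'a \<times> 'a \<Rightarrow> 'k::field" where
  "rot_diff = at_unit (\<lambda>k. if k = el 1 0 then 1 else if k = el (-1) 0 then -1 else 0)"
definition rot_norm :: "'a \<times> 'a \<Rightarrow> 'k::field" where
  "rot_norm = at_unit (\<lambda>k. if k = el 0 0 \<or> k = el 1 0 \<or> k = el (-1) 0 then 1 else 0)"

lemma sign_idem_closed [simp]: "sign_idem c \<in> carrier D" and rot_diff_closed [simp]: "rot_diff \<in> carrier D" 
  and rot_norm_closed [simp]: "rot_norm \<in> carrier D"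
  by (simp_all add: sign_idem_def rot_diff_def rot_norm_def)

lemma L_sign_idem:
  assumes \<phi>: "\<phi> \<in> carrier L"
  shows "(sign_idem c \<odot>\<^bsub>L\<^esub> \<phi>) (x, y) = (if commuting x y then - \<phi> (x, y) - c * \<phi> (conj_by (el 0 1) x, conj_by (el 0 1) y) else 0)"
proof -
  have "conj_by (el 0 0) x = x" if "x \<in> carrier G" for x using that by (simp flip: el_one)
  then show ?thesis
    unfolding sign_idem_def L_smult_at_unit[OF \<phi>] sum_el commuting_def by simp
qed

lemma L_rot_diff:
  assumes \<phi>: "\<phi> \<in> carrier L"
  shows "(rot_diff \<odot>\<^bsub>L\<^esub> \<phi>) (x, y) = (if commuting x y then \<phi> (conj_by (el 1 0) x, conj_by (el 1 0) y)
     - \<phi> (conj_by (el (-1) 0) x, conj_by (el (-1) 0) y) else 0)"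
  unfolding rot_diff_def L_smult_at_unit[OF \<phi>] sum_el commuting_def by simp

lemma L_rot_norm:
  assumes \<phi>: "\<phi> \<in> carrier L"
  shows "(rot_norm \<odot>\<^bsub>L\<^esub> \<phi>) (x, y) = (if commuting x y then \<phi> (x, y) + \<phi> (conj_by (el 1 0) x, conj_by (el 1 0) y)
     + \<phi> (conj_by (el (-1) 0) x, conj_by (el (-1) 0) y) else 0)"
proof -
  have "conj_by (el 0 0) x = x" if "x \<in> carrier G" for x using that by (simp flip: el_one)
  then show ?thesis
    unfolding rot_norm_def L_smult_at_unit[OF \<phi>] sum_el commuting_def by simp
qed

lemma supp_comm_smult:
  assumes "\<phi> \<in> carrier L" 
  shows "supp_comm (sign_idem c \<odot>\<^bsub>L\<^esub> \<phi>)" "supp_comm (rot_diff \<odot>\<^bsub>L\<^esub> \<phi>)" "supp_comm (rot_norm \<odot>\<^bsub>L\<^esub> \<phi>)"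
  using assms by (simp_all add: supp_comm_def L_sign_idem L_rot_diff L_rot_norm)

lemma L_sign_idem_rot_pair: "\<phi> \<in> carrier L \<Longrightarrow> (sign_idem c \<odot>\<^bsub>L\<^esub> \<phi>) (rot_pair v) = - \<phi> (rot_pair v) - c * \<phi> (rot_pair (- v))"
  by (simp add: rot_pair_def L_sign_idem commuting_rot_pair conj_by_ref_rot)
lemma L_sign_idem_refl_pair: "\<phi> \<in> carrier L \<Longrightarrow> (sign_idem c \<odot>\<^bsub>L\<^esub> \<phi>) (refl_pair a v) = - \<phi> (refl_pair a v) - c * \<phi> (refl_pair (- a) v)"
  by (simp add: refl_pair_def L_sign_idem commuting_refl_el conj_by_ref_refl_el)
text \<open>Rotations act trivially on pairs of rotations. Hence the first differential vanishes there, and the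
  second one is multiplication by 3.\<close>

lemma L_rot_diff_rot_pair: "\<phi> \<in> carrier L \<Longrightarrow> (rot_diff \<odot>\<^bsub>L\<^esub> \<phi>) (rot_pair v) = 0"
  by (simp add: rot_pair_def L_rot_diff commuting_rot_pair conj_by_rot_rot)
lemma L_rot_diff_refl_pair: "\<phi> \<in> carrier L \<Longrightarrow> (rot_diff \<odot>\<^bsub>L\<^esub> \<phi>) (refl_pair a v) = \<phi> (refl_pair (a + 1) v) - \<phi> (refl_pair (a - 1) v)"
  by (simp add: refl_pair_def L_rot_diff commuting_refl_el conj_by_rot_refl_el)
lemma L_rot_norm_rot_pair: "\<phi> \<in> carrier L \<Longrightarrow> (rot_norm \<odot>\<^bsub>L\<^esub> \<phi>) (rot_pair v) = \<phi> (rot_pair v) + \<phi> (rot_pair v) + \<phi> (rot_pair v)"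
  by (simp add: rot_pair_def L_rot_norm commuting_rot_pair conj_by_rot_rot)
lemma L_rot_norm_refl_pair: "\<phi> \<in> carrier L \<Longrightarrow> (rot_norm \<odot>\<^bsub>L\<^esub> \<phi>) (refl_pair a v) = \<phi> (refl_pair a v) + \<phi> (refl_pair (a + 1) v) + \<phi> (refl_pair (a - 1) v)"
  by (simp add: refl_pair_def L_rot_norm commuting_refl_el conj_by_rot_refl_el)

lemma mult_at_unit_shifted: 
  assumes f: "f \<in> carrier D"
  shows "f \<otimes>\<^bsub>D\<^esub> at_unit c = at_unit (\<lambda>y. \<Sum>k\<in>carrier G. c k * f (\<one>, y \<otimes> inv k))"
proof -
  have "(\<Sum>b\<in>carrier G. f (\<one>, b) * c (inv b \<otimes> y)) = (\<Sum>k\<in>carrier G. c k * f (\<one>, y \<otimes> inv k))"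
    if "y \<in> carrier G" for y
    by (rule sum.reindex_bij_witness[of _ "\<lambda>k. y \<otimes> inv k" "\<lambda>b. inv b \<otimes> y"])
      (use that in \<open>simp_all add: grp mult.commute\<close>)
  then show ?thesis unfolding mult_at_unit[OF f] by (simp add: at_unit_def fun_eq_iff)
qed

lemma at_unit_ext: "(\<And>a b. c (el a b) = c' (el a b)) \<Longrightarrow> at_unit c = at_unit c'"
proof -
  assume eq: "\<And>a b. c (el a b) = c' (el a b)"
  have "c y = c' y" if "y \<in> carrier G" for y using el_cases[OF that] eq by metis
  then show ?thesis unfolding at_unit_def by (intro ext) auto
qed

lemma at_unit_el [simp]: "at_unit c (\<one>, el a b) = c (el a b)" by (simp add: at_unit_def)

lemma D_sign_idem: assumes f: "f \<in> carrier D" shows "f \<otimes>\<^bsub>D\<^esub> sign_idem c = at_unit (\<lambda>y. - f (\<one>, y) - c * f (\<one>, y \<otimes> el 0 1))"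
  unfolding sign_idem_def mult_at_unit_shifted[OF f] sum_el by (rule at_unit_ext) simp
lemma D_rot_diff: assumes f: "f \<in> carrier D" shows "f \<otimes>\<^bsub>D\<^esub> rot_diff = at_unit (\<lambda>y. f (\<one>, y \<otimes> el (-1) 0) - f (\<one>, y \<otimes> el 1 0))"
  unfolding rot_diff_def mult_at_unit_shifted[OF f] sum_el by (rule at_unit_ext) simp
lemma D_rot_norm: assumes f: "f \<in> carrier D" shows "f \<otimes>\<^bsub>D\<^esub> rot_norm = at_unit (\<lambda>y. f (\<one>, y) + f (\<one>, y \<otimes> el (-1) 0) + f (\<one>, y \<otimes> el 1 0))"
  unfolding rot_norm_def mult_at_unit_shifted[OF f] sum_el by (rule at_unit_ext) simp

end

section \<open>The periodic resolution in characteristic 3\<close>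

locale sym3_char3 = sym3 G el for G :: "'a monoid" (structure) and el +
  fixes K :: "'k::field itself"
  assumes three: "(3 :: 'k) = 0"
begin

lemma two_k: "(2 :: 'k) = - 1"
proof -
  have "(2 :: 'k) + 1 = 0" using three by simp
  then show ?thesis by (simp add: eq_neg_iff_add_eq_0 del: one_add_one)
qed

lemma triple_k: "x + x + x = (0 :: 'k)"
proof -
  have "x + x + x = 3 * x" by simp
  then show ?thesis using three by simp
qed

lemma double_k: "x + x = - (x :: 'k)"
  using triple_k[of x] by (simp add: eq_neg_iff_add_eq_0)

lemma minus_minus_k: "- x - y = x \<longleftrightarrow> x = (y :: 'k)"
proof -
  have "- x - y = x \<longleftrightarrow> x + x + y = 0" by (auto simp: algebra_simps eq_neg_iff_add_eq_0)
  then show ?thesis unfolding double_k by auto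
qed

text \<open>Elements of the double of the form \<open>\<delta>\<^sub>e \<otimes> c\<close>; to compare two of them, six coefficients suffice.\<close>

definition unit_part :: "('a \<times> 'a \<Rightarrow> 'k) \<Rightarrow> bool" where "unit_part f \<longleftrightarrow> (\<exists>c. f = at_unit c)"

lemma unit_part_at_unit [simp]: "unit_part (at_unit c)" by (auto simp: unit_part_def)

lemma unit_part_ext:
  assumes "unit_part f" "unit_part g" "f (\<one>, el 0 0) = g (\<one>, el 0 0)" "f (\<one>, el 1 0) = g (\<one>, el 1 0)"
    "f (\<one>, el (-1) 0) = g (\<one>, el (-1) 0)" "f (\<one>, el 0 1) = g (\<one>, el 0 1)" 
    "f (\<one>, el 1 1) = g (\<one>, el 1 1)" "f (\<one>, el (-1) 1) = g (\<one>, el (-1) 1)"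
  shows "f = g"
proof -
  obtain c c' where c: "f = at_unit c" "g = at_unit c'" using assms(1,2) unfolding unit_part_def by auto
  have "\<forall>a b. c (el a b) = c' (el a b)"
    using assms(3-) unfolding c by (simp add: all_3 all_2)
  then show ?thesis unfolding c by (intro at_unit_ext) blast
qed

lemma unit_part_mult [simp]: "f \<in> carrier D \<Longrightarrow> unit_part (f \<otimes>\<^bsub>D\<^esub> sign_idem c)" "f \<in> carrier D \<Longrightarrow> unit_part (f \<otimes>\<^bsub>D\<^esub> rot_diff)" 
  "f \<in> carrier D \<Longrightarrow> unit_part (f \<otimes>\<^bsub>D\<^esub> rot_norm)"
  by (simp_all add: D_sign_idem D_rot_diff D_rot_norm)

lemma unit_part_basic [simp]: "unit_part (sign_idem c)" "unit_part rot_diff" "unit_part rot_norm"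
  by (simp_all add: sign_idem_def rot_diff_def rot_norm_def)

lemma mult_sign_idem_el [simp]: "f \<in> carrier D \<Longrightarrow> (f \<otimes>\<^bsub>D\<^esub> sign_idem c) (\<one>, el a b) = - f (\<one>, el a b) - c * f (\<one>, el a (b + 1))"
  by (simp add: D_sign_idem)
lemma mult_rot_diff_el [simp]: "f \<in> carrier D \<Longrightarrow> (f \<otimes>\<^bsub>D\<^esub> rot_diff) (\<one>, el a b) = 
    f (\<one>, el (a + (if b = 0 then -1 else 1)) b) - f (\<one>, el (a + (if b = 0 then 1 else -1)) b)"
  by (simp add: D_rot_diff)
lemma mult_rot_norm_el [simp]: "f \<in> carrier D \<Longrightarrow> (f \<otimes>\<^bsub>D\<^esub> rot_norm) (\<one>, el a b) = 
    f (\<one>, el a b) + f (\<one>, el (a + (if b = 0 then -1 else 1)) b) + f (\<one>, el (a + (if b = 0 then 1 else -1)) b)"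
  by (simp add: D_rot_norm)

lemma basic_el [simp]: 
  "sign_idem c (\<one>, el a b) = (if a = 0 \<and> b = 0 then -1 else if a = 0 \<and> b = 1 then - c else 0)"
  "rot_diff (\<one>, el a b) = (if a = 1 \<and> b = 0 then 1 else if a = -1 \<and> b = 0 then -1 else 0)"
  "rot_norm (\<one>, el a b) = (if b = 0 then 1 else 0)"
  using all_3[of "\<lambda>a. a = 0 \<or> a = 1 \<or> a = -1"] by (auto simp: sign_idem_def rot_diff_def rot_norm_def)

lemma sign_idem_idem:
  assumes "c * c = (1 :: 'k)" shows "sign_idem c \<otimes>\<^bsub>D\<^esub> sign_idem c = sign_idem c"
  by (rule unit_part_ext) (simp_all add: assms two_k)

lemma sign_idem_rot_diff: "sign_idem (- c) \<otimes>\<^bsub>D\<^esub> rot_diff = rot_diff \<otimes>\<^bsub>D\<^esub> sign_idem (c :: 'k)"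
  by (rule unit_part_ext) simp_all

lemma sign_idem_rot_norm: "sign_idem c \<otimes>\<^bsub>D\<^esub> rot_norm = rot_norm \<otimes>\<^bsub>D\<^esub> sign_idem (c :: 'k)"
  by (rule unit_part_ext) simp_all

lemma rot_diff_rot_norm: "rot_diff \<otimes>\<^bsub>D\<^esub> rot_norm = (\<lambda>_. 0 :: 'k)" "rot_norm \<otimes>\<^bsub>D\<^esub> rot_diff = (\<lambda>_. 0 :: 'k)"
proof -
  have z: "unit_part (\<lambda>_. 0)" unfolding unit_part_def by (rule exI[of _ "\<lambda>_. 0"]) (auto simp: at_unit_def)
  show "rot_diff \<otimes>\<^bsub>D\<^esub> rot_norm = (\<lambda>_. 0 :: 'k)" "rot_norm \<otimes>\<^bsub>D\<^esub> rot_diff = (\<lambda>_. 0 :: 'k)"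
    by (rule unit_part_ext; simp add: z)+
qed

lemma sign_idem_fixed:
  assumes c: "c * c = (1 :: 'k)" and f: "f \<in> carrier D" "f \<otimes>\<^bsub>D\<^esub> sign_idem c = f"
  shows "unit_part f" "f (\<one>, el a 1) = c * f (\<one>, el a 0)"
proof -
  show "unit_part f" using unit_part_mult(1)[OF f(1), of c] f(2) by simp
  have "- f (\<one>, el a 1) - c * f (\<one>, el a 0) = f (\<one>, el a 1)"
    using mult_sign_idem_el[OF f(1), of c a 1] f(2) by simp
  then show "f (\<one>, el a 1) = c * f (\<one>, el a 0)" by (simp add: minus_minus_k)
qed

text \<open>An element of the left ideal is given by its three coefficients at rotations. If \<open>s - s\<^sup>2\<close> kills it, these
  agree, and it is the image under \<open>1 + s + s\<^sup>2\<close> of the element that has this coefficient at 1 and the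
  coefficient 0 at the other two rotations.\<close>

lemma exact_rot_norm:
  assumes c: "c * c = (1 :: 'k)" and f: "f \<in> carrier D" "f \<otimes>\<^bsub>D\<^esub> sign_idem c = f" 
    and fX: "f \<otimes>\<^bsub>D\<^esub> rot_diff = (\<lambda>_. 0)"
  shows "\<exists>y\<in>carrier D. y \<otimes>\<^bsub>D\<^esub> sign_idem c = y \<and> f = y \<otimes>\<^bsub>D\<^esub> rot_norm"
proof -
  note F = sign_idem_fixed[OF c f]
  let ?x = "f (\<one>, el 0 0)"
  have 0: "f (\<one>, el (-1) 0) = f (\<one>, el 1 0)"
    using mult_rot_diff_el[OF f(1), of 0 0] fX by simp
  have 1: "?x = f (\<one>, el (-1) 0)"
    using mult_rot_diff_el[OF f(1), of 1 0] fX by simp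
  let ?y = "at_unit (\<lambda>k. if k = el 0 0 then ?x else if k = el 0 1 then c * ?x else 0)"
  have "?y \<otimes>\<^bsub>D\<^esub> sign_idem c = ?y"
    by (rule unit_part_ext) (simp_all add: minus_minus_k c three flip: mult.assoc)
  moreover have "f = ?y \<otimes>\<^bsub>D\<^esub> rot_norm"
    by (rule unit_part_ext) (simp_all add: F 0 1 three)
  ultimately show ?thesis by (intro bexI[of _ ?y]) simp_all
qed

text \<open>If the coefficients \<open>x\<^sub>0, x\<^sub>1, x\<^sub>2\<close> at rotations sum to 0, then a preimage under \<open>s - s\<^sup>2\<close> has the coefficients
  \<open>0, x\<^sub>2, -x\<^sub>1\<close>. It lies in the left ideal of the opposite sign.\<close>

lemma exact_rot_diff:
  assumes c: "c * c = (1 :: 'k)" and f: "f \<in> carrier D" "f \<otimes>\<^bsub>D\<^esub> sign_idem c = f" 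
    and f0: "f (\<one>, el 0 0) + f (\<one>, el 1 0) + f (\<one>, el (-1) 0) = 0"
  shows "\<exists>y\<in>carrier D. y \<otimes>\<^bsub>D\<^esub> sign_idem (- c) = y \<and> f = y \<otimes>\<^bsub>D\<^esub> rot_diff"
proof -
  note F = sign_idem_fixed[OF c f]
  let ?x = "f (\<one>, el 1 0)" and ?z = "f (\<one>, el (-1) 0)"
  let ?y = "at_unit (\<lambda>k. if k = el 1 0 then ?z else if k = el (-1) 0 then - ?x 
    else if k = el 1 1 then - (c * ?z) else if k = el (-1) 1 then c * ?x else 0)"
  have x0: "f (\<one>, el 0 0) = - ?x - ?z" using f0 by (simp add: algebra_simps eq_neg_iff_add_eq_0)
  have "?y \<otimes>\<^bsub>D\<^esub> sign_idem (- c) = ?y"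
    by (rule unit_part_ext) (simp_all add: c three flip: mult.assoc)
  moreover have "f = ?y \<otimes>\<^bsub>D\<^esub> rot_diff"
    by (rule unit_part_ext) (simp_all add: F x0 three algebra_simps)
  ultimately show ?thesis by (intro bexI[of _ ?y]) simp_all
qed

text \<open>The signs of the idempotents \<open>+ - - +\<close>: they change after each even degree, where the differential is
  \<open>s - s\<^sup>2\<close>.\<close>

definition period_sign :: "nat \<Rightarrow> 'k" where
  "period_sign n = (if n mod 4 = 0 \<or> n mod 4 = 3 then 1 else -1)"

definition period_del :: "nat \<Rightarrow> 'a \<times> 'a \<Rightarrow> 'k" where "period_del n = (if even n then rot_diff else rot_norm)"

lemma period_sign_sq [simp]: "period_sign n * period_sign n = 1" by (simp add: period_sign_def)

lemma period_sign_sq' [simp]: "period_sign n * (period_sign n * x) = x" by (simp flip: mult.assoc)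

lemma period_sign_Suc: "period_sign (Suc n) = (if even n then - period_sign n else period_sign n)"
proof -
  have "n mod 4 = 0 \<or> n mod 4 = 1 \<or> n mod 4 = 2 \<or> n mod 4 = 3" by presburger
  moreover have "Suc n mod 4 = (if n mod 4 = 3 then 0 else Suc (n mod 4))" by presburger
  moreover have "even n \<longleftrightarrow> n mod 4 = 0 \<or> n mod 4 = 2" by presburger
  ultimately show ?thesis by (auto simp: period_sign_def)
qed

lemma period_sign_0 [simp]: "period_sign 0 = 1" by (simp add: period_sign_def)

lemma trivial_module_simps [simp]:
  "carrier (trivial_double_module G) = UNIV" "\<zero>\<^bsub>trivial_double_module G\<^esub> = 0"
  "f \<odot>\<^bsub>trivial_double_module G\<^esub> x = double_counit G f * x"
  by (simp_all add: trivial_double_module_def)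

lemma double_counit_sign_idem: "double_counit G (sign_idem 1) = (1 :: 'k)"
  and double_counit_rot_diff: "double_counit G rot_diff = (0 :: 'k)"
  and double_counit_one: "double_counit G (x \<odot>\<^bsub>D\<^esub> \<one>\<^bsub>D\<^esub>) = (x :: 'k)"
proof -
  show "double_counit G (sign_idem 1) = (1 :: 'k)" "double_counit G rot_diff = (0 :: 'k)"
    unfolding double_counit_def sum_el by (simp_all add: two_k)
  have "double_counit G (x \<odot>\<^bsub>D\<^esub> \<one>\<^bsub>D\<^esub>) = (\<Sum>b\<in>carrier G. if b = \<one> then x else 0)"
    unfolding double_counit_def by (rule sum.cong) (simp_all add: D_one)
  then show "double_counit G (x \<odot>\<^bsub>D\<^esub> \<one>\<^bsub>D\<^esub>) = x" by simp
qed

text \<open>Exactness in degree 0 is a case of \<open>exact_rot_diff\<close>: on the left ideal of sign \<open>+\<close>, the counit is twice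
  the sum of the coefficients at rotations.\<close>

lemma double_cyclic_resolution:
  assumes res: "projective_resolution (D :: ('k, _) module) P d e (trivial_double_module G)"
  shows "cyclic_resolution_algebra (D :: ('k, _) module) L (trivial_double_module G) P d e
     (\<lambda>n. sign_idem (period_sign n)) period_del 1"
proof -
  have N: "left_module (D :: ('k, _) module) (trivial_double_module G)"
    using res by (simp add: projective_resolution_def)
  have R: "ring (D :: ('k, _) module)" using N by (simp add: left_module_def)
  show ?thesis
  proof (intro cyclic_resolution_algebra.intro cyclic_resolution.intro cyclic_resolution_axioms.intro
      cyclic_resolution_algebra_axioms.intro left_mod_of_left_module[OF L_module[OF R]] 
      left_mod_of_left_module[OF N] res)
    fix n
    show "sign_idem (period_sign n) \<in> carrier D" "period_del n \<in> carrier D" by (simp_all add: period_del_def)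
    show "sign_idem (period_sign n) \<otimes>\<^bsub>D\<^esub> sign_idem (period_sign n) = sign_idem (period_sign n)" by (simp add: sign_idem_idem)
    show "sign_idem (period_sign (Suc n)) \<otimes>\<^bsub>D\<^esub> period_del n = period_del n \<otimes>\<^bsub>D\<^esub> sign_idem (period_sign n)"
      by (simp add: period_sign_Suc period_del_def sign_idem_rot_diff sign_idem_rot_norm)
    show "period_del (Suc n) \<otimes>\<^bsub>D\<^esub> period_del n = \<zero>\<^bsub>D\<^esub>" by (simp add: period_del_def rot_diff_rot_norm)
    show "1 \<in> carrier (trivial_double_module G)" by simp
    show "sign_idem (period_sign 0) \<odot>\<^bsub>trivial_double_module G\<^esub> 1 = (1 :: 'k)"
      "period_del 0 \<odot>\<^bsub>trivial_double_module G\<^esub> 1 = \<zero>\<^bsub>trivial_double_module G\<^esub>"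
      by (simp_all add: double_counit_sign_idem double_counit_rot_diff period_del_def)
    show "\<exists>a\<in>carrier D. z = a \<odot>\<^bsub>trivial_double_module G\<^esub> 1" for z :: 'k
      by (rule bexI[OF _ D_scalar[of z]]) (simp add: double_counit_one del: D_ops)
    fix f :: "'a \<times> 'a \<Rightarrow> 'k" assume f: "f \<in> carrier D"
    { assume fE: "f \<otimes>\<^bsub>D\<^esub> sign_idem (period_sign 0) = f" and f1: "f \<odot>\<^bsub>trivial_double_module G\<^esub> 1 = \<zero>\<^bsub>trivial_double_module G\<^esub>"
      have c1: "(1 :: 'k) * 1 = 1" by simp
      have fE1: "f \<otimes>\<^bsub>D\<^esub> sign_idem 1 = f" using fE by simp
      note F = sign_idem_fixed(2)[OF c1 f fE1]
      let ?S = "f (\<one>, el 0 0) + f (\<one>, el 1 0) + f (\<one>, el (-1) 0)"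
      have "?S + ?S = 0" using f1 unfolding trivial_module_simps double_counit_def sum_el F by (simp add: algebra_simps)
      then have "?S = 0" unfolding double_k by (simp only: neg_equal_0_iff_equal)
      then have "\<exists>y\<in>carrier D. y \<otimes>\<^bsub>D\<^esub> sign_idem (- 1) = y \<and> f = y \<otimes>\<^bsub>D\<^esub> rot_diff"
        by (rule exact_rot_diff[OF c1 f fE1])
      then show "\<exists>y\<in>carrier D. y \<otimes>\<^bsub>D\<^esub> sign_idem (period_sign 1) = y \<and> f = y \<otimes>\<^bsub>D\<^esub> period_del 0"
        by (simp add: period_del_def period_sign_def) }
    { assume fE: "f \<otimes>\<^bsub>D\<^esub> sign_idem (period_sign (Suc n)) = f" and fd: "f \<otimes>\<^bsub>D\<^esub> period_del n = \<zero>\<^bsub>D\<^esub>"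
      show "\<exists>y\<in>carrier D. y \<otimes>\<^bsub>D\<^esub> sign_idem (period_sign (Suc (Suc n))) = y \<and> f = y \<otimes>\<^bsub>D\<^esub> period_del (Suc n)"
      proof (cases "even n")
        case True
        then have "f \<otimes>\<^bsub>D\<^esub> rot_diff = (\<lambda>_. 0)" using fd by (simp add: period_del_def)
        then have "\<exists>y\<in>carrier D. y \<otimes>\<^bsub>D\<^esub> sign_idem (period_sign (Suc n)) = y \<and> f = y \<otimes>\<^bsub>D\<^esub> rot_norm"
          by (rule exact_rot_norm[OF period_sign_sq f fE])
        then show ?thesis using True by (simp add: period_del_def period_sign_Suc[of "Suc n"])
      next
        case False
        then have fN: "f \<otimes>\<^bsub>D\<^esub> rot_norm = (\<lambda>_. 0)" using fd by (simp add: period_del_def)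
        have "f (\<one>, el 0 0) + f (\<one>, el 1 0) + f (\<one>, el (-1) 0) = (f \<otimes>\<^bsub>D\<^esub> rot_norm) (\<one>, el 0 0)"
          using f by (simp add: add_ac)
        also have "\<dots> = 0" unfolding fN ..
        finally have "\<exists>y\<in>carrier D. y \<otimes>\<^bsub>D\<^esub> sign_idem (- period_sign (Suc n)) = y \<and> f = y \<otimes>\<^bsub>D\<^esub> rot_diff"
          by (rule exact_rot_diff[OF period_sign_sq f fE])
        then show ?thesis using False by (simp add: period_del_def period_sign_Suc[of "Suc n"])
      qed }
  next
    show "k \<odot>\<^bsub>D\<^esub> \<one>\<^bsub>D\<^esub> \<in> carrier D" for k :: 'k by (rule D_scalar)
    show "(k \<odot>\<^bsub>D\<^esub> \<one>\<^bsub>D\<^esub>) \<otimes>\<^bsub>D\<^esub> a = a \<otimes>\<^bsub>D\<^esub> (k \<odot>\<^bsub>D\<^esub> \<one>\<^bsub>D\<^esub>)" if "a \<in> carrier D" for a and k :: 'k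
      unfolding D_scalar_left[OF that] D_scalar_right[OF that] ..
  qed
qed

lemma supp_comm_zero: "supp_comm (\<lambda>_. 0 :: 'k)" by (simp add: supp_comm_def)

lemma sign_idem_fix_iff:
  assumes v: "v \<in> carrier L" and c: "c * c = (1 :: 'k)"
  shows "sign_idem c \<odot>\<^bsub>L\<^esub> v = v \<longleftrightarrow> supp_comm v \<and> (\<forall>w. v (rot_pair (- w)) = c * v (rot_pair w)) \<and>
    (\<forall>a w. w \<noteq> 0 \<longrightarrow> v (refl_pair (- a) w) = c * v (refl_pair a w))"
proof -
  have c': "x = c * y \<longleftrightarrow> y = c * x" for x y using c by (metis mult.assoc mult_1)
  have 1: "(sign_idem c \<odot>\<^bsub>L\<^esub> v) (rot_pair w) = v (rot_pair w) \<longleftrightarrow> v (rot_pair (- w)) = c * v (rot_pair w)" for w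
    unfolding L_sign_idem_rot_pair[OF v] minus_minus_k by (rule c')
  have 2: "(sign_idem c \<odot>\<^bsub>L\<^esub> v) (refl_pair a w) = v (refl_pair a w) \<longleftrightarrow> v (refl_pair (- a) w) = c * v (refl_pair a w)" for a w
    unfolding L_sign_idem_refl_pair[OF v] minus_minus_k by (rule c')
  show ?thesis
  proof
    assume eq: "sign_idem c \<odot>\<^bsub>L\<^esub> v = v"
    show "supp_comm v \<and> (\<forall>w. v (rot_pair (- w)) = c * v (rot_pair w)) \<and> (\<forall>a w. w \<noteq> 0 \<longrightarrow> v (refl_pair (- a) w) = c * v (refl_pair a w))"
      using supp_comm_smult(1)[OF v, of c] 1 2 unfolding eq by blast
  next
    assume "supp_comm v \<and> (\<forall>w. v (rot_pair (- w)) = c * v (rot_pair w)) \<and> (\<forall>a w. w \<noteq> 0 \<longrightarrow> v (refl_pair (- a) w) = c * v (refl_pair a w))"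
    then show "sign_idem c \<odot>\<^bsub>L\<^esub> v = v"
      using 1 2 by (intro L_ext[OF supp_comm_smult(1)[OF v]]) blast+
  qed
qed

lemma rot_diff_zero_iff:
  assumes v: "v \<in> carrier L"
  shows "rot_diff \<odot>\<^bsub>L\<^esub> v = (\<lambda>_. 0 :: 'k) \<longleftrightarrow> (\<forall>a w. w \<noteq> 0 \<longrightarrow> v (refl_pair (a + 1) w) = v (refl_pair (a - 1) w))"
proof
  assume "rot_diff \<odot>\<^bsub>L\<^esub> v = (\<lambda>_. 0)"
  then show "\<forall>a w. w \<noteq> 0 \<longrightarrow> v (refl_pair (a + 1) w) = v (refl_pair (a - 1) w)" 
    using L_rot_diff_refl_pair[OF v] by (metis eq_iff_diff_eq_0)
next
  assume "\<forall>a w. w \<noteq> 0 \<longrightarrow> v (refl_pair (a + 1) w) = v (refl_pair (a - 1) w)"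
  then show "rot_diff \<odot>\<^bsub>L\<^esub> v = (\<lambda>_. 0)"
    by (intro L_ext[OF supp_comm_smult(2)[OF v] supp_comm_zero]) (simp_all add: L_rot_diff_rot_pair[OF v] L_rot_diff_refl_pair[OF v])
qed

lemma rot_norm_zero_iff:
  assumes v: "v \<in> carrier L"
  shows "rot_norm \<odot>\<^bsub>L\<^esub> v = (\<lambda>_. 0 :: 'k) \<longleftrightarrow> (\<forall>a w. w \<noteq> 0 \<longrightarrow> v (refl_pair a w) + v (refl_pair (a + 1) w) + v (refl_pair (a - 1) w) = 0)"
proof
  assume "rot_norm \<odot>\<^bsub>L\<^esub> v = (\<lambda>_. 0)"
  then show "\<forall>a w. w \<noteq> 0 \<longrightarrow> v (refl_pair a w) + v (refl_pair (a + 1) w) + v (refl_pair (a - 1) w) = 0" 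
    using L_rot_norm_refl_pair[OF v] by metis
next
  assume "\<forall>a w. w \<noteq> 0 \<longrightarrow> v (refl_pair a w) + v (refl_pair (a + 1) w) + v (refl_pair (a - 1) w) = 0"
  then show "rot_norm \<odot>\<^bsub>L\<^esub> v = (\<lambda>_. 0)"
    by (intro L_ext[OF supp_comm_smult(3)[OF v] supp_comm_zero]) 
      (simp_all add: L_rot_norm_rot_pair[OF v] L_rot_norm_refl_pair[OF v] three)
qed

end

section \<open>The cohomology of the commuting pairs\<close>

locale double_resolution = sym3_char3 G el K
  for G :: "'a monoid" (structure) and el and K :: "'k::field itself" +
  fixes P :: "nat \<Rightarrow> ('a \<times> 'a \<Rightarrow> 'k, 'p) module" and d :: "nat \<Rightarrow> 'p \<Rightarrow> 'p" and e :: "'p \<Rightarrow> 'k"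
  assumes res: "projective_resolution (drinfeld_double G) P d e (trivial_double_module G)"
begin

sublocale C: cyclic_resolution_algebra "drinfeld_double G :: ('k, 'a \<times> 'a \<Rightarrow> 'k) module" "dual_double G" 
    "trivial_double_module G" P d e "\<lambda>n. sign_idem (period_sign n)" period_del 1
  by (rule double_cyclic_resolution[OF res])

text \<open>On pairs of rotations the only condition is to be even or odd. On the other pairs, the cocycle
  condition relates the three values \<open>v (refl_pair a w)\<close> for fixed \<open>w\<close>.\<close>

lemma eps_cocycles_iff: "v \<in> C.eps_cocycles n \<longleftrightarrow> supp_comm v \<and> (\<forall>w. v (rot_pair (- w)) = period_sign n * v (rot_pair w)) \<and>
    (\<forall>a w. w \<noteq> 0 \<longrightarrow> v (refl_pair (- a) w) = period_sign n * v (refl_pair a w)) \<and>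
    (\<forall>a w. w \<noteq> 0 \<longrightarrow> (if even n then v (refl_pair (a + 1) w) = v (refl_pair (a - 1) w)
       else v (refl_pair a w) + v (refl_pair (a + 1) w) + v (refl_pair (a - 1) w) = 0))"
proof (cases "supp_comm v")
  case True
  then have v: "v \<in> carrier L" by (rule supp_comm_L)
  show ?thesis
    using v True unfolding C.eps_cocycles_def mem_Collect_eq sign_idem_fix_iff[OF v period_sign_sq] L_ops period_del_def
    by (cases "even n") (simp_all add: rot_diff_zero_iff[OF v] rot_norm_zero_iff[OF v])
next
  case False
  then show ?thesis using sign_idem_fix_iff[of v "period_sign n"] by (auto simp: C.eps_cocycles_def)
qed

lemma three_cases: 
  fixes Q :: "3 \<Rightarrow> bool" assumes "Q 0" "Q 1" "Q (-1)" shows "Q a"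
  using assms all_3[of Q] by blast

text \<open>In positive degree, a cocycle is a coboundary exactly when it vanishes on pairs of rotations. It
  suffices to construct a preimage separately for every \<open>w\<close>. Write \<open>v\<^sub>a\<close> for \<open>v (refl_pair a w)\<close>. For
  \<open>s - s\<^sup>2\<close>, where the three values sum to 0, the preimage \<open>0, -v\<^sub>2, v\<^sub>1\<close> has the right sign because the reflection
  \<open>a \<mapsto> -a\<close> exchanges the indices 1 and 2. For \<open>1 + s + s\<^sup>2\<close>, where the three values agree, it is
  \<open>v\<^sub>0, 0, 0\<close>.\<close>

lemma eps_coboundaries_iff:
  assumes v: "v \<in> C.eps_cocycles (Suc n)"
  shows "v \<in> C.eps_coboundaries (Suc n) \<longleftrightarrow> (\<forall>w. v (rot_pair w) = 0)"
proof
  assume "v \<in> C.eps_coboundaries (Suc n)"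
  then obtain y where y: "y \<in> carrier L" "v = period_del n \<odot>\<^bsub>L\<^esub> y" by auto
  then show "\<forall>w. v (rot_pair w) = 0"
    by (cases "even n") (simp_all add: period_del_def L_rot_diff_rot_pair L_rot_norm_rot_pair three)
next
  assume al0: "\<forall>w. v (rot_pair w) = 0"
  have sv: "supp_comm v" and vs: "\<And>a w. w \<noteq> 0 \<Longrightarrow> v (refl_pair (- a) w) = period_sign (Suc n) * v (refl_pair a w)"
    using v unfolding eps_cocycles_iff by blast+
  have "\<exists>y. supp_comm y \<and> sign_idem (period_sign n) \<odot>\<^bsub>L\<^esub> y = y \<and> v = period_del n \<odot>\<^bsub>L\<^esub> y"
  proof (cases "even n")
    case True
    have vN: "v (refl_pair 0 w) + v (refl_pair 1 w) + v (refl_pair (-1) w) = 0" if "w \<noteq> 0" for w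
      using v that True unfolding eps_cocycles_iff by (metis add_0 diff_0 even_Suc)
    obtain y where y: "supp_comm y" "\<And>w. y (rot_pair w) = 0"
      "\<And>a w. w \<noteq> 0 \<Longrightarrow> y (refl_pair a w) = (if a = 0 then 0 else if a = 1 then - v (refl_pair (-1) w) else v (refl_pair 1 w))"
      using L_construct[of "\<lambda>_. 0" "\<lambda>a w. if a = 0 then 0 else if a = 1 then - v (refl_pair (-1) w) else v (refl_pair 1 w)"]
      by metis
    have yL: "y \<in> carrier L" using y(1) by (rule supp_comm_L)
    have "y (refl_pair (- a) w) = period_sign n * y (refl_pair a w)" if w: "w \<noteq> 0" for a w
      by (rule three_cases[where Q = "\<lambda>a. y (refl_pair (- a) w) = period_sign n * y (refl_pair a w)"])
        (use vs[OF w, of 1] vs[OF w, of "-1"] True in \<open>simp_all add: y(3)[OF w] period_sign_Suc\<close>)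
    then have "sign_idem (period_sign n) \<odot>\<^bsub>L\<^esub> y = y" unfolding sign_idem_fix_iff[OF yL period_sign_sq] using y by simp
    moreover have "v = rot_diff \<odot>\<^bsub>L\<^esub> y"
    proof (rule L_ext[OF sv supp_comm_smult(2)[OF yL]])
      show "v (rot_pair w) = (rot_diff \<odot>\<^bsub>L\<^esub> y) (rot_pair w)" for w using al0 by (simp add: L_rot_diff_rot_pair[OF yL])
      show "v (refl_pair a w) = (rot_diff \<odot>\<^bsub>L\<^esub> y) (refl_pair a w)" if w: "w \<noteq> 0" for a w
        unfolding L_rot_diff_refl_pair[OF yL] y(3)[OF w]
        by (rule three_cases[where a = a]) (use vN[OF w] in \<open>simp_all add: eq_neg_iff_add_eq_0 algebra_simps\<close>)
    qed
    ultimately show ?thesis using y(1) True by (auto simp: period_del_def)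
  next
    case False
    have vX: "v (refl_pair (a + 1) w) = v (refl_pair (a - 1) w)" if "w \<noteq> 0" for a w
      using v that False unfolding eps_cocycles_iff by simp
    have vc: "v (refl_pair a w) = v (refl_pair 0 w)" if w: "w \<noteq> 0" for a w
      by (rule three_cases[where a = a]) (use vX[OF w, of 0] vX[OF w, of 1] in simp_all)
    obtain y where y: "supp_comm y" "\<And>w. y (rot_pair w) = 0"
      "\<And>a w. w \<noteq> 0 \<Longrightarrow> y (refl_pair a w) = (if a = 0 then v (refl_pair 0 w) else 0)"
      using L_construct[of "\<lambda>_. 0" "\<lambda>a w. if a = 0 then v (refl_pair 0 w) else 0"] by metis
    have yL: "y \<in> carrier L" using y(1) by (rule supp_comm_L)
    have "y (refl_pair (- a) w) = period_sign n * y (refl_pair a w)" if w: "w \<noteq> 0" for a w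
      using vs[OF w, of 0] False by (simp add: y(3)[OF w] period_sign_Suc)
    then have "sign_idem (period_sign n) \<odot>\<^bsub>L\<^esub> y = y" unfolding sign_idem_fix_iff[OF yL period_sign_sq] using y by simp
    moreover have "v = rot_norm \<odot>\<^bsub>L\<^esub> y"
    proof (rule L_ext[OF sv supp_comm_smult(3)[OF yL]])
      show "v (rot_pair w) = (rot_norm \<odot>\<^bsub>L\<^esub> y) (rot_pair w)" for w using al0 y(2) by (simp add: L_rot_norm_rot_pair[OF yL])
      show "v (refl_pair a w) = (rot_norm \<odot>\<^bsub>L\<^esub> y) (refl_pair a w)" if w: "w \<noteq> 0" for a w
        unfolding L_rot_norm_refl_pair[OF yL] y(3)[OF w] vc[OF w, of a]
        by (rule three_cases[where a = a]) simp_all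
    qed
    ultimately show ?thesis using y(1) False by (auto simp: period_del_def)
  qed
  then show "v \<in> C.eps_coboundaries (Suc n)" using supp_comm_L by auto
qed

abbreviation T_inv :: "int ^ 2 ^ 2" where "T_inv \<equiv> mat22 1 (-1) 0 1"
abbreviation S_inv :: "int ^ 2 ^ 2" where "S_inv \<equiv> mat22 0 1 (-1) 0"

lemma T_inv: "T_mat ** T_inv = mat 1" "T_inv ** T_mat = mat 1"
  and S_inv: "S_mat ** S_inv = mat 1" "S_inv ** S_mat = mat 1"
  by (simp_all add: T_mat_eq S_mat_eq mat22_mult mat22_one)

text \<open>Compatibility of \<open>\<pi>\<close> with every substitution of exponents by an invertible matrix; both \<open>T\<close> and \<open>S\<close> are
  instances.\<close>

definition equivariant :: "(('a \<times> 'a \<Rightarrow> 'k) \<Rightarrow> 'w) \<Rightarrow> (int ^ 2 ^ 2 \<Rightarrow> 'w \<Rightarrow> 'w) \<Rightarrow> bool" where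
  "equivariant \<pi> act \<longleftrightarrow> (\<forall>A B \<phi> \<psi>. A ** B = mat 1 \<and> B ** A = mat 1 \<and> \<phi> \<in> carrier L \<and>
     (\<forall>v. \<psi> (rot_pair v) = \<phi> (rot_pair (mat_act B v))) \<and> (\<forall>a v. \<psi> (refl_pair a v) = \<phi> (refl_pair a (mat_act B v))) \<longrightarrow> \<pi> \<psi> = act A (\<pi> \<phi>))"

text \<open>What remains for a given degree: a map \<open>\<pi>\<close> from \<open>L\<close> to the asserted module that is linear and
  equivariant, and that has the coboundaries as kernel and the whole module as image on cocycles.\<close>

lemma torus_rep:
  fixes WR :: "(int ^ 2 ^ 2, 'k, 'w) rep"
  assumes W: "linear_rep SL2Z WR"
    and \<pi>_closed: "\<And>x. x \<in> carrier L \<Longrightarrow> \<pi> x \<in> carrier (fst WR)"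
    and \<pi>_add: "\<And>x y. x \<in> carrier L \<Longrightarrow> y \<in> carrier L \<Longrightarrow> \<pi> (\<lambda>z. x z + y z) = \<pi> x \<oplus>\<^bsub>fst WR\<^esub> \<pi> y"
    and \<pi>_smult: "\<And>k x. x \<in> carrier L \<Longrightarrow> \<pi> (\<lambda>z. k * x z) = k \<odot>\<^bsub>fst WR\<^esub> \<pi> x"
    and ker: "\<And>v. v \<in> C.eps_cocycles m \<Longrightarrow> \<pi> v = \<zero>\<^bsub>fst WR\<^esub> \<longleftrightarrow> v \<in> C.eps_coboundaries m"
    and onto: "\<And>w. w \<in> carrier (fst WR) \<Longrightarrow> \<exists>v\<in>C.eps_cocycles m. \<pi> v = w"
    and equiv: "equivariant \<pi> (snd WR)"
  shows "\<exists>\<rho>. torus_action G P d m \<rho>"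
    and "torus_action G P d m \<rho> \<Longrightarrow> rep_iso SL2Z (Ext_space (drinfeld_double G) P d m (dual_double G), \<rho>) WR"
proof -
  obtain W act where WR: "WR = (W, act)" by (cases WR)
  let ?Z = "Ext_space (drinfeld_double G) P d m (dual_double G)"
  let ?E = "Ext_map (drinfeld_double G) P d m (dual_double G) (dual_double G)"
  have mW: "module ring_of_type_algebra W" using W by (simp add: WR linear_rep_iff)
  have "\<exists>\<Psi>. module ring_of_type_algebra ?Z \<and> module_hom ring_of_type_algebra ?Z W \<Psi> \<and>
    bij_betw \<Psi> (carrier ?Z) (carrier W) \<and> 
    (\<forall>g A C. module_hom D L L g \<longrightarrow> (\<forall>x\<in>carrier L. \<pi> (g x) = act A (\<pi> x)) \<longrightarrow> C \<in> carrier ?Z \<longrightarrow>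
       ?E g C \<in> carrier ?Z \<and> \<Psi> (?E g C) = act A (\<Psi> C))"
  proof (rule C.Ext_iso[where W = W and \<pi> = \<pi> and m = m, OF mW])
    fix \<Psi>
    assume 1: "module ring_of_type_algebra ?Z" "module_hom ring_of_type_algebra ?Z W \<Psi>"
      "bij_betw \<Psi> (carrier ?Z) (carrier W)"
      and 2: "\<And>g act C. module_hom D L L g \<Longrightarrow> (\<And>x. x \<in> carrier L \<Longrightarrow> \<pi> (g x) = act (\<pi> x)) \<Longrightarrow> C \<in> carrier ?Z \<Longrightarrow>
       ?E g C \<in> carrier ?Z \<and> \<Psi> (?E g C) = act (\<Psi> C)"
    show ?thesis
    proof (intro exI[of _ \<Psi>] conjI 1 allI impI)
      fix g A C assume "module_hom D L L g" "\<forall>x\<in>carrier L. \<pi> (g x) = act A (\<pi> x)" "C \<in> carrier ?Z"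
      then show "?E g C \<in> carrier ?Z" "\<Psi> (?E g C) = act A (\<Psi> C)"
        using 2[of g "act A" C] by blast+
    qed
  qed (use \<pi>_closed \<pi>_add \<pi>_smult ker onto in \<open>simp_all add: WR L_scalar del: D_ops\<close>)
  then obtain \<Psi> where Z: "module ring_of_type_algebra ?Z" and hom: "module_hom ring_of_type_algebra ?Z W \<Psi>"
    and bij: "bij_betw \<Psi> (carrier ?Z) (carrier W)"
    and E: "\<And>g A C. module_hom D L L g \<Longrightarrow> \<forall>x\<in>carrier L. \<pi> (g x) = act A (\<pi> x) \<Longrightarrow> C \<in> carrier ?Z \<Longrightarrow>
       ?E g C \<in> carrier ?Z \<and> \<Psi> (?E g C) = act A (\<Psi> C)"
    by blast
  have "\<forall>x\<in>carrier L. \<pi> (T_map G x) = act T_mat (\<pi> x)"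
    using equiv T_inv T_map_rot_pair T_map_refl_pair unfolding equivariant_def WR snd_conv by blast
  note T = E[OF T_map_hom this]
  have "\<forall>x\<in>carrier L. \<pi> (S_map G x) = act S_mat (\<pi> x)"
    using equiv S_inv S_map_rot_pair S_map_refl_pair unfolding equivariant_def WR snd_conv by blast
  note S = E[OF S_map_hom this]
  note R = rep_via_generators[OF W[unfolded WR] Z hom bij T S]
  show "\<exists>\<rho>. torus_action G P d m \<rho>"
    using R(1) by (simp add: torus_action_def Let_def)
  show "rep_iso SL2Z (?Z, \<rho>) WR" if "torus_action G P d m \<rho>"
    using R(2)[of \<rho>] that by (simp add: torus_action_def Let_def WR)
qed

lemma perm_rep_simps [simp]: "fst (perm_rep a I) = span_on I" 
  "snd (perm_rep a I) g = lin_ext (\<lambda>x. basis_vec (a g x))"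
  by (simp_all add: perm_rep_def)

lemma sum_rep_simps [simp]:
  "carrier (fst (V \<oplus>\<^sub>r W)) = carrier (fst V) \<times> carrier (fst W)"
  "\<zero>\<^bsub>fst (V \<oplus>\<^sub>r W)\<^esub> = (\<zero>\<^bsub>fst V\<^esub>, \<zero>\<^bsub>fst W\<^esub>)"
  "p \<oplus>\<^bsub>fst (V \<oplus>\<^sub>r W)\<^esub> q = (fst p \<oplus>\<^bsub>fst V\<^esub> fst q, snd p \<oplus>\<^bsub>fst W\<^esub> snd q)"
  "k \<odot>\<^bsub>fst (V \<oplus>\<^sub>r W)\<^esub> p = (k \<odot>\<^bsub>fst V\<^esub> fst p, k \<odot>\<^bsub>fst W\<^esub> snd p)"
  "snd (V \<oplus>\<^sub>r W) g p = (snd V g (fst p), snd W g (snd p))"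
  by (simp_all add: rep_sum_def case_prod_unfold)

lemma trivial_rep_simps [simp]:
  "carrier (fst trivial_rep) = UNIV" "\<zero>\<^bsub>fst trivial_rep\<^esub> = 0" "x \<oplus>\<^bsub>fst trivial_rep\<^esub> y = x + y"
  "k \<odot>\<^bsub>fst trivial_rep\<^esub> x = k * x" "snd trivial_rep g x = x"
  by (simp_all add: trivial_rep_def)

lemma line_sum_closed: "line_sum F \<in> carrier (span_on (proj_line :: ('n::{comm_ring_1, finite} ^ 2) set set))"
  by (simp add: span_on_carrier line_sum_def)

lemma line_sum_eq_zero_3:
  assumes F: "\<And>v. F (- v) = F v" and z: "line_sum F = (\<lambda>_. 0 :: 'k)" and v: "v \<noteq> (0 :: 3 ^ 2)"
  shows "F v = 0"
proof -
  have "F v + F v = 0" using line_sum_3[OF v, of F] F z by simp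
  then show ?thesis unfolding double_k by simp
qed

lemma line_sum_eq_zero_2:
  assumes z: "line_sum F = (\<lambda>_. 0 :: 'k)" and v: "v \<noteq> (0 :: 2 ^ 2)"
  shows "F v = 0"
  using line_sum_2[OF v, of F] z by simp

lemma line_sum_construct_3:
  assumes w: "w \<in> carrier (span_on (proj_line :: (3 ^ 2) set set))" 
    and F: "\<And>v. v \<noteq> 0 \<Longrightarrow> F v = - w {0, v, - v}"
  shows "line_sum F = (w :: _ \<Rightarrow> 'k)"
proof
  fix l
  show "line_sum F l = w l"
  proof (cases "l \<in> proj_line")
    case True
    then obtain v where v: "v \<noteq> 0" "l = {0, v, - v}" unfolding proj_line_3 by blast
    have "F v + F (- v) = - w l + - w l" using v F[of v] F[of "- v"] by (simp add: insert_commute)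
    then show ?thesis using v line_sum_3[OF v(1), of F] double_k[of "- w l"] by simp
  next
    case False
    then show ?thesis using w by (simp add: line_sum_def span_on_carrier)
  qed
qed

lemma line_sum_construct_2:
  assumes w: "w \<in> carrier (span_on (proj_line :: (2 ^ 2) set set))" 
    and F: "\<And>v. v \<noteq> 0 \<Longrightarrow> F v = w {0, v}"
  shows "line_sum F = (w :: _ \<Rightarrow> 'k)"
proof
  fix l
  show "line_sum F l = w l"
  proof (cases "l \<in> proj_line")
    case True
    then obtain v where v: "v \<noteq> 0" "l = {0, v}" unfolding proj_line_2 by blast
    then show ?thesis using line_sum_2[OF v(1), of F] F by simp
  next
    case False
    then show ?thesis using w by (simp add: line_sum_def span_on_carrier)
  qed
qed

lemma line_sum_equivariant_pullback:
  fixes F F' :: "'n::{comm_ring_1, finite} ^ 2 \<Rightarrow> 'k"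
  assumes "A ** B = mat 1" "B ** A = mat 1" "\<And>v. F' v = F (mat_act B v)"
  shows "line_sum F' = lin_ext (\<lambda>l. basis_vec (mat_act A ` l)) (line_sum F)"
proof -
  have "F' = (\<lambda>v. F (mat_act B v))" using assms(3) by blast
  then show ?thesis using line_sum_equivariant[OF assms(1,2), of F] by simp
qed

text \<open>In degree 0, a cocycle is an invariant function. It consists of the value at the pair of units, the
  common function on the pairs of powers of each reflection, and an even function on the pairs of
  rotations.\<close>

theorem torus_degree_0:
  "\<exists>\<rho>. torus_action G P d 0 \<rho>"
  "torus_action G P d 0 \<rho> \<Longrightarrow> rep_iso SL2Z (Ext_space (drinfeld_double G) P d 0 (dual_double G), \<rho>)
     (trivial_rep \<oplus>\<^sub>r proj_line_rep TYPE(2) \<oplus>\<^sub>r proj_line_rep TYPE(3))"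
proof -
  let ?W = "trivial_rep \<oplus>\<^sub>r proj_line_rep TYPE(2) \<oplus>\<^sub>r proj_line_rep TYPE(3) :: (_, 'k, _) rep"
  define \<pi> :: "('a \<times> 'a \<Rightarrow> 'k) \<Rightarrow> _" where
    "\<pi> = (\<lambda>\<phi>. (\<phi> (rot_pair 0), line_sum (\<lambda>v. \<phi> (refl_pair 0 v)), line_sum (\<lambda>v. \<phi> (rot_pair v))))"
  have W: "linear_rep SL2Z ?W"
    by (intro linear_rep_sum linear_rep_trivial linear_rep_proj_line)
  have c: "\<pi> x \<in> carrier (fst ?W)" for x
    by (simp add: \<pi>_def proj_line_rep_def line_sum_closed)
  have a: "\<pi> (\<lambda>z. x z + y z) = \<pi> x \<oplus>\<^bsub>fst ?W\<^esub> \<pi> y" for x y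
    by (simp add: \<pi>_def proj_line_rep_def fun_eq_iff line_sum_add)
  have s: "\<pi> (\<lambda>z. k * x z) = k \<odot>\<^bsub>fst ?W\<^esub> \<pi> x" for k x
    by (simp add: \<pi>_def proj_line_rep_def fun_eq_iff line_sum_scale)
  have k: "\<pi> v = \<zero>\<^bsub>fst ?W\<^esub> \<longleftrightarrow> v \<in> C.eps_coboundaries 0" if v: "v \<in> C.eps_cocycles 0" for v
  proof
    assume "\<pi> v = \<zero>\<^bsub>fst ?W\<^esub>"
    then have z: "v (rot_pair 0) = 0" "line_sum (\<lambda>w. v (refl_pair 0 w)) = (\<lambda>_. 0)" "line_sum (\<lambda>w. v (rot_pair w)) = (\<lambda>_. 0)"
      by (simp_all add: \<pi>_def proj_line_rep_def)
    have rot_pair: "v (rot_pair (- w)) = v (rot_pair w)" and X: "\<And>a. w' \<noteq> 0 \<Longrightarrow> v (refl_pair (a + 1) w') = v (refl_pair (a - 1) w')" for w w'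
      using v unfolding eps_cocycles_iff by simp_all
    have "v = (\<lambda>_. 0)"
    proof (rule L_ext[OF _ supp_comm_zero])
      show "supp_comm v" using v unfolding eps_cocycles_iff by blast
      show "v (rot_pair w) = 0" for w
        using z(1) line_sum_eq_zero_3[of "\<lambda>w. v (rot_pair w)" w, OF rot_pair z(3)] by (cases "w = 0") simp_all
      show "v (refl_pair a w) = 0" if w: "w \<noteq> 0" for a w
      proof -
        have "v (refl_pair 0 w) = 0" by (rule line_sum_eq_zero_2[OF z(2) w])
        then show ?thesis
          by (rule three_cases[where a = a, rotated 0]) (use X[OF w, of 1] X[OF w, of 0] \<open>v (refl_pair 0 w) = 0\<close> in simp_all)
      qed
    qed
    then show "v \<in> C.eps_coboundaries 0" by simp
  next
    assume "v \<in> C.eps_coboundaries 0"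
    then have v0: "v z = 0" for z by simp
    show "\<pi> v = \<zero>\<^bsub>fst ?W\<^esub>" by (simp add: \<pi>_def proj_line_rep_def line_sum_def fun_eq_iff v0)
  qed
  have o: "\<exists>v\<in>C.eps_cocycles 0. \<pi> v = w" if w: "w \<in> carrier (fst ?W)" for w
  proof -
    obtain x w2 w3 where weq: "w = (x, w2, w3)" by (cases w)
    have w2: "w2 \<in> carrier (span_on (proj_line :: (2 ^ 2) set set))"
      and w3: "w3 \<in> carrier (span_on (proj_line :: (3 ^ 2) set set))"
      using w by (simp_all add: weq proj_line_rep_def)
    obtain v where v: "supp_comm v" "\<And>u. v (rot_pair u) = (if u = 0 then x else - w3 {0, u, - u})"
      "\<And>a u. u \<noteq> 0 \<Longrightarrow> v (refl_pair a u) = w2 {0, u}"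
      using L_construct[of "\<lambda>u. if u = 0 then x else - w3 {0, u, - u}" "\<lambda>a u. w2 {0, u}"] by metis
    have "v \<in> C.eps_cocycles 0" unfolding eps_cocycles_iff using v by (simp add: insert_commute)
    moreover have "\<pi> v = w"
      using v line_sum_construct_3[OF w3] line_sum_construct_2[OF w2] by (simp add: \<pi>_def weq)
    ultimately show ?thesis by blast
  qed
  have eq: "equivariant \<pi> (snd ?W)"
    unfolding equivariant_def \<pi>_def by (auto simp: proj_line_rep_def intro!: line_sum_equivariant_pullback)
  note R = torus_rep[where \<pi> = \<pi> and WR = ?W, OF W c a s k o eq]
  show "\<exists>\<rho>. torus_action G P d 0 \<rho>" by (rule R(1))
  show "rep_iso SL2Z (Ext_space (drinfeld_double G) P d 0 (dual_double G), \<rho>) ?W"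
    if "torus_action G P d 0 \<rho>"
    by (rule R(2)[OF _ _ that])
qed

text \<open>In positive degree, only the functions on pairs of rotations survive; for sign \<open>+\<close> they are even.\<close>

theorem torus_positive_sign:
  assumes m: "m > 0" "period_sign m = 1"
  shows "\<exists>\<rho>. torus_action G P d m \<rho>"
  "torus_action G P d m \<rho> \<Longrightarrow> rep_iso SL2Z (Ext_space (drinfeld_double G) P d m (dual_double G), \<rho>)
     (trivial_rep \<oplus>\<^sub>r proj_line_rep TYPE(3))"
proof -
  let ?W = "trivial_rep \<oplus>\<^sub>r proj_line_rep TYPE(3) :: (_, 'k, _) rep"
  obtain n where n: "m = Suc n" using m(1) gr0_implies_Suc by blast
  define \<pi> :: "('a \<times> 'a \<Rightarrow> 'k) \<Rightarrow> _" where
    "\<pi> = (\<lambda>\<phi>. (\<phi> (rot_pair 0), line_sum (\<lambda>v. \<phi> (rot_pair v))))"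
  have W: "linear_rep SL2Z ?W"
    by (intro linear_rep_sum linear_rep_trivial linear_rep_proj_line)
  have c: "\<pi> x \<in> carrier (fst ?W)" for x
    by (simp add: \<pi>_def proj_line_rep_def line_sum_closed)
  have a: "\<pi> (\<lambda>z. x z + y z) = \<pi> x \<oplus>\<^bsub>fst ?W\<^esub> \<pi> y" for x y
    by (simp add: \<pi>_def proj_line_rep_def fun_eq_iff line_sum_add)
  have s: "\<pi> (\<lambda>z. k * x z) = k \<odot>\<^bsub>fst ?W\<^esub> \<pi> x" for k x
    by (simp add: \<pi>_def proj_line_rep_def fun_eq_iff line_sum_scale)
  have k: "\<pi> v = \<zero>\<^bsub>fst ?W\<^esub> \<longleftrightarrow> v \<in> C.eps_coboundaries m" if v: "v \<in> C.eps_cocycles m" for v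
  proof
    assume "\<pi> v = \<zero>\<^bsub>fst ?W\<^esub>"
    then have z: "v (rot_pair 0) = 0" "line_sum (\<lambda>w. v (rot_pair w)) = (\<lambda>_. 0)"
      by (simp_all add: \<pi>_def proj_line_rep_def)
    have rot_pair: "v (rot_pair (- w)) = v (rot_pair w)" for w
      using v m(2) unfolding eps_cocycles_iff by simp
    have "v (rot_pair w) = 0" for w
      using z(1) line_sum_eq_zero_3[of "\<lambda>w. v (rot_pair w)" w, OF rot_pair z(2)] by (cases "w = 0") simp_all
    then show "v \<in> C.eps_coboundaries m" using eps_coboundaries_iff v unfolding n by blast
  next
    assume "v \<in> C.eps_coboundaries m"
    then have "v (rot_pair w) = 0" for w using eps_coboundaries_iff v unfolding n by blast
    then show "\<pi> v = \<zero>\<^bsub>fst ?W\<^esub>" by (simp add: \<pi>_def proj_line_rep_def line_sum_def fun_eq_iff)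
  qed
  have o: "\<exists>v\<in>C.eps_cocycles m. \<pi> v = w" if w: "w \<in> carrier (fst ?W)" for w
  proof -
    obtain x w3 where weq: "w = (x, w3)" by (cases w)
    have w3: "w3 \<in> carrier (span_on (proj_line :: (3 ^ 2) set set))"
      using w by (simp_all add: weq proj_line_rep_def)
    obtain v where v: "supp_comm v" "\<And>u. v (rot_pair u) = (if u = 0 then x else - w3 {0, u, - u})"
      "\<And>a u. u \<noteq> 0 \<Longrightarrow> v (refl_pair a u) = 0"
      using L_construct[of "\<lambda>u. if u = 0 then x else - w3 {0, u, - u}" "\<lambda>a u. 0"] by metis
    have "v \<in> C.eps_cocycles m" unfolding eps_cocycles_iff using v m(2) by (simp add: insert_commute)
    moreover have "\<pi> v = w"
      using v line_sum_construct_3[OF w3] by (simp add: \<pi>_def weq)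
    ultimately show ?thesis by blast
  qed
  have eq: "equivariant \<pi> (snd ?W)"
    unfolding equivariant_def \<pi>_def by (auto simp: proj_line_rep_def intro!: line_sum_equivariant_pullback)
  note R = torus_rep[where \<pi> = \<pi> and WR = ?W, OF W c a s k o eq]
  show "\<exists>\<rho>. torus_action G P d m \<rho>" by (rule R(1))
  show "rep_iso SL2Z (Ext_space (drinfeld_double G) P d m (dual_double G), \<rho>) ?W"
    if "torus_action G P d m \<rho>"
    by (rule R(2)[OF _ _ that])
qed

text \<open>For sign \<open>-\<close> the functions on pairs of rotations are odd; in particular they vanish at 0.\<close>

theorem torus_negative_sign:
  assumes m: "m > 0" "period_sign m = - 1"
  shows "\<exists>\<rho>. torus_action G P d m \<rho>"
  "torus_action G P d m \<rho> \<Longrightarrow> rep_iso SL2Z (Ext_space (drinfeld_double G) P d m (dual_double G), \<rho>)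
     twisted_proj_line_rep"
proof -
  let ?W = "twisted_proj_line_rep :: (_, 'k, _) rep"
  obtain n where n: "m = Suc n" using m(1) gr0_implies_Suc by blast
  \<comment> \<open>Antisymmetrizing makes \<open>\<pi>\<close> map all of \<open>L\<close> into the twisted space; on odd functions it is
    multiplication by \<open>-2 = 1\<close>, hence the plain restriction.\<close>
  define \<pi> :: "('a \<times> 'a \<Rightarrow> 'k) \<Rightarrow> _" where "\<pi> = (\<lambda>\<phi> v. \<phi> (rot_pair (- v)) - \<phi> (rot_pair v))"
  have W: "linear_rep SL2Z ?W" by (rule linear_rep_twisted)
  have c: "\<pi> x \<in> carrier (fst ?W)" for x
    unfolding twisted_rep_eq fst_conv twisted_carrier by (simp add: \<pi>_def)
  have a: "\<pi> (\<lambda>z. x z + y z) = \<pi> x \<oplus>\<^bsub>fst ?W\<^esub> \<pi> y" for x y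
    by (simp add: \<pi>_def twisted_rep_eq span_on_def fun_eq_iff)
  have s: "\<pi> (\<lambda>z. k * x z) = k \<odot>\<^bsub>fst ?W\<^esub> \<pi> x" for k x
    by (simp add: \<pi>_def twisted_rep_eq span_on_def fun_eq_iff algebra_simps)
  have \<pi>v: "\<pi> v = (\<lambda>u. v (rot_pair u))" if v: "v \<in> C.eps_cocycles m" for v
  proof
    fix u
    have "v (rot_pair (- u)) = - v (rot_pair u)" using v m(2) unfolding eps_cocycles_iff by simp
    then show "\<pi> v u = v (rot_pair u)" using double_k[of "- v (rot_pair u)"] by (simp add: \<pi>_def)
  qed
  have k: "\<pi> v = \<zero>\<^bsub>fst ?W\<^esub> \<longleftrightarrow> v \<in> C.eps_coboundaries m" if v: "v \<in> C.eps_cocycles m" for v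
    using eps_coboundaries_iff v unfolding \<pi>v[OF v] n by (simp add: twisted_rep_eq span_on_def fun_eq_iff)
  have o: "\<exists>v\<in>C.eps_cocycles m. \<pi> v = w" if w: "w \<in> carrier (fst ?W)" for w
  proof -
    have w': "w 0 = 0" "\<And>x. w (- x) = - w x"
      using w unfolding twisted_rep_eq fst_conv twisted_carrier by simp_all
    obtain v where v: "supp_comm v" "\<And>u. v (rot_pair u) = w u" "\<And>a u. u \<noteq> 0 \<Longrightarrow> v (refl_pair a u) = 0"
      using L_construct[of w "\<lambda>a u. 0"] by metis
    have eps_cocycles: "v \<in> C.eps_cocycles m" unfolding eps_cocycles_iff using v m(2) w' by simp
    then show ?thesis using \<pi>v[OF eps_cocycles] v(2) by (intro bexI[OF _ eps_cocycles]) simp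
  qed
  have eq: "equivariant \<pi> (snd ?W)"
    unfolding equivariant_def
  proof (intro allI impI, elim conjE)
    fix A B and \<phi> \<psi> :: "'a \<times> 'a \<Rightarrow> 'k" assume AB: "A ** B = mat 1" "B ** A = mat 1" 
      and "\<forall>v. \<psi> (rot_pair v) = \<phi> (rot_pair (mat_act B v))"
    then show "\<pi> \<psi> = snd ?W A (\<pi> \<phi>)"
      unfolding twisted_rep_eq snd_conv
      by (subst lin_ext_mat_act[OF AB]) (simp_all add: \<pi>_def fun_eq_iff mat_act_minus)
  qed
  note R = torus_rep[where \<pi> = \<pi> and WR = ?W, OF W c a s k o eq]
  show "\<exists>\<rho>. torus_action G P d m \<rho>" by (rule R(1))
  show "rep_iso SL2Z (Ext_space (drinfeld_double G) P d m (dual_double G), \<rho>) ?W"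
    if "torus_action G P d m \<rho>"
    by (rule R(2)[OF _ _ that])
qed

end

section \<open>The symmetric group on three letters as the affine group of the line over Z/3\<close>

text \<open>The representatives of the residues modulo 3 among the letters 1, 2, 3.\<close>

definition of_three :: "3 \<Rightarrow> nat" where "of_three x = (if x = 0 then 3 else if x = 1 then 1 else 2)"

definition aff :: "3 \<Rightarrow> 2 \<Rightarrow> nat \<Rightarrow> nat" where
  "aff a b n = (if n \<in> {1..3} then of_three (a + (if b = 0 then of_nat n else - of_nat n)) else n)"

lemma of_three_mem: "of_three x \<in> {1..3}" by (simp add: of_three_def)

lemma of_nat_of_three [simp]: "of_nat (of_three x) = x"
proof -
  have "\<forall>x. of_nat (of_three x) = x" by (simp add: all_3 of_three_def)
  then show ?thesis by blast
qed

lemma of_three_of_nat: "n \<in> {1..3} \<Longrightarrow> of_three (of_nat n) = n"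
proof -
  assume "n \<in> {1..3}"
  then have "n = 1 \<or> n = 2 \<or> n = 3" by auto
  then show ?thesis by (auto simp: of_three_def)
qed

lemma aff_mult: "aff a b \<circ> aff c d = aff (a + (if b = 0 then c else - c)) (b + d)"
proof -
  have bd: "\<forall>b d :: 2. (b + d = 0) = (b = d)" by (simp add: all_2 two_2)
  have b1: "\<forall>b :: 2. b \<noteq> 0 \<longrightarrow> b = 1" by (simp add: all_2)
  show ?thesis
  proof
    fix n
    show "(aff a b \<circ> aff c d) n = aff (a + (if b = 0 then c else - c)) (b + d) n"
      using of_three_mem b1 by (cases "n \<in> {1..3}") (auto simp: aff_def bd algebra_simps)
  qed
qed

lemma of_three_inj: "of_three x = of_three y \<longleftrightarrow> x = y"
  by (metis of_nat_of_three)

lemma aff_inj: "aff a b = aff c d \<longleftrightarrow> a = c \<and> b = d"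
proof
  assume eq: "aff a b = aff c d"
  have aff3: "aff a b 3 = of_three a" for a b by (cases "b = 0") (simp_all add: aff_def)
  have aff1: "aff a b 1 = of_three (a + (if b = 0 then 1 else - 1))" for a b
    by (cases "b = 0") (simp_all add: aff_def)
  have "aff a b 3 = aff c d 3" "aff a b 1 = aff c d 1" using eq by simp_all
  then have ac: "a = c" and "(if b = 0 then 1 else -1 :: 3) = (if d = 0 then 1 else -1)"
    unfolding aff3 aff1 of_three_inj by simp_all
  then have "(b = 0) = (d = 0)" by (auto split: if_splits)
  moreover have "\<forall>b d :: 2. (b = 0) = (d = 0) \<longrightarrow> b = d" by (simp add: all_2)
  ultimately show "a = c \<and> b = d" using ac by blast
qed simp

lemma aff_zero: "aff 0 0 = id"
  by (rule ext) (simp add: aff_def of_three_of_nat)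

lemma aff_permutes: "aff a b permutes {1..3}"
proof -
  have "\<exists>c d. aff a b \<circ> aff c d = id \<and> aff c d \<circ> aff a b = id"
    by (rule exI[of _ "if b = 0 then - a else a"], rule exI[of _ b]) (simp add: aff_mult aff_zero)
  then have "bij (aff a b)" using o_bij by blast
  moreover have "aff a b n = n" if "n \<notin> {1..3}" for n using that by (auto simp: aff_def)
  ultimately show ?thesis unfolding permutes_def by (metis bij_pointE)
qed

text \<open>There are six affine maps and six permutations.\<close>

lemma sym3_sym_group: "sym3 (sym_group 3) aff"
proof -
  interpret group "sym_group 3" by (rule sym_group_is_group)
  have fin: "finite (carrier (sym_group 3))" by (simp add: sym_group_def finite_permutations)
  have sub: "range (\<lambda>(a, b). aff a b) \<subseteq> carrier (sym_group 3)"
    using aff_permutes by (auto simp: sym_group_def)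
  have "inj (\<lambda>(a, b). aff a b)" by (auto simp: inj_on_def aff_inj)
  then have "card (range (\<lambda>(a, b). aff a b)) = CARD(3 \<times> 2)" by (rule card_image)
  also have "\<dots> = card (carrier (sym_group 3))"
    using card_permutations[of "{1..3 :: nat}" 3] by (simp add: sym_group_def fact_numeral)
  finally have "range (\<lambda>(a, b). aff a b) = carrier (sym_group 3)"
    by (intro card_subset_eq[OF fin sub])
  then show ?thesis
    by unfold_locales (simp_all add: fin sym_group_mult aff_mult aff_inj)
qed

theorem theorem7p7:
  fixes P :: "nat \<Rightarrow> ((nat \<Rightarrow> nat) \<times> (nat \<Rightarrow> nat) \<Rightarrow> 'k::alg_closed_field, 'p) module"
    and d :: "nat \<Rightarrow> 'p \<Rightarrow> 'p" and e :: "'p \<Rightarrow> 'k" and m :: nat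
  assumes char: "CHAR('k) = 3"
    and res: "projective_resolution (drinfeld_double (sym_group 3)) P d e
                (trivial_double_module (sym_group 3))"
  defines "Z \<equiv> Ext_space (drinfeld_double (sym_group 3)) P d m (dual_double (sym_group 3))"
  shows "(\<exists>\<rho>. torus_action (sym_group 3) P d m \<rho>) \<and>
    (\<forall>\<rho>. torus_action (sym_group 3) P d m \<rho> \<longrightarrow>
      (m = 0 \<longrightarrow> rep_iso SL2Z (Z, \<rho>)
         (trivial_rep \<oplus>\<^sub>r proj_line_rep TYPE(2) \<oplus>\<^sub>r proj_line_rep TYPE(3))) \<and>
      (m > 0 \<and> (m mod 4 = 0 \<or> m mod 4 = 3) \<longrightarrow> rep_iso SL2Z (Z, \<rho>)
         (trivial_rep \<oplus>\<^sub>r proj_line_rep TYPE(3))) \<and>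
      (m > 0 \<and> (m mod 4 = 1 \<or> m mod 4 = 2) \<longrightarrow> rep_iso SL2Z (Z, \<rho>) twisted_proj_line_rep))"
proof -
  interpret sym3 "sym_group 3" aff by (rule sym3_sym_group)
  have "of_nat CHAR('k) = (0 :: 'k)" by (rule of_nat_CHAR)
  then have three: "(3 :: 'k) = 0" by (simp add: char)
  interpret double_resolution "sym_group 3" aff "TYPE('k)" P d e
    by unfold_locales (fact three, fact res)
  show ?thesis
  proof (cases "m = 0")
    case True
    then show ?thesis unfolding Z_def using torus_degree_0 by simp
  next
    case False
    show ?thesis
    proof (cases "m mod 4 = 0 \<or> m mod 4 = 3")
      case True
      then have "period_sign m = 1" by (simp add: period_sign_def)
      then show ?thesis unfolding Z_def using torus_positive_sign[of m] False True by auto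
    next
      case False2: False
      then have "period_sign m = - 1" by (simp add: period_sign_def)
      then show ?thesis unfolding Z_def using torus_negative_sign[of m] False False2 by auto
    qed
  qed
qed

end
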